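(* Let $n\ge3$ and fix $r>0$. The Riemannian manifold $(\bar X_r,\bar g)$ satisfies: (a) The scalar curvature satisfies $R_{\bar g}\ge\frac12[z(r,\theta)]^2-C_{n,r}$ for a constant $C_{n,r}>0$ depending only on $n$ and $r$. In particular, $R_{\bar g}>-n(n-1)$ provided that $p\in\mathbb{H}^2$ is chosen to have a large enough $z$-coordinate. (b) Under the obvious identification (isometry) between $Y_{p,r}$ and $\bar Y_r$, we have $\bar H_r>H_{p,r}$ provided that the $z$-coordinate of $p$ is large enough.
   Context: Let $\mathbb{H}^2=\{(x,z):z>0\}$ with metric $z^{-2}(dz^2+dx^2)$, and let $\mathbb{H}^n/\mathbb{Z}^{n-2}=\mathbb{H}^2\times\mathbb{T}^{n-2}$ with the hyperbolic metric $g_H=z^{-2}(dz^2+dx^2)+z^{-2}g_{\mathbb{T}^{n-2}}$, where $g_{\mathbb{T}^{n-2}}$ is the flat metric on $\mathbb{T}^{n-2}=\mathbb{R}^{n-2}/2\pi\mathbb{Z}^{n-2}$. For $p\in\mathbb{H}^2$, let $(\varrho,\theta)$ be geodesic polar coordinates on $\mathbb{H}^2$ centered at $p$, so that the metric is $d\varrho^2+\sinh^2\varrho\,d\theta^2$, and regard $z=z(\varrho,\theta)$ as a function of these coordinates. Let $\mathbb{D}_r(p)\subset\mathbb{H}^2$ be the geodesic disc of radius $r$ centered at $p$, $X_{p,r}=\mathbb{D}_r(p)\times\mathbb{T}^{n-2}\subset\mathbb{H}^n/\mathbb{Z}^{n-2}$ and $Y_{p,r}=\partial X_{p,r}$. $H_{p,r}$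 is the mean curvature of $Y_{p,r}\subset(X_{p,r},g_H)$. Let $\mathcal{D}$ be a $2$-disc with polar coordinates $(\bar\varrho,\bar\theta)$, $0\le\bar\varrho\le\pi/3$, $0\le\bar\theta<2\pi$, and metric $g_{\mathcal{D}}=d\bar\varrho^2+4\sin^2(\bar\varrho/2)\,d\bar\theta^2$. Let $\bar X_r=\mathbb{S}^1\times\mathcal{D}\times\mathbb{T}^{n-3}$, with $\theta$ the coordinate on $\mathbb{S}^1$ (period $2\pi$), equipped with the metric $$\bar g=\sinh^2r\,d\theta^2+(z(r,\theta))^{-2}g_{\mathcal{D}}+(z(r,\theta))^{-2}g_{\mathbb{T}^{n-3}},$$ where $g_{\mathbb{T}^{n-3}}$ is the flat metric on $\mathbb{R}^{n-3}/2\pi\mathbb{Z}^{n-3}$. Let $\bar Y_r=\partial\bar X_r$, and let $\bar H_r$ be the mean curvature of $\bar Y_r\subset(\bar X_r,\bar g)$. The obvious identification of $Y_{p,r}=\partial\mathbb{D}_r(p)\times\mathbb{S}^1\times\mathbb{T}^{n-3}$ with $\bar Y_r=\mathbb{S}^1\times\partial\mathcal{D}\times\mathbb{T}^{n-3}$ matches $\theta$ with $\theta$, the first circle factor of $\mathbb{T}^{n-2}$ with $\bar\theta$, and the $\mathbb{T}^{n-3}$-factors; it is an isometry of the induced metrics. Mean curvatures are with respect to outward unit normals (trace of the second fundamental form, positive for round balls in Euclidean space). *)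

theory Defs
  imports "HOL-Analysis.Derivative" "Jordan_Normal_Form.Gauss_Jordan_Elimination"
begin

section \<open>Riemannian geometry in a coordinate chart\<close>

text \<open>
  The dimension \<open>n\<close> is a natural number, so points and vectors are functions \<open>nat \<Rightarrow> real\<close> of
  which only the coordinates \<open>i < n\<close> are relevant, and a metric is given by its components
  \<open>g x i j\<close> with \<open>i, j < n\<close>. Torus and circle factors are represented by their universal covers,
  with \<open>2 * pi\<close>-periodic coordinates ranging over all of \<open>real\<close>; every quantity
  below is local, and all data are periodic in these coordinates.
\<close>

type_synonym point = "nat \<Rightarrow> real"
type_synonym metric = "point \<Rightarrow> nat \<Rightarrow> nat \<Rightarrow> real"

definition partial :: "nat \<Rightarrow> (point \<Rightarrow> real) \<Rightarrow> point \<Rightarrow> real" where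
  "partial i f x = deriv (\<lambda>t. f (x(i := t))) (x i)"

definition inverse_metric :: "nat \<Rightarrow> metric \<Rightarrow> metric" where
  "inverse_metric n g x i j = the (mat_inverse (Matrix.mat n n (\<lambda>(k, l). g x k l))) $$ (i, j)"

definition inner_g :: "nat \<Rightarrow> metric \<Rightarrow> point \<Rightarrow> (nat \<Rightarrow> real) \<Rightarrow> (nat \<Rightarrow> real) \<Rightarrow> real" where
  "inner_g n g x V W = (\<Sum>i<n. \<Sum>j<n. g x i j * V i * W j)"

text \<open>\<open>christoffel n g k i j\<close> is \<open>\<Gamma>\<close> with upper index \<open>k\<close> and lower indices \<open>i, j\<close>.\<close>

definition christoffel :: "nat \<Rightarrow> metric \<Rightarrow> nat \<Rightarrow> nat \<Rightarrow> nat \<Rightarrow> point \<Rightarrow> real" where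
  "christoffel n g k i j x =
     (\<Sum>l<n. inverse_metric n g x k l *
        (partial i (\<lambda>y. g y j l) x + partial j (\<lambda>y. g y i l) x - partial l (\<lambda>y. g y i j) x)) / 2"

text \<open>\<open>riemann n g l k i j\<close> is the \<open>l\<close>-th component of \<open>R(\<partial>\<^sub>i, \<partial>\<^sub>j) \<partial>\<^sub>k\<close>, where
  \<open>R(X, Y) = [\<nabla>\<^sub>X, \<nabla>\<^sub>Y] - \<nabla>\<^bsub>[X, Y]\<^esub>\<close>; with the trace below, round spheres have positive curvature.\<close>

definition riemann :: "nat \<Rightarrow> metric \<Rightarrow> nat \<Rightarrow> nat \<Rightarrow> nat \<Rightarrow> nat \<Rightarrow> point \<Rightarrow> real" where
  "riemann n g l k i j x =
     partial i (christoffel n g l j k) x - partial j (christoffel n g l i k) x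
     + (\<Sum>m<n. christoffel n g l i m x * christoffel n g m j k x
            - christoffel n g l j m x * christoffel n g m i k x)"

definition ricci :: "nat \<Rightarrow> metric \<Rightarrow> nat \<Rightarrow> nat \<Rightarrow> point \<Rightarrow> real" where
  "ricci n g j k x = (\<Sum>i<n. riemann n g i k i j x)"

definition scalar_curvature :: "nat \<Rightarrow> metric \<Rightarrow> point \<Rightarrow> real" where
  "scalar_curvature n g x = (\<Sum>j<n. \<Sum>k<n. inverse_metric n g x j k * ricci n g j k x)"

text \<open>\<open>V\<close> is the velocity of the geodesic \<open>c\<close>, parametrised by the interval \<open>J\<close>.\<close>

definition geodesic :: "nat \<Rightarrow> metric \<Rightarrow> real set \<Rightarrow> (real \<Rightarrow> point) \<Rightarrow> (real \<Rightarrow> nat \<Rightarrow> real) \<Rightarrow> bool" where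
  "geodesic n g J c V \<longleftrightarrow> (\<forall>t\<in>J. \<forall>k<n.
     ((\<lambda>s. c s k) has_real_derivative V t k) (at t within J) \<and>
     ((\<lambda>s. V s k) has_real_derivative
        - (\<Sum>i<n. \<Sum>j<n. christoffel n g k i j (c t) * V t i * V t j)) (at t within J))"

text \<open>Hypersurfaces are parametrised by maps \<open>F\<close> with the parameters \<open>q a\<close>, \<open>a < n - 1\<close>.\<close>

definition induced_metric :: "nat \<Rightarrow> metric \<Rightarrow> (point \<Rightarrow> point) \<Rightarrow> metric" where
  "induced_metric n g F q a b =
     inner_g n g (F q) (\<lambda>i. partial a (\<lambda>s. F s i) q) (\<lambda>i. partial b (\<lambda>s. F s i) q)"

definition outward_unit_normal ::
    "nat \<Rightarrow> metric \<Rightarrow> point set \<Rightarrow> (point \<Rightarrow> point) \<Rightarrow> point \<Rightarrow> (nat \<Rightarrow> real) \<Rightarrow> bool" where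
  "outward_unit_normal n g X F q N \<longleftrightarrow>
     (\<forall>i\<ge>n. N i = 0) \<and>
     (\<forall>a<n - 1. inner_g n g (F q) N (\<lambda>i. partial a (\<lambda>s. F s i) q) = 0) \<and>
     inner_g n g (F q) N N = 1 \<and>
     (\<exists>\<epsilon>>0. \<forall>t. 0 < t \<and> t < \<epsilon> \<longrightarrow>
        (\<lambda>i. F q i - t * N i) \<in> X \<and> (\<lambda>i. F q i + t * N i) \<notin> X)"

text \<open>The components \<open>- g(\<nabla>\<^sub>a \<partial>\<^sub>b F, N)\<close> of the second fundamental form, which equal
  \<open>g(\<nabla>\<^sub>a N, \<partial>\<^sub>b F)\<close>; the sign makes it positive for round balls with outward \<open>N\<close>.\<close>

definition second_fundamental_form ::
    "nat \<Rightarrow> metric \<Rightarrow> (point \<Rightarrow> point) \<Rightarrow> point \<Rightarrow> (nat \<Rightarrow> real) \<Rightarrow> nat \<Rightarrow> nat \<Rightarrow> real" where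
  "second_fundamental_form n g F q N a b =
     - inner_g n g (F q)
         (\<lambda>k. partial a (partial b (\<lambda>s. F s k)) q
            + (\<Sum>i<n. \<Sum>j<n. christoffel n g k i j (F q)
                 * partial a (\<lambda>s. F s i) q * partial b (\<lambda>s. F s j) q))
         N"

definition mean_curvature :: "nat \<Rightarrow> metric \<Rightarrow> point set \<Rightarrow> (point \<Rightarrow> point) \<Rightarrow> point \<Rightarrow> real" where
  "mean_curvature n g X F q =
     (\<Sum>a<n - 1. \<Sum>b<n - 1. inverse_metric (n - 1) (induced_metric n g F) q a b
        * second_fundamental_form n g F q (THE N. outward_unit_normal n g X F q N) a b)"


section \<open>The hyperbolic side\<close>

text \<open>Coordinates: \<open>0\<close> is \<open>x\<close>, \<open>1\<close> is \<open>z\<close>, and \<open>2, \<dots>, n - 1\<close> are the torus coordinates. The same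
  formula gives the metric of the hyperbolic plane, for dimension \<open>2\<close>.\<close>

definition hyperbolic_metric :: metric where
  "hyperbolic_metric x i j = (if i = j then 1 / (x 1)\<^sup>2 else 0)"

text \<open>\<open>\<Phi> \<rho> \<theta> = exp\<^sub>p (\<rho> (cos \<theta> e\<^sub>1 + sin \<theta> e\<^sub>2))\<close> for some orthonormal basis \<open>e\<^sub>1, e\<^sub>2\<close> of the
  tangent plane at \<open>p\<close>. Thus \<open>\<Phi> \<rho> \<theta> 1\<close> is the function \<open>z(\<rho>, \<theta>)\<close>.\<close>

definition geodesic_polar_coordinates :: "point \<Rightarrow> (real \<Rightarrow> real \<Rightarrow> point) \<Rightarrow> bool" where
  "geodesic_polar_coordinates p \<Phi> \<longleftrightarrow> (\<exists>e1 e2.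
     inner_g 2 hyperbolic_metric p e1 e1 = 1 \<and>
     inner_g 2 hyperbolic_metric p e2 e2 = 1 \<and>
     inner_g 2 hyperbolic_metric p e1 e2 = 0 \<and>
     (\<forall>\<theta>. \<exists>V. geodesic 2 hyperbolic_metric {0..} (\<lambda>\<rho>. \<Phi> \<rho> \<theta>) V \<and>
        (\<forall>\<rho>\<ge>0. \<Phi> \<rho> \<theta> 1 > 0) \<and>
        (\<forall>k<2. \<Phi> 0 \<theta> k = p k \<and> V 0 k = cos \<theta> * e1 k + sin \<theta> * e2 k)))"

definition geodesic_disc :: "(real \<Rightarrow> real \<Rightarrow> point) \<Rightarrow> real \<Rightarrow> (real \<times> real) set" where
  "geodesic_disc \<Phi> r = {(\<Phi> \<rho> \<theta> 0, \<Phi> \<rho> \<theta> 1) | \<rho> \<theta>. 0 \<le> \<rho> \<and> \<rho> \<le> r}"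

definition X_hyp :: "(real \<Rightarrow> real \<Rightarrow> point) \<Rightarrow> real \<Rightarrow> point set" where
  "X_hyp \<Phi> r = {x. (x 0, x 1) \<in> geodesic_disc \<Phi> r}"

text \<open>Parameters of the boundary: \<open>q 0\<close> is \<open>\<theta>\<close>, \<open>q 1\<close> is the coordinate of the first circle factor
  of the torus, and the remaining ones are those of the other circle factors.\<close>

definition Y_hyp :: "(real \<Rightarrow> real \<Rightarrow> point) \<Rightarrow> real \<Rightarrow> point \<Rightarrow> point" where
  "Y_hyp \<Phi> r q = (\<lambda>i. if i = 0 then \<Phi> r (q 0) 0 else if i = 1 then \<Phi> r (q 0) 1 else q (i - 1))"


section \<open>The comparison manifold\<close>

text \<open>
  The disc with metric \<open>d\<rho>\<^sup>2 + 4 sin\<^sup>2(\<rho>/2) d\<theta>\<^sup>2\<close>, in the Cartesian coordinates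
  \<open>y 0 = \<rho> cos \<theta>\<close>, \<open>y 1 = \<rho> sin \<theta>\<close>, so that the centre is an ordinary point of the chart. There
  the metric extends smoothly with the Euclidean value; the polar form is recovered in
  \<open>disc_metric_polar\<close> below.
\<close>

definition radius :: "point \<Rightarrow> real" where
  "radius y = sqrt ((y 0)\<^sup>2 + (y 1)\<^sup>2)"

definition d_radius :: "point \<Rightarrow> nat \<Rightarrow> real" where
  "d_radius y i = y i / radius y"

definition d_angle :: "point \<Rightarrow> nat \<Rightarrow> real" where
  "d_angle y i = (if i = 0 then - y 1 else y 0) / (radius y)\<^sup>2"

definition disc_metric :: metric where
  "disc_metric y i j =
     (if radius y = 0 then (if i = j then 1 else 0)
      else d_radius y i * d_radius y j + 4 * (sin (radius y / 2))\<^sup>2 * (d_angle y i * d_angle y j))"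

text \<open>Coordinates of the comparison manifold: \<open>0\<close> is \<open>\<theta>\<close>, \<open>1\<close> and \<open>2\<close> are the Cartesian
  coordinates of the disc, and \<open>3, \<dots>, n - 1\<close> are the torus coordinates.\<close>

definition X_bar :: "point set" where
  "X_bar = {x. radius (\<lambda>i. x (i + 1)) \<le> pi / 3}"

definition g_bar :: "(real \<Rightarrow> real \<Rightarrow> real) \<Rightarrow> real \<Rightarrow> metric" where
  "g_bar z r x i j =
     (if i = 0 \<and> j = 0 then (sinh r)\<^sup>2
      else if i \<in> {1, 2} \<and> j \<in> {1, 2} then
        disc_metric (\<lambda>k. x (k + 1)) (i - 1) (j - 1) / (z r (x 0))\<^sup>2
      else if i = j then 1 / (z r (x 0))\<^sup>2
      else 0)"

text \<open>Parameters of the boundary: \<open>q 0\<close> is \<open>\<theta>\<close>, \<open>q 1\<close> is the angle in the disc, and the remaining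
  ones are the torus coordinates. The identification with \<open>Y_hyp\<close> is equality of parameters.\<close>

definition Y_bar :: "point \<Rightarrow> point" where
  "Y_bar q = (\<lambda>i. if i = 0 then q 0 else if i = 1 then pi / 3 * cos (q 1)
     else if i = 2 then pi / 3 * sin (q 1) else q (i - 1))"


section \<open>Consistency of the definitions\<close>

lemma disc_metric_polar:
  assumes "q 0 > 0"
  defines "P \<equiv> \<lambda>q i. if i = 0 then q 0 * cos (q 1) else q 0 * sin (q 1)"
  shows "induced_metric 2 disc_metric P q 0 0 = 1"
    and "induced_metric 2 disc_metric P q 0 1 = 0"
    and "induced_metric 2 disc_metric P q 1 1 = 4 * (sin (q 0 / 2))\<^sup>2"
proof -
  have rad: "radius (P q) = q 0"
    using assms(1) by (simp add: radius_def P_def power_mult_distrib flip: distrib_left)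
  have d0: "partial 0 (\<lambda>s. P s i) q = (if i = 0 then cos (q 1) else sin (q 1))" for i
    unfolding partial_def P_def by (rule DERIV_imp_deriv) (auto intro!: derivative_eq_intros)
  have d1: "partial 1 (\<lambda>s. P s i) q = (if i = 0 then - q 0 * sin (q 1) else q 0 * cos (q 1))" for i
    unfolding partial_def P_def by (rule DERIV_imp_deriv) (auto intro!: derivative_eq_intros)
  have split: "inner_g 2 disc_metric (P q) V W =
      (\<Sum>i<2. d_radius (P q) i * V i) * (\<Sum>i<2. d_radius (P q) i * W i)
      + 4 * (sin (q 0 / 2))\<^sup>2 * ((\<Sum>i<2. d_angle (P q) i * V i) * (\<Sum>i<2. d_angle (P q) i * W i))"
    for V W
    using assms(1) by (simp add: inner_g_def disc_metric_def rad numeral_2_eq_2 algebra_simps)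
  have P: "P q 0 = q 0 * cos (q 1)" "P q (Suc 0) = q 0 * sin (q 1)"
    by (auto simp: P_def)
  have two: "(\<Sum>i<2. f i) = f 0 + f 1" for f :: "nat \<Rightarrow> real"
    by (simp add: numeral_2_eq_2)
  have sc: "cos (q 1) * cos (q 1) + sin (q 1) * sin (q 1) = 1"
    using sin_cos_squared_add2[of "q 1"] by (simp add: power2_eq_square)
  have cs: "q 0 * cos (q 1) * (q 0 * cos (q 1)) + q 0 * sin (q 1) * (q 0 * sin (q 1)) = (q 0)\<^sup>2"
  proof -
    have "q 0 * cos (q 1) * (q 0 * cos (q 1)) + q 0 * sin (q 1) * (q 0 * sin (q 1))
        = (q 0)\<^sup>2 * (cos (q 1) * cos (q 1) + sin (q 1) * sin (q 1))"
      by (simp only: power2_eq_square ring_distribs mult_ac)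
    then show ?thesis
      using sc by simp
  qed
  have r0: "(\<Sum>i<2. d_radius (P q) i * partial 0 (\<lambda>s. P s i) q) = 1"
    using assms(1) sc unfolding two d0 by (simp add: d_radius_def rad P)
  have r1: "(\<Sum>i<2. d_radius (P q) i * partial 1 (\<lambda>s. P s i) q) = 0"
    using assms(1) unfolding two d1 by (simp add: d_radius_def rad P)
  have a0: "(\<Sum>i<2. d_angle (P q) i * partial 0 (\<lambda>s. P s i) q) = 0"
    using assms(1) unfolding two d0 by (simp add: d_angle_def rad P)
  have a1: "(\<Sum>i<2. d_angle (P q) i * partial 1 (\<lambda>s. P s i) q) = 1"
    using assms(1) cs unfolding two d1 by (simp add: d_angle_def rad P flip: add_divide_distrib)
  show "induced_metric 2 disc_metric P q 0 0 = 1"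
    and "induced_metric 2 disc_metric P q 0 1 = 0"
    and "induced_metric 2 disc_metric P q 1 1 = 4 * (sin (q 0 / 2))\<^sup>2"
    unfolding induced_metric_def split r0 r1 a0 a1 by simp_all
qed

lemma inverse_metric_diagonal:
  assumes g: "\<And>i j. i < n \<Longrightarrow> j < n \<Longrightarrow> g x i j = (if i = j then d i else 0)"
    and d: "\<And>i. i < n \<Longrightarrow> d i \<noteq> 0" and "i < n" "j < n"
  shows "inverse_metric n g x i j = (if i = j then 1 / d i else 0)"
proof -
  define A where "A = Matrix.mat n n (\<lambda>(k, l). g x k l)"
  define B where "B = Matrix.mat n n (\<lambda>(k, l). if k = l then 1 / d k else 0)"
  have A: "A \<in> carrier_mat n n" and B: "B \<in> carrier_mat n n"
    by (auto simp: A_def B_def)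
  have entry: "(if b then u else 0) * (if c then v else 0) = (if b then if c then u * v else 0 else 0)"
    for b c and u v :: real
    by simp
  have AB: "A * B = 1\<^sub>m n" and BA: "B * A = 1\<^sub>m n"
    using d by (auto intro!: eq_matI simp: A_def B_def g scalar_prod_def entry sum.If_cases
        if_distrib[of "\<lambda>u. u * _"] if_distrib[of "\<lambda>u. _ * u"] cong: if_cong)
  obtain C where C: "mat_inverse A = Some C"
    using mat_inverse(1)[OF A, of n] A B AB BA
    by (cases "mat_inverse A") (auto simp: Units_def ring_mat_def)
  then have "A * C = 1\<^sub>m n" "C \<in> carrier_mat n n"
    using mat_inverse(2)[OF A] by auto
  then have "C = B"
    using A B BA by (metis assoc_mult_mat left_mult_one_mat right_mult_one_mat)
  then show ?thesis
    using C assms(3,4) by (simp add: inverse_metric_def A_def[symmetric]) (simp add: B_def)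
qed

text \<open>Polar coordinates exist at every point, so statements quantifying over them are not vacuous.\<close>

lemma geodesic_polar_coordinates_exist:
  assumes p: "p 1 > 0"
  shows "\<exists>\<Phi>. geodesic_polar_coordinates p \<Phi>"
proof -
  define D where "D = (\<lambda>\<rho> \<theta>. cosh \<rho> - sin \<theta> * sinh \<rho> :: real)"
  define \<Phi> :: "real \<Rightarrow> real \<Rightarrow> point" where
    "\<Phi> = (\<lambda>\<rho> \<theta> k. if k = 0 then p 0 + p 1 * cos \<theta> * sinh \<rho> / D \<rho> \<theta> else p 1 / D \<rho> \<theta>)"
  define V :: "real \<Rightarrow> real \<Rightarrow> nat \<Rightarrow> real" where
    "V = (\<lambda>\<theta> \<rho> k. if k = 0 then p 1 * cos \<theta> / (D \<rho> \<theta>)\<^sup>2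
            else - p 1 * (sinh \<rho> - sin \<theta> * cosh \<rho>) / (D \<rho> \<theta>)\<^sup>2)"
  define e1 e2 :: "nat \<Rightarrow> real" where
    "e1 = (\<lambda>k. if k = 0 then p 1 else 0)" and "e2 = (\<lambda>k. if k = 1 then p 1 else 0)"
  have two: "(\<Sum>i<2. f i) = f 0 + f 1" for f :: "nat \<Rightarrow> real"
    by (simp add: numeral_2_eq_2)
  have D: "D \<rho> \<theta> > 0" for \<rho> \<theta>
  proof -
    have "(sinh \<rho>)\<^sup>2 < (cosh \<rho>)\<^sup>2"
      by (simp add: cosh_square_eq)
    then have lt: "\<bar>sinh \<rho>\<bar> < cosh \<rho>"
      by (metis abs_le_square_iff abs_of_nonneg cosh_real_nonneg linorder_not_le power2_abs)
    have "\<bar>sin \<theta> * sinh \<rho>\<bar> \<le> 1 * \<bar>sinh \<rho>\<bar>"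
      unfolding abs_mult by (intro mult_right_mono) auto
    with lt have "sin \<theta> * sinh \<rho> < cosh \<rho>"
      by linarith
    then show ?thesis
      by (simp only: D_def diff_gt_0_iff_gt)
  qed
  have inv: "inverse_metric 2 hyperbolic_metric y k l = (if k = l then (y 1)\<^sup>2 else 0)"
    if "y 1 > 0" "k < 2" "l < 2" for y k l
    using inverse_metric_diagonal[of 2 hyperbolic_metric y "\<lambda>_. 1 / (y 1)\<^sup>2"] that
    by (simp add: hyperbolic_metric_def)
  have par: "partial l (\<lambda>y. hyperbolic_metric y i j) y
      = (if i = j \<and> l = 1 then - 2 / (y 1) ^ 3 else 0)" if "y 1 > 0" for l i j y
    using that unfolding partial_def hyperbolic_metric_def
    by (cases "l = 1"; cases "i = j"; intro DERIV_imp_deriv)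
      (auto intro!: derivative_eq_intros simp: power2_eq_square power3_eq_cube field_simps)
  have chr: "christoffel 2 hyperbolic_metric k i j y =
      (if k = 0 then (if i \<noteq> j then - 1 / y 1 else 0)
       else if i = 0 \<and> j = 0 then 1 / y 1 else if i = 1 \<and> j = 1 then - 1 / y 1 else 0)"
    if "y 1 > 0" "k < 2" "i < 2" "j < 2" for k i j y
    using that unfolding christoffel_def two
    by (auto simp: inv par less_2_cases_iff power2_eq_square power3_eq_cube field_simps)
  have geo: "geodesic 2 hyperbolic_metric {0..} (\<lambda>\<rho>. \<Phi> \<rho> \<theta>) (V \<theta>)" for \<theta>
    unfolding geodesic_def
  proof (intro ballI allI impI)
    fix t :: real and k :: nat
    assume "k < 2"
    define E where "E = (\<lambda>\<rho>. sinh \<rho> - sin \<theta> * cosh \<rho>)"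
    have dD: "((\<lambda>s. D s \<theta>) has_real_derivative E t) (at t within {0..})"
      unfolding D_def E_def by (auto intro!: derivative_eq_intros)
    have dE: "(E has_real_derivative D t \<theta>) (at t within {0..})"
      unfolding D_def E_def by (auto intro!: derivative_eq_intros)
    have c1: "cosh t * D t \<theta> - sinh t * E t = 1"
      using cosh_square_eq[of t] by (simp add: D_def E_def power2_eq_square algebra_simps)
    have "(D t \<theta>)\<^sup>2 - (E t)\<^sup>2 = ((cosh t)\<^sup>2 - (sinh t)\<^sup>2) * (1 - (sin \<theta>)\<^sup>2)"
      by (simp add: D_def E_def power2_eq_square algebra_simps)
    then have c2: "(D t \<theta>)\<^sup>2 - (E t)\<^sup>2 = (cos \<theta>)\<^sup>2"
      by (simp add: cosh_square_eq cos_squared_eq)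
    have pos: "D t \<theta> > 0" "\<Phi> t \<theta> 1 > 0"
      using D p by (auto simp: \<Phi>_def)
    have d0: "((\<lambda>s. sinh s / D s \<theta>) has_real_derivative 1 / (D t \<theta>)\<^sup>2) (at t within {0..})"
      using pos c1 by (auto intro!: derivative_eq_intros dD simp: power2_eq_square)
    have d1: "((\<lambda>s. 1 / D s \<theta>) has_real_derivative - E t / (D t \<theta>)\<^sup>2) (at t within {0..})"
      using pos by (auto intro!: derivative_eq_intros dD simp: power2_eq_square)
    have d2: "((\<lambda>s. 1 / (D s \<theta>)\<^sup>2) has_real_derivative - 2 * E t / (D t \<theta>) ^ 3) (at t within {0..})"
      using pos by (auto intro!: derivative_eq_intros dD simp: field_simps eval_nat_numeral)
    have d3: "((\<lambda>s. E s / (D s \<theta>)\<^sup>2) has_real_derivative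
        ((D t \<theta>)\<^sup>2 - 2 * (E t)\<^sup>2) / (D t \<theta>) ^ 3) (at t within {0..})"
      using pos by (auto intro!: derivative_eq_intros dD dE simp: field_simps eval_nat_numeral)
    have "k = 0 \<or> k = 1"
      using \<open>k < 2\<close> by auto
    then show "((\<lambda>s. \<Phi> s \<theta> k) has_real_derivative V \<theta> t k) (at t within {0..}) \<and>
        ((\<lambda>s. V \<theta> s k) has_real_derivative - (\<Sum>i<2. \<Sum>j<2.
          christoffel 2 hyperbolic_metric k i j (\<Phi> t \<theta>) * V \<theta> t i * V \<theta> t j)) (at t within {0..})"
    proof
      assume k: "k = 0"
      have "- (\<Sum>i<2. \<Sum>j<2. christoffel 2 hyperbolic_metric k i j (\<Phi> t \<theta>) * V \<theta> t i * V \<theta> t j)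
          = p 1 * cos \<theta> * (- 2 * E t / (D t \<theta>) ^ 3)"
        using pos p unfolding two
        by (simp add: chr k) (simp add: V_def \<Phi>_def flip: E_def, simp add: E_def field_simps eval_nat_numeral)
      moreover have "((\<lambda>s. \<Phi> s \<theta> 0) has_real_derivative V \<theta> t 0) (at t within {0..})"
        using DERIV_add[OF DERIV_const DERIV_cmult[OF d0, of "p 1 * cos \<theta>"], of "p 0"]
        by (simp add: \<Phi>_def V_def)
      moreover have "((\<lambda>s. V \<theta> s 0) has_real_derivative
          p 1 * cos \<theta> * (- 2 * E t / (D t \<theta>) ^ 3)) (at t within {0..})"
        using DERIV_cmult[OF d2, of "p 1 * cos \<theta>"] by (simp add: V_def)
      ultimately show ?thesis
        by (simp only: k)
    next
      assume k: "k = 1"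
      have "- (\<Sum>i<2. \<Sum>j<2. christoffel 2 hyperbolic_metric k i j (\<Phi> t \<theta>) * V \<theta> t i * V \<theta> t j)
          = - p 1 * (((cos \<theta>)\<^sup>2 - (E t)\<^sup>2) / (D t \<theta>) ^ 3)"
        using pos p unfolding two
        by (simp add: chr k) (simp add: V_def \<Phi>_def E_def field_simps eval_nat_numeral)
      also have "(cos \<theta>)\<^sup>2 - (E t)\<^sup>2 = (D t \<theta>)\<^sup>2 - 2 * (E t)\<^sup>2"
        using c2 by simp
      finally have "- (\<Sum>i<2. \<Sum>j<2. christoffel 2 hyperbolic_metric k i j (\<Phi> t \<theta>) * V \<theta> t i * V \<theta> t j)
          = - p 1 * (((D t \<theta>)\<^sup>2 - 2 * (E t)\<^sup>2) / (D t \<theta>) ^ 3)" .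
      moreover have "((\<lambda>s. \<Phi> s \<theta> 1) has_real_derivative V \<theta> t 1) (at t within {0..})"
        using DERIV_cmult[OF d1, of "p 1"] by (simp add: \<Phi>_def V_def E_def minus_divide_left algebra_simps)
      moreover have "((\<lambda>s. V \<theta> s 1) has_real_derivative
          - p 1 * (((D t \<theta>)\<^sup>2 - 2 * (E t)\<^sup>2) / (D t \<theta>) ^ 3)) (at t within {0..})"
        using DERIV_cmult[OF d3, of "- p 1"] by (simp add: V_def E_def)
      ultimately show ?thesis
        by (simp only: k)
    qed
  qed
  have "inner_g 2 hyperbolic_metric p e1 e1 = 1" "inner_g 2 hyperbolic_metric p e2 e2 = 1"
    "inner_g 2 hyperbolic_metric p e1 e2 = 0"
    using p by (simp_all add: inner_g_def two hyperbolic_metric_def e1_def e2_def power2_eq_square)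
  moreover have "\<Phi> \<rho> \<theta> 1 > 0" for \<rho> \<theta>
    using p D[of \<rho> \<theta>] by (simp add: \<Phi>_def)
  moreover have "\<Phi> 0 \<theta> k = p k \<and> V \<theta> 0 k = cos \<theta> * e1 k + sin \<theta> * e2 k" if "k < 2" for \<theta> k
    using that by (auto simp: \<Phi>_def V_def D_def e1_def e2_def less_2_cases_iff)
  ultimately show ?thesis
    unfolding geodesic_polar_coordinates_def using geo by blast
qed

end

theory Submission
  imports Defs "Jordan_Normal_Form.Determinant"
begin

text \<open>
  The metric of the comparison manifold is a warped product over the circle: with
  \<open>w = 1 / z(r, \<theta>)\<close> it reads \<open>sinh\<^sup>2 r d\<theta>\<^sup>2 + w\<^sup>2 G\<close>, where \<open>G\<close> is the product of the disc with a
  flat torus. The disc is a cap of the round sphere of radius 2, so \<open>G\<close> has scalar curvature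
  \<open>1 / 2\<close>, and with \<open>m = n - 1\<close> the warped product formula gives

  \<open>R = z\<^sup>2 / 2 - (2 m w'' / w + m (m - 1) (w' / w)\<^sup>2) / sinh\<^sup>2 r\<close>.

  The geodesic equation makes \<open>1 / z\<close> along a unit speed geodesic a solution of \<open>w'' = w\<close>. Hence
  \<open>1 / z(\<rho>, \<theta>) = (cosh \<rho> - sin \<psi> sinh \<rho>) / z(p)\<close>, where \<open>\<psi> = \<alpha> \<plusminus> \<theta>\<close> is the initial direction
  measured in the chart. The height of \<open>p\<close> enters \<open>w\<close> only as a constant factor, so \<open>w' / w\<close> and
  \<open>w'' / w\<close> are bounded in terms of \<open>r\<close> alone. This is the bound on the scalar curvature; since
  \<open>z(r, \<theta>) \<ge> z(p) exp (- r)\<close>, the positive term wins when \<open>p\<close> is high.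

  The mean curvatures of the two boundaries scale differently. The boundary of the comparison
  manifold bends only in the direction of the boundary circle of the disc, whose geodesic curvature
  is \<open>cot (\<pi> / 6) / 2 = \<surd>3 / 2\<close>, so its mean curvature is \<open>\<surd>3 / 2 z\<close> and grows with the height.
  The mean curvature on the hyperbolic side is \<open>coth r - (n - 2) \<nu>\<close>, where \<open>\<nu> \<in> [-1, 1]\<close> is the
  vertical component of the Euclidean unit normal of the boundary of the geodesic disc, which is a
  Euclidean circle. It stays bounded.

  The formulas behind these arguments are \<open>scalar_curvature_warped\<close>,
  \<open>scalar_curvature_flat_extension\<close> and \<open>disc_gauss_curvature\<close> for the curvature,
  \<open>polar_coordinates_formula\<close> for the function \<open>z\<close>, and \<open>mean_curvature_bar\<close> and
  \<open>mean_curvature_hyp\<close> for the boundaries.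
\<close>

section \<open>Inverse metrics and partial derivatives\<close>

definition invertible_at :: "nat \<Rightarrow> metric \<Rightarrow> point \<Rightarrow> bool" where
  "invertible_at n g x \<longleftrightarrow>
     (\<exists>B. \<forall>i<n. \<forall>j<n. (\<Sum>k<n. g x i k * B k j) = (if i = j then 1 else 0))"

text \<open>
  A right inverse of a square matrix is two-sided, hence it is what Gauss-Jordan elimination
  returns. This reduces the inverse of a product metric to one matrix product.
\<close>

lemma
  fixes B :: "nat \<Rightarrow> nat \<Rightarrow> real"
  assumes AB: "\<And>i j. i < n \<Longrightarrow> j < n \<Longrightarrow> (\<Sum>k<n. g x i k * B k j) = (if i = j then 1 else 0)"
    and "i < n" "j < n"
  shows inverse_metric_eqI: "inverse_metric n g x i j = B i j"
    and left_inverse: "(\<Sum>k<n. B i k * g x k j) = (if i = j then 1 else 0)"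
proof -
  define MA where "MA = Matrix.mat n n (\<lambda>(k, l). g x k l)"
  define MB where "MB = Matrix.mat n n (\<lambda>(k, l). B k l)"
  have A: "MA \<in> carrier_mat n n" and B: "MB \<in> carrier_mat n n"
    by (auto simp: MA_def MB_def)
  have AB: "MA * MB = 1\<^sub>m n"
    using AB by (auto intro!: eq_matI simp: MA_def MB_def scalar_prod_def lessThan_atLeast0)
  have BA: "MB * MA = 1\<^sub>m n"
    by (rule mat_mult_left_right_inverse[OF A B AB])
  obtain C where C: "mat_inverse MA = Some C"
    using mat_inverse(1)[OF A, of n] A B AB BA
    by (cases "mat_inverse MA") (auto simp: Units_def ring_mat_def)
  then have "MA * C = 1\<^sub>m n" "C \<in> carrier_mat n n"
    using mat_inverse(2)[OF A] by auto
  then have "C = MB"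
    using A B BA by (metis assoc_mult_mat left_mult_one_mat right_mult_one_mat)
  then show "inverse_metric n g x i j = B i j"
    using C assms(2,3) by (simp add: inverse_metric_def MA_def[symmetric]) (simp add: MB_def)
  have "(MB * MA) $$ (i, j) = 1\<^sub>m n $$ (i, j)"
    by (simp only: BA)
  then show "(\<Sum>k<n. B i k * g x k j) = (if i = j then 1 else 0)"
    using assms(2,3) by (simp add: MA_def MB_def scalar_prod_def lessThan_atLeast0)
qed

lemma
  assumes "invertible_at n g x" "i < n" "j < n"
  shows metric_times_inverse:
      "(\<Sum>k<n. g x i k * inverse_metric n g x k j) = (if i = j then 1 else 0)"
    and inverse_times_metric:
      "(\<Sum>k<n. inverse_metric n g x i k * g x k j) = (if i = j then 1 else 0)"
proof -
  obtain B where B: "\<And>i j. i < n \<Longrightarrow> j < n \<Longrightarrow> (\<Sum>k<n. g x i k * B k j) = (if i = j then 1 else 0)"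
    using assms(1) by (auto simp: invertible_at_def)
  have eq: "inverse_metric n g x i j = B i j" if "i < n" "j < n" for i j
    using inverse_metric_eqI[of n g x B i j] B that by blast
  show "(\<Sum>k<n. g x i k * inverse_metric n g x k j) = (if i = j then 1 else 0)"
    using B[OF assms(2,3)] assms(3) by (simp add: eq)
  show "(\<Sum>k<n. inverse_metric n g x i k * g x k j) = (if i = j then 1 else 0)"
    using left_inverse[of n g x B i j] B assms(2,3) by (simp add: eq)
qed

text \<open>
  The value \<open>partial i f x\<close> is arbitrary if the derivative does not exist, so calculation rules need
  a relational version that includes existence.
\<close>

definition has_partial :: "nat \<Rightarrow> (point \<Rightarrow> real) \<Rightarrow> real \<Rightarrow> point \<Rightarrow> bool" where
  "has_partial i f D x \<longleftrightarrow> ((\<lambda>t. f (x(i := t))) has_real_derivative D) (at (x i))"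

lemma has_partial_imp: "has_partial i f D x \<Longrightarrow> partial i f x = D"
  unfolding has_partial_def partial_def by (rule DERIV_imp_deriv)

lemma has_partial_partial: "has_partial i f D x \<Longrightarrow> has_partial i f (partial i f x) x"
  by (simp add: has_partial_imp)

lemma has_partial_const [simp]: "has_partial i (\<lambda>y. c) 0 x"
  by (simp add: has_partial_def)

lemma partial_const [simp]: "partial i (\<lambda>y. c) x = 0"
  by (rule has_partial_imp) simp

lemma partial_cong_ev:
  assumes "\<forall>\<^sub>F t in nhds (x i). f (x(i := t)) = f' (x(i := t))"
  shows "partial i f x = partial i f' x"
  using assms unfolding partial_def by (rule deriv_cong_ev) simp

text \<open>
  Partial derivatives see a function only along coordinate lines. It is therefore enough that \<open>U\<close> is
  open along these lines: an identity that holds on \<open>U\<close> may then be differentiated at its points.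
\<close>

locale metric_chart =
  fixes n :: nat and g :: metric and U :: "point set"
  assumes line_open: "x \<in> U \<Longrightarrow> \<forall>\<^sub>F t in nhds (x i). x(i := t) \<in> U"
    and metric_symmetric: "x \<in> U \<Longrightarrow> i < n \<Longrightarrow> j < n \<Longrightarrow> g x i j = g x j i"
    and metric_invertible: "x \<in> U \<Longrightarrow> invertible_at n g x"
    and metric_partial: "x \<in> U \<Longrightarrow> i < n \<Longrightarrow> j < n \<Longrightarrow> l < n \<Longrightarrow>
      has_partial l (\<lambda>y. g y i j) (partial l (\<lambda>y. g y i j) x) x"
begin

lemma partial_cong_chart:
  assumes "x \<in> U" "\<And>y. y \<in> U \<Longrightarrow> f y = f' y"
  shows "partial i f x = partial i f' x"
  using line_open[OF assms(1), of i] assms(2)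
  by (intro partial_cong_ev) (auto elim: eventually_mono)

end

section \<open>Warped products over a line\<close>

definition fibre :: "point \<Rightarrow> point" where
  "fibre x = (\<lambda>k. x (Suc k))"

lemma fibre_upd [simp]: "fibre (x(0 := t)) = fibre x" "fibre (x(Suc i := t)) = (fibre x)(i := t)"
  by (auto simp: fibre_def fun_eq_iff)

lemma fibre_apply [simp]: "fibre x k = x (Suc k)"
  by (simp add: fibre_def)

text \<open>
  The base is coordinate 0 and the coordinates of the fibre are shifted by one, so that every sum over
  all coordinates splits by \<open>sum.lessThan_Suc_shift\<close> into a base term and a sum over the fibre.
\<close>

definition warped_product :: "real \<Rightarrow> (real \<Rightarrow> real) \<Rightarrow> metric \<Rightarrow> metric" where
  "warped_product a w G x i j =
     (if i = 0 \<and> j = 0 then a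
      else if i = 0 \<or> j = 0 then 0
      else (w (x 0))\<^sup>2 * G (fibre x) (i - 1) (j - 1))"

locale warped_product_chart = metric_chart m G U
  for m :: nat and G :: metric and U :: "point set" +
  fixes a :: real and w w' w'' :: "real \<Rightarrow> real"
  assumes base: "a \<noteq> 0"
    and warp_nonzero: "w t \<noteq> 0"
    and warp_deriv: "(w has_real_derivative w' t) (at t)"
    and warp_deriv2: "(w' has_real_derivative w'' t) (at t)"
begin

abbreviation "g \<equiv> warped_product a w G"

lemma fibre_line_open: "fibre x \<in> U \<Longrightarrow> \<forall>\<^sub>F t in nhds (x i). fibre (x(i := t)) \<in> U"
  using line_open[of "fibre x" "i - 1"] by (cases i) (auto simp: fibre_def[of x])

lemma partial_cong_fibre:
  assumes "fibre x \<in> U" "\<And>y. fibre y \<in> U \<Longrightarrow> f y = f' y"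
  shows "partial i f x = partial i f' x"
  using fibre_line_open[OF assms(1), of i] assms(2)
  by (intro partial_cong_ev) (auto elim: eventually_mono)

lemma inverse_warped:
  assumes "fibre x \<in> U" "i < Suc m" "j < Suc m"
  shows "inverse_metric (Suc m) g x i j =
    (if i = 0 \<and> j = 0 then 1 / a else if i = 0 \<or> j = 0 then 0
     else inverse_metric m G (fibre x) (i - 1) (j - 1) / (w (x 0))\<^sup>2)"
proof (rule inverse_metric_eqI[OF _ assms(2,3)])
  fix i j assume "i < Suc m" "j < Suc m"
  moreover have "(\<Sum>k<m. (w (x 0))\<^sup>2 * G (fibre x) i k * (inverse_metric m G (fibre x) k j / (w (x 0))\<^sup>2))
      = (if i = j then 1 else 0)" if "i < m" "j < m" for i j
    using metric_times_inverse[OF metric_invertible[OF assms(1)] that] warp_nonzero by simp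
  ultimately show "(\<Sum>k<Suc m. g x i k * (if k = 0 \<and> j = 0 then 1 / a else if k = 0 \<or> j = 0 then 0
     else inverse_metric m G (fibre x) (k - 1) (j - 1) / (w (x 0))\<^sup>2)) = (if i = j then 1 else 0)"
    using base
    by (cases i; cases j) (auto simp: sum.lessThan_Suc_shift warped_product_def simp del: sum.lessThan_Suc)
qed

lemma partial_warped_base:
  "partial 0 (\<lambda>y. g y (Suc i) (Suc j)) x = 2 * w (x 0) * w' (x 0) * G (fibre x) i j"
  by (rule has_partial_imp, unfold has_partial_def)
     (auto simp: warped_product_def intro!: derivative_eq_intros warp_deriv)

lemma partial_warped_fibre:
  assumes "fibre x \<in> U" "i < m" "j < m" "l < m"
  shows "partial (Suc l) (\<lambda>y. g y (Suc i) (Suc j)) x = (w (x 0))\<^sup>2 * partial l (\<lambda>y. G y i j) (fibre x)"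
proof -
  have "((\<lambda>t. G ((fibre x)(l := t)) i j) has_real_derivative partial l (\<lambda>y. G y i j) (fibre x)) (at (x (Suc l)))"
    using metric_partial[OF assms] by (simp add: has_partial_def fibre_def)
  from DERIV_cmult[OF this, of "(w (x 0))\<^sup>2"] show ?thesis
    by (intro has_partial_imp) (simp add: has_partial_def warped_product_def)
qed

lemma partial_warped_mixed [simp]:
  "partial l (\<lambda>y. g y 0 j) x = 0" "partial l (\<lambda>y. g y j 0) x = 0"
  by (auto simp: warped_product_def cong: if_cong)

text \<open>
  The fibre components depend on the base only through \<open>w\<^sup>2\<close>, so their base derivatives are
  \<open>2 w w' G\<close>. In the mixed symbols the inverse metric cancels \<open>G\<close>, and in the pure fibre symbols the
  factors \<open>w\<^sup>2\<close> cancel.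
\<close>

lemma christoffel_warped:
  assumes x: "fibre x \<in> U"
  shows "christoffel (Suc m) g 0 0 j x = 0"
    and "christoffel (Suc m) g 0 j 0 x = 0"
    and "christoffel (Suc m) g k 0 0 x = 0"
    and "i < m \<Longrightarrow> j < m \<Longrightarrow>
      christoffel (Suc m) g 0 (Suc i) (Suc j) x = - (w (x 0) * w' (x 0) / a * G (fibre x) i j)"
    and "i < m \<Longrightarrow> j < m \<Longrightarrow>
      christoffel (Suc m) g (Suc i) 0 (Suc j) x = (if i = j then w' (x 0) / w (x 0) else 0)"
    and "i < m \<Longrightarrow> j < m \<Longrightarrow>
      christoffel (Suc m) g (Suc i) (Suc j) 0 x = (if i = j then w' (x 0) / w (x 0) else 0)"
    and "i < m \<Longrightarrow> j < m \<Longrightarrow> k < m \<Longrightarrow>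
      christoffel (Suc m) g (Suc k) (Suc i) (Suc j) x = christoffel m G k i j (fibre x)"
proof -
  note shift = sum.lessThan_Suc_shift
  note [simp del] = sum.lessThan_Suc
  have mixed: "(\<Sum>l<m. inverse_metric (Suc m) g x (Suc i) (Suc l) * (2 * w (x 0) * w' (x 0) * G (fibre x) l j)) / 2
      = (if i = j then w' (x 0) / w (x 0) else 0)" if "i < m" "j < m" for i j
  proof -
    have "(\<Sum>l<m. inverse_metric (Suc m) g x (Suc i) (Suc l) * (2 * w (x 0) * w' (x 0) * G (fibre x) l j)) / 2
      = (\<Sum>l<m. inverse_metric m G (fibre x) i l * G (fibre x) l j) * (w' (x 0) / w (x 0))"
      unfolding sum_distrib_right sum_divide_distrib using that warp_nonzero
      by (intro sum.cong refl) (simp add: inverse_warped[OF x] power2_eq_square)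
    then show ?thesis
      using inverse_times_metric[OF metric_invertible[OF x] that] by simp
  qed
  show "christoffel (Suc m) g 0 0 j x = 0" "christoffel (Suc m) g 0 j 0 x = 0"
    by (auto simp: christoffel_def shift inverse_warped[OF x])
  show "christoffel (Suc m) g k 0 0 x = 0"
    by (auto simp: christoffel_def shift)
  show "christoffel (Suc m) g 0 (Suc i) (Suc j) x = - (w (x 0) * w' (x 0) / a * G (fibre x) i j)"
    if "i < m" "j < m"
    using that by (simp add: christoffel_def shift inverse_warped[OF x] partial_warped_base)
  show "christoffel (Suc m) g (Suc i) 0 (Suc j) x = (if i = j then w' (x 0) / w (x 0) else 0)"
    if "i < m" "j < m"
    using mixed[OF that] that
    by (simp add: christoffel_def shift partial_warped_base metric_symmetric[OF x, of j])
  show "christoffel (Suc m) g (Suc i) (Suc j) 0 x = (if i = j then w' (x 0) / w (x 0) else 0)"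
    if "i < m" "j < m"
    using mixed[OF that] that
    by (simp add: christoffel_def shift partial_warped_base metric_symmetric[OF x, of j])
  show "christoffel (Suc m) g (Suc k) (Suc i) (Suc j) x = christoffel m G k i j (fibre x)"
    if "i < m" "j < m" "k < m"
    unfolding christoffel_def
    using that warp_nonzero
    by (auto simp: shift inverse_warped[OF x] partial_warped_fibre[OF x] simp flip: right_diff_distrib distrib_left
        intro!: sum.cong)
qed

lemma partial_christoffel_warped:
  assumes x: "fibre x \<in> U"
  shows "partial l (christoffel (Suc m) g 0 0 j) x = 0"
    and "partial l (christoffel (Suc m) g 0 j 0) x = 0"
    and "partial l (christoffel (Suc m) g k 0 0) x = 0"
    and "i < m \<Longrightarrow> j < m \<Longrightarrow> partial 0 (christoffel (Suc m) g 0 (Suc i) (Suc j)) x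
       = - (((w' (x 0))\<^sup>2 + w (x 0) * w'' (x 0)) / a * G (fibre x) i j)"
    and "i < m \<Longrightarrow> j < m \<Longrightarrow> partial 0 (christoffel (Suc m) g (Suc i) (Suc j) 0) x
       = (if i = j then w'' (x 0) / w (x 0) - (w' (x 0) / w (x 0))\<^sup>2 else 0)"
    and "i < m \<Longrightarrow> j < m \<Longrightarrow> k < m \<Longrightarrow> l < m \<Longrightarrow>
      partial (Suc l) (christoffel (Suc m) g (Suc k) (Suc i) (Suc j)) x
       = partial l (christoffel m G k i j) (fibre x)"
proof -
  show "partial l (christoffel (Suc m) g 0 0 j) x = 0"
    by (subst partial_cong_fibre[OF x christoffel_warped(1)]) simp_all
  show "partial l (christoffel (Suc m) g 0 j 0) x = 0"
    by (subst partial_cong_fibre[OF x christoffel_warped(2)]) simp_all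
  show "partial l (christoffel (Suc m) g k 0 0) x = 0"
    by (subst partial_cong_fibre[OF x christoffel_warped(3)]) simp_all
  show "partial 0 (christoffel (Suc m) g 0 (Suc i) (Suc j)) x
       = - (((w' (x 0))\<^sup>2 + w (x 0) * w'' (x 0)) / a * G (fibre x) i j)" if "i < m" "j < m"
    using that base by (simp only: partial_cong_fibre[OF x christoffel_warped(4)])
      (intro has_partial_imp, unfold has_partial_def,
        auto intro!: derivative_eq_intros warp_deriv warp_deriv2
        simp: power2_eq_square field_simps)
  show "partial 0 (christoffel (Suc m) g (Suc i) (Suc j) 0) x
       = (if i = j then w'' (x 0) / w (x 0) - (w' (x 0) / w (x 0))\<^sup>2 else 0)" if "i < m" "j < m"
    using that warp_nonzero by (simp only: partial_cong_fibre[OF x christoffel_warped(6)])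
      (intro has_partial_imp, unfold has_partial_def,
        auto intro!: derivative_eq_intros warp_deriv warp_deriv2
        simp: power2_eq_square field_simps)
  show "partial (Suc l) (christoffel (Suc m) g (Suc k) (Suc i) (Suc j)) x
       = partial l (christoffel m G k i j) (fibre x)" if "i < m" "j < m" "k < m" "l < m"
    using that by (subst partial_cong_fibre[OF x christoffel_warped(7)]) (auto simp: partial_def)
qed

text \<open>
  The component \<open>0\<close> of the trace contributes \<open>- w w'' G / a\<close>, by \<open>(w w')' - w'\<^sup>2 = w w''\<close>. Each fibre component
  contributes the term of the fibre minus \<open>w'\<^sup>2 / a\<close> times \<open>G\<close>, except the one whose index agrees with
  the derivative index; hence the factor \<open>m - 1\<close>.
\<close>

lemma ricci_warped:
  assumes x: "fibre x \<in> U"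
  shows "ricci (Suc m) g 0 0 x = - (real m * (w'' (x 0) / w (x 0)))"
    and "j < m \<Longrightarrow> k < m \<Longrightarrow> ricci (Suc m) g (Suc j) (Suc k) x = ricci m G j k (fibre x)
      - (w (x 0) * w'' (x 0) + (real m - 1) * (w' (x 0))\<^sup>2) / a * G (fibre x) j k"
proof -
  note shift = sum.lessThan_Suc_shift
  note [simp del] = sum.lessThan_Suc
  note \<Gamma> = christoffel_warped[OF x] partial_christoffel_warped[OF x]
  define v v1 v2 where v: "v = w (x 0)" "v1 = w' (x 0)" "v2 = w'' (x 0)"
  have v0: "v \<noteq> 0" by (simp add: v warp_nonzero)
  have "riemann (Suc m) g (Suc i) 0 (Suc i) 0 x = - (v2 / v)" if "i < m" for i
    using that v0 
    by (simp add: riemann_def shift \<Gamma> v[symmetric] power2_eq_square sum_negf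
        if_distrib[of "\<lambda>u. u * _"] if_distrib[of "\<lambda>u. _ * u"] cong: if_cong)
  then show "ricci (Suc m) g 0 0 x = - (real m * (w'' (x 0) / w (x 0)))"
    by (simp add: ricci_def shift v) (simp add: riemann_def)
  assume jk: "j < m" "k < m"
  have 0: "riemann (Suc m) g 0 (Suc k) 0 (Suc j) x = - (v * v2 / a * G (fibre x) j k)"
  proof -
    have "(\<Sum>i<m. v * v1 / a * G (fibre x) j i * (if i = k then v1 / v else 0)) = v1\<^sup>2 / a * G (fibre x) j k"
      using jk v0 by (simp add: if_distrib[of "\<lambda>u. _ * u"] sum.If_cases power2_eq_square cong: if_cong)
    then show ?thesis
      using jk by (simp add: riemann_def shift \<Gamma> flip: v cong: if_cong)
        (simp add: algebra_simps sum_negf add_divide_distrib flip: v cong: if_cong)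
  qed
  have i: "riemann (Suc m) g (Suc i) (Suc k) (Suc i) (Suc j) x = riemann m G i k i j (fibre x)
      - v1\<^sup>2 / a * (G (fibre x) j k - (if i = j then G (fibre x) j k else 0))" if "i < m" for i
    using jk that v0 
    by (auto simp: riemann_def shift \<Gamma> v[symmetric] power2_eq_square algebra_simps)
  have "ricci (Suc m) g (Suc j) (Suc k) x = - (v * v2 / a * G (fibre x) j k) + ricci m G j k (fibre x)
     - v1\<^sup>2 / a * (real m * G (fibre x) j k - G (fibre x) j k)"
    using jk by (simp add: ricci_def shift 0 i sum_subtractf flip: sum_distrib_left sum_divide_distrib)
  then show "ricci (Suc m) g (Suc j) (Suc k) x = ricci m G j k (fibre x)
      - (w (x 0) * w'' (x 0) + (real m - 1) * (w' (x 0))\<^sup>2) / a * G (fibre x) j k"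
    by (simp add: v algebra_simps add_divide_distrib diff_divide_distrib)
qed

text \<open>
  The trace of \<open>G\<close> with respect to itself is \<open>m\<close>, which turns the Ricci tensor into the classical
  formula. The term \<open>w'' / w\<close> occurs \<open>m\<close> times in the base direction and \<open>m\<close> times in the fibre
  directions.
\<close>

lemma scalar_curvature_warped:
  assumes x: "fibre x \<in> U"
  shows "scalar_curvature (Suc m) g x = scalar_curvature m G (fibre x) / (w (x 0))\<^sup>2
     - 2 * real m * (w'' (x 0) / w (x 0)) / a - real m * (real m - 1) * (w' (x 0) / w (x 0))\<^sup>2 / a"
proof -
  note shift = sum.lessThan_Suc_shift
  note [simp del] = sum.lessThan_Suc
  define v v1 v2 where v: "v = w (x 0)" "v1 = w' (x 0)" "v2 = w'' (x 0)"
  have v0: "v \<noteq> 0" by (simp add: v warp_nonzero)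
  have trace: "(\<Sum>j<m. \<Sum>k<m. inverse_metric m G (fibre x) j k * G (fibre x) j k) = real m"
  proof -
    have "(\<Sum>k<m. inverse_metric m G (fibre x) j k * G (fibre x) j k) = 1" if "j < m" for j
      using inverse_times_metric[OF metric_invertible[OF x] that that] that
      by (simp add: metric_symmetric[OF x, of j])
    then show ?thesis by simp
  qed
  define c where "c = (v * v2 + (real m - 1) * v1\<^sup>2) / a"
  have "scalar_curvature (Suc m) g x = - (real m * (v2 / v)) / a
     + (\<Sum>j<m. \<Sum>k<m. inverse_metric m G (fibre x) j k / v\<^sup>2 * (ricci m G j k (fibre x) - c * G (fibre x) j k))"
    by (simp add: scalar_curvature_def shift inverse_warped[OF x] ricci_warped[OF x] v c_def)
  also have "(\<Sum>j<m. \<Sum>k<m. inverse_metric m G (fibre x) j k / v\<^sup>2 * (ricci m G j k (fibre x) - c * G (fibre x) j k))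
     = scalar_curvature m G (fibre x) / v\<^sup>2 - c / v\<^sup>2 * real m"
    unfolding trace[symmetric]
    by (simp add: scalar_curvature_def sum_divide_distrib sum_distrib_left algebra_simps sum_subtractf diff_divide_distrib)
  also have "- (real m * (v2 / v)) / a + (scalar_curvature m G (fibre x) / v\<^sup>2 - c / v\<^sup>2 * real m)
     = scalar_curvature m G (fibre x) / v\<^sup>2 - 2 * real m * (v2 / v) / a
       - real m * (real m - 1) * (v1 / v)\<^sup>2 / a"
  proof -
    have "c / v\<^sup>2 = (v2 / v) / a + (real m - 1) * (v1 / v)\<^sup>2 / a"
      using v0 base by (simp add: c_def power2_eq_square divide_simps)
    then show ?thesis
      by (simp add: algebra_simps add_divide_distrib)
  qed
  finally show ?thesis
    unfolding v .
qed

end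

section \<open>Products with flat factors\<close>

text \<open>
  The identity matrix in the added directions is the flat metric, so this is the product of \<open>G\<close> with a
  flat space.
\<close>

definition flat_extension :: "nat \<Rightarrow> metric \<Rightarrow> metric" where
  "flat_extension k G x i j = (if i < k \<and> j < k then G x i j else if i = j then 1 else 0)"

lemma sum_lessThan_restrict:
  fixes f :: "nat \<Rightarrow> real"
  assumes "k \<le> m" "\<And>i. k \<le> i \<Longrightarrow> i < m \<Longrightarrow> f i = 0"
  shows "(\<Sum>i<m. f i) = (\<Sum>i<k. f i)"
  using assms by (intro sum.mono_neutral_right) auto

locale flat_extension_chart = metric_chart k G U for k G U +
  fixes m :: nat
  assumes dim_le: "k \<le> m"
    and coeff_indep: "k \<le> l \<Longrightarrow> i < k \<Longrightarrow> j < k \<Longrightarrow> G (x(l := t)) i j = G x i j"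
begin

abbreviation "g \<equiv> flat_extension k G"

lemma inverse_flat_extension:
  assumes x: "x \<in> U" and "i < m" "j < m"
  shows "inverse_metric m g x i j =
    (if i < k \<and> j < k then inverse_metric k G x i j else if i = j then 1 else 0)"
proof (rule inverse_metric_eqI[OF _ assms(2,3)])
  fix i j assume ij: "i < m" "j < m"
  let ?B = "\<lambda>i j. if i < k \<and> j < k then inverse_metric k G x i j else if i = j then 1 else 0"
  show "(\<Sum>l<m. g x i l * ?B l j) = (if i = j then 1 else 0)"
  proof (cases "i < k")
    case True
    have "(\<Sum>l<m. g x i l * ?B l j) = (\<Sum>l<k. g x i l * ?B l j)"
      using dim_le True by (intro sum_lessThan_restrict) (auto simp: flat_extension_def)
    also have "\<dots> = (if i = j then 1 else 0)"
    proof (cases "j < k")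
      case j: True
      show ?thesis
        using metric_times_inverse[OF metric_invertible[OF x] True j] True j
        by (simp add: flat_extension_def)
    qed (use True in \<open>auto simp: flat_extension_def\<close>)
    finally show ?thesis .
  next
    case False
    then have "(\<Sum>l<m. g x i l * ?B l j) = (\<Sum>l<m. if l = i then ?B i j else 0)"
      by (intro sum.cong) (auto simp: flat_extension_def)
    also have "\<dots> = (if i = j then 1 else 0)"
      using ij False by (auto simp: flat_extension_def)
    finally show ?thesis .
  qed
qed

lemma partial_flat_extension:
  "partial l (\<lambda>y. g y i j) x =
     (if i < k \<and> j < k \<and> l < k then partial l (\<lambda>y. G y i j) x else 0)"
proof (cases "i < k \<and> j < k \<and> \<not> l < k")
  case True
  then show ?thesis
    by (auto simp: flat_extension_def partial_def coeff_indep)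
qed (auto simp: flat_extension_def cong: if_cong)

lemma christoffel_flat_extension:
  assumes x: "x \<in> U" and "a < m" "b < m" "c < m"
  shows "christoffel m g a b c x = (if a < k \<and> b < k \<and> c < k then christoffel k G a b c x else 0)"
proof (cases "a < k \<and> b < k \<and> c < k")
  case True
  then show ?thesis
    using assms dim_le unfolding christoffel_def
    by (subst sum_lessThan_restrict[of k])
      (auto simp: inverse_flat_extension[OF x] partial_flat_extension
        intro!: sum.cong arg_cong[of _ _ "\<lambda>t. t / 2"])
next
  case False
  then have "(\<Sum>l<m. inverse_metric m g x a l * (partial b (\<lambda>y. g y c l) x + partial c (\<lambda>y. g y b l) x
      - partial l (\<lambda>y. g y b c) x)) = 0"
    using assms by (intro sum.neutral)
      (auto simp: inverse_flat_extension[OF x] partial_flat_extension)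
  then show ?thesis
    using False by (auto simp: christoffel_def)
qed

text \<open>
  Derivatives of the symbols in the added directions appear in the curvature of the product; they
  vanish because the symbols depend only on the coordinates of the factor.
\<close>

lemma christoffel_indep:
  assumes "k \<le> l" "b < k" "c < k"
  shows "christoffel k G a b c (x(l := t)) = christoffel k G a b c x"
proof -
  have "Matrix.mat k k (\<lambda>(i, j). G (x(l := t)) i j) = Matrix.mat k k (\<lambda>(i, j). G x i j)"
    using assms by (intro eq_matI) (auto simp: coeff_indep)
  then have inv: "inverse_metric k G (x(l := t)) = inverse_metric k G x"
    by (simp add: inverse_metric_def fun_eq_iff)
  have "partial i (\<lambda>y. G y p q) (x(l := t)) = partial i (\<lambda>y. G y p q) x" if "i < k" "p < k" "q < k" for i p q
    using assms that by (simp add: partial_def fun_upd_twist[of l i] coeff_indep)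
  then show ?thesis
    using assms by (simp add: christoffel_def inv)
qed

lemma partial_christoffel_flat_extension:
  assumes x: "x \<in> U" and "a < m" "b < m" "c < m"
  shows "partial l (christoffel m g a b c) x =
    (if a < k \<and> b < k \<and> c < k \<and> l < k then partial l (christoffel k G a b c) x else 0)"
proof (cases "a < k \<and> b < k \<and> c < k \<and> \<not> l < k")
  case True
  have "partial l (christoffel m g a b c) x = partial l (christoffel k G a b c) x"
    using True assms(2-4) by (intro partial_cong_chart[OF x]) (simp add: christoffel_flat_extension)
  also have "\<dots> = 0"
    using True by (simp add: partial_def christoffel_indep)
  finally show ?thesis
    using True by auto
next
  case False
  then show ?thesis
    using assms(2-4) by (subst partial_cong_chart[OF x christoffel_flat_extension]) auto
qed

lemma riemann_flat_extension:
  assumes x: "x \<in> U" and "a < m" "b < m" "c < m" "d < m"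
  shows "riemann m g a b c d x = (if a < k \<and> b < k \<and> c < k \<and> d < k then riemann k G a b c d x else 0)"
proof (cases "a < k \<and> b < k \<and> c < k \<and> d < k")
  case True
  then show ?thesis
    using assms(2-5) dim_le unfolding riemann_def
    by (subst sum_lessThan_restrict[of k])
      (auto simp: christoffel_flat_extension[OF x] partial_christoffel_flat_extension[OF x])
next
  case False
  then have "(\<Sum>l<m. christoffel m g a c l x * christoffel m g l d b x -
       christoffel m g a d l x * christoffel m g l c b x) = 0"
    using assms(2-5) by (intro sum.neutral) (auto simp: christoffel_flat_extension[OF x])
  then show ?thesis
    using False assms(2-5) by (auto simp: riemann_def partial_christoffel_flat_extension[OF x])
qed

lemma scalar_curvature_flat_extension:
  assumes x: "x \<in> U"
  shows "scalar_curvature m g x = scalar_curvature k G x"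
proof -
  have ric: "ricci m g b c x = (if b < k \<and> c < k then ricci k G b c x else 0)" if "b < m" "c < m" for b c
    unfolding ricci_def using that dim_le
    by (subst sum_lessThan_restrict[of k]) (auto simp: riemann_flat_extension[OF x])
  have "(\<Sum>c<m. inverse_metric m g x b c * ricci m g b c x)
      = (if b < k then \<Sum>c<k. inverse_metric k G x b c * ricci k G b c x else 0)" if "b < m" for b
    using that dim_le
    by (subst sum_lessThan_restrict[of k])
      (auto simp: ric inverse_flat_extension[OF x] flat_extension_def)
  then show ?thesis
    unfolding scalar_curvature_def using dim_le
    by (subst sum_lessThan_restrict[of k]) auto
qed

lemma metric_chart_flat_extension: "metric_chart m g U"
proof
  fix x assume x: "x \<in> U"
  show "\<forall>\<^sub>F t in nhds (x i). x(i := t) \<in> U" for i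
    by (rule line_open[OF x])
  show "g x i j = g x j i" for i j
    using metric_symmetric[OF x, of i j] by (auto simp: flat_extension_def)
  have "(\<Sum>l<m. g x i l * inverse_metric m g x l j) = (if i = j then 1 else 0)" if "i < m" "j < m" for i j
  proof (cases "i < k")
    case True
    have "(\<Sum>l<m. g x i l * inverse_metric m g x l j) = (\<Sum>l<k. g x i l * inverse_metric m g x l j)"
      using dim_le True by (intro sum_lessThan_restrict) (auto simp: flat_extension_def)
    also have "\<dots> = (if i = j then 1 else 0)"
    proof (cases "j < k")
      case j: True
      show ?thesis
        using metric_times_inverse[OF metric_invertible[OF x] True j] True j that dim_le
        by (simp add: flat_extension_def inverse_flat_extension[OF x])
    qed (use True that dim_le in \<open>auto simp: flat_extension_def inverse_flat_extension[OF x]\<close>)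
    finally show ?thesis .
  next
    case False
    then have "(\<Sum>l<m. g x i l * inverse_metric m g x l j) = (\<Sum>l<m. if l = i then inverse_metric m g x i j else 0)"
      by (intro sum.cong) (auto simp: flat_extension_def)
    also have "\<dots> = (if i = j then 1 else 0)"
      using that False by (auto simp: flat_extension_def inverse_flat_extension[OF x])
    finally show ?thesis .
  qed
  then show "invertible_at m g x"
    unfolding invertible_at_def by (intro exI[of _ "inverse_metric m g x"]) simp
  show "has_partial l (\<lambda>y. g y i j) (partial l (\<lambda>y. g y i j) x) x" for l i j
  proof (cases "i < k \<and> j < k")
    case True
    then show ?thesis
      using metric_partial[OF x, of i j l] 
      by (cases "l < k") (auto simp: flat_extension_def has_partial_def partial_def coeff_indep)
  qed (auto simp: flat_extension_def partial_flat_extension cong: if_cong)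
qed

end

section \<open>Discs in geodesic normal coordinates\<close>

lemma sum_two: "(\<Sum>i<2. f i) = f 0 + f 1" for f :: "nat \<Rightarrow> real"
  by (simp add: numeral_2_eq_2)

lemma has_partial_add:
  "has_partial l f a x \<Longrightarrow> has_partial l g b x \<Longrightarrow> has_partial l (\<lambda>y. f y + g y) (a + b) x"
  unfolding has_partial_def by (rule DERIV_add)

lemma has_partial_mult:
  "has_partial l f a x \<Longrightarrow> has_partial l g b x \<Longrightarrow> has_partial l (\<lambda>y. f y * g y) (a * g x + f x * b) x"
  unfolding has_partial_def by (auto intro!: derivative_eq_intros)

lemma has_partial_coord: "has_partial l (\<lambda>y. y i) (if i = l then 1 else 0) x"
  unfolding has_partial_def by (cases "i = l") (auto intro!: derivative_eq_intros)

definition sqnorm :: "point \<Rightarrow> real" where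
  "sqnorm y = (y 0)\<^sup>2 + (y 1)\<^sup>2"

lemma has_partial_sqnorm:
  assumes "(f has_real_derivative f') (at (sqnorm x))" "l < 2"
  shows "has_partial l (\<lambda>y. f (sqnorm y)) (f' * (2 * x l)) x"
proof -
  have "((\<lambda>t. sqnorm (x(l := t))) has_real_derivative 2 * x l) (at (x l))"
    using assms(2) unfolding sqnorm_def less_2_cases_iff
    by (elim disjE) (auto intro!: derivative_eq_intros)
  moreover have "(f has_real_derivative f') (at (sqnorm (x(l := x l))))"
    using assms(1) by simp
  ultimately show ?thesis
    unfolding has_partial_def by (rule DERIV_chain2[rotated])
qed

definition kron :: "nat \<Rightarrow> nat \<Rightarrow> real" where
  "kron i j = (if i = j then 1 else 0)"

text \<open>
  In Cartesian coordinates \<open>y\<close> with \<open>u = |y|\<^sup>2 = \<rho>\<^sup>2\<close>, a metric \<open>d\<rho>\<^sup>2 + f(\<rho>)\<^sup>2 d\<phi>\<^sup>2\<close> has the components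
  \<open>h(u) \<delta>\<^sub>i\<^sub>j + \<kappa>(u) y\<^sub>i y\<^sub>j\<close>, where \<open>h = f\<^sup>2 / u\<close> and \<open>h + u \<kappa> = 1\<close>; the last equation says that \<open>\<rho>\<close> is
  arc length. Writing \<open>h\<close> in terms of \<open>\<kappa>\<close>, instead of dividing by \<open>u\<close>, makes all formulas below
  polynomial in \<open>y\<close> up to powers of \<open>1 / h\<close>, so that they hold at the centre of the disc as well.
\<close>

locale normal_disc =
  fixes \<kappa> \<kappa>' \<kappa>'' :: "real \<Rightarrow> real"
  assumes \<kappa>_deriv: "(\<kappa> has_real_derivative \<kappa>' u) (at u)"
    and \<kappa>_deriv2: "(\<kappa>' has_real_derivative \<kappa>'' u) (at u)"
begin

definition h :: "real \<Rightarrow> real" where "h u = 1 - u * \<kappa> u"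
definition h' :: "real \<Rightarrow> real" where "h' u = - (\<kappa> u + u * \<kappa>' u)"
definition h'' :: "real \<Rightarrow> real" where "h'' u = - (2 * \<kappa>' u + u * \<kappa>'' u)"

definition G :: metric where
  "G y i j = h (sqnorm y) * kron i j + \<kappa> (sqnorm y) * (y i * y j)"

text \<open>
  The determinant of the metric is \<open>h (h + u \<kappa>) = h\<close>.
\<close>

definition U :: "point set" where "U = {y. h (sqnorm y) \<noteq> 0}"

text \<open>
  The coefficients of the Christoffel symbols, see \<open>\<Gamma>\<close> below, and their derivatives.
\<close>

definition \<alpha> :: "real \<Rightarrow> real" where "\<alpha> u = h' u / h u"
definition \<beta> :: "real \<Rightarrow> real" where "\<beta> u = \<kappa> u - h' u"
definition \<gamma> :: "real \<Rightarrow> real" where "\<gamma> u = \<kappa>' u - 2 * \<kappa> u * \<alpha> u"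
definition \<alpha>' :: "real \<Rightarrow> real" where "\<alpha>' u = h'' u / h u - (\<alpha> u)\<^sup>2"
definition \<beta>' :: "real \<Rightarrow> real" where "\<beta>' u = \<kappa>' u - h'' u"
definition \<gamma>' :: "real \<Rightarrow> real" where "\<gamma>' u = \<kappa>'' u - 2 * \<kappa>' u * \<alpha> u - 2 * \<kappa> u * \<alpha>' u"

lemma h_deriv: "(h has_real_derivative h' u) (at u)"
  unfolding h_def h'_def by (auto intro!: derivative_eq_intros \<kappa>_deriv)

lemma h'_deriv: "(h' has_real_derivative h'' u) (at u)"
  unfolding h'_def h''_def by (auto intro!: derivative_eq_intros \<kappa>_deriv \<kappa>_deriv2)

lemma \<alpha>_deriv: "h u \<noteq> 0 \<Longrightarrow> (\<alpha> has_real_derivative \<alpha>' u) (at u)"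
  unfolding \<alpha>_def \<alpha>'_def by (auto intro!: derivative_eq_intros h_deriv h'_deriv simp: divide_simps power2_eq_square)

lemma \<beta>_deriv: "(\<beta> has_real_derivative \<beta>' u) (at u)"
  unfolding \<beta>_def \<beta>'_def by (auto intro!: derivative_eq_intros \<kappa>_deriv h'_deriv)

lemma \<gamma>_deriv: "h u \<noteq> 0 \<Longrightarrow> (\<gamma> has_real_derivative \<gamma>' u) (at u)"
  unfolding \<gamma>_def \<gamma>'_def by (auto intro!: derivative_eq_intros \<kappa>_deriv \<kappa>_deriv2 \<alpha>_deriv)

lemma line_open_U:
  assumes "x \<in> U"
  shows "\<forall>\<^sub>F t in nhds (x i). x(i := t) \<in> U"
proof -
  have cont: "isCont h u" for u
    using h_deriv DERIV_isCont by blast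
  have "isCont (\<lambda>t. sqnorm (x(i := t))) (x i)"
    unfolding sqnorm_def by (cases "i = 0"; cases "i = 1") (auto intro!: continuous_intros)
  then have "isCont (\<lambda>t. h (sqnorm (x(i := t)))) (x i)"
    by (rule isCont_o2) (rule cont)
  then have "((\<lambda>t. h (sqnorm (x(i := t)))) \<longlongrightarrow> h (sqnorm x)) (nhds (x i))"
    using tendsto_at_iff_tendsto_nhds[of "\<lambda>t. h (sqnorm (x(i := t)))" "x i"]
    by (simp add: isCont_def)
  then show ?thesis
    using assms tendsto_imp_eventually_ne by (auto simp: U_def)
qed

lemma sum_kron:
  "i < 2 \<Longrightarrow> (\<Sum>l<2. kron i l * f l) = f i" "i < 2 \<Longrightarrow> (\<Sum>l<2. kron l i * f l) = f i"
  by (auto simp: sum_two kron_def less_2_cases_iff)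

text \<open>
  The metric has the eigenvalue \<open>1\<close> in the direction of \<open>y\<close> and \<open>h\<close> orthogonally to it, so the inverse
  has \<open>1\<close> and \<open>1 / h\<close>; note \<open>(1 - u \<kappa>) / h = 1\<close>.
\<close>

lemma inverse_product:
  assumes "x \<in> U" "i < 2" "j < 2"
  shows "(\<Sum>k<2. G x i k * ((kron k j - \<kappa> (sqnorm x) * (x k * x j)) / h (sqnorm x))) = (if i = j then 1 else 0)"
proof -
  define u v where "u = sqnorm x" and "v = \<kappa> u"
  have h0: "h u \<noteq> 0"
    using assms(1) by (auto simp: U_def u_def)
  have norm: "(\<Sum>k<2. x k * x k) = u"
    by (simp add: sum_two u_def sqnorm_def power2_eq_square)
  have "(\<Sum>k<2. G x i k * ((kron k j - v * (x k * x j)) / h u))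
      = (\<Sum>k<2. h u * (kron i k * kron k j) - h u * v * x j * (kron i k * x k)
          + v * x i * (kron k j * x k) - v * v * x i * x j * (x k * x k)) / h u"
    unfolding sum_divide_distrib times_divide_eq_right G_def u_def[symmetric] v_def[symmetric]
    by (intro sum.cong refl arg_cong[of _ _ "\<lambda>t. t / h u"]) (simp add: ring_distribs mult_ac)
  also have "\<dots> = (h u * kron i j + v * x i * x j * (1 - h u - u * v)) / h u"
    unfolding sum.distrib sum_subtractf sum_distrib_left[symmetric] sum_kron(1)[OF assms(2)] sum_kron(2)[OF assms(3)] norm
    by (simp add: ring_distribs mult_ac)
  also have "1 - h u - u * v = 0"
    by (simp add: h_def v_def)
  finally show ?thesis
    using h0 by (simp add: kron_def u_def v_def)
qed

lemma inverse_G: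
  assumes "x \<in> U" "i < 2" "j < 2"
  shows "inverse_metric 2 G x i j = (kron i j - \<kappa> (sqnorm x) * (x i * x j)) / h (sqnorm x)"
proof -
  define B where "B i j = (kron i j - \<kappa> (sqnorm x) * (x i * x j)) / h (sqnorm x)" for i j
  have "inverse_metric 2 G x i j = B i j"
    using inverse_product[OF assms(1)] assms(2,3)
    by (intro inverse_metric_eqI[where B = B]) (simp_all add: B_def)
  then show ?thesis by (simp add: B_def)
qed

lemma partial_G:
  assumes "l < 2"
  shows "has_partial l (\<lambda>y. G y i j) (h' (sqnorm x) * (2 * x l) * kron i j + \<kappa>' (sqnorm x) * (2 * x l) * (x i * x j)
     + \<kappa> (sqnorm x) * (kron i l * x j + x i * kron j l)) x"
proof -
  have "has_partial l (\<lambda>y. G y i j) (h' (sqnorm x) * (2 * x l) * kron i j + h (sqnorm x) * 0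
     + (\<kappa>' (sqnorm x) * (2 * x l) * (x i * x j) + \<kappa> (sqnorm x) *
        ((if i = l then 1 else 0) * x j + x i * (if j = l then 1 else 0)))) x"
    unfolding G_def
    by (rule has_partial_add[OF has_partial_mult[OF has_partial_sqnorm[OF h_deriv assms] has_partial_const]
      has_partial_mult[OF has_partial_sqnorm[OF \<kappa>_deriv assms] has_partial_mult[OF has_partial_coord has_partial_coord]]])
  then show ?thesis by (simp add: kron_def add.assoc)
qed

definition \<Gamma> :: "nat \<Rightarrow> nat \<Rightarrow> nat \<Rightarrow> point \<Rightarrow> real" where
  "\<Gamma> m i j y = \<alpha> (sqnorm y) * (y i * kron j m + y j * kron i m) + \<beta> (sqnorm y) * (kron i j * y m)
     + \<gamma> (sqnorm y) * (y i * y j * y m)"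

text \<open>
  The symbols with all indices lowered, \<open>L\<close> in the proof, have again the shape \<open>\<delta> y\<close> plus \<open>y y y\<close>.
  Raising the index needs besides \<open>L\<close> only its contraction with \<open>y\<close>, and \<open>h = 1 - u \<kappa>\<close> removes the
  denominator from the last two coefficients.
\<close>

lemma christoffel_G:
  assumes x: "x \<in> U" and "m < 2" "i < 2" "j < 2"
  shows "christoffel 2 G m i j x = \<Gamma> m i j x"
proof -
  define u where "u = sqnorm x"
  have h0: "h u \<noteq> 0"
    using x by (auto simp: U_def u_def)
  have par: "partial l (\<lambda>y. G y i j) x = (h' u * (2 * x l) * kron i j + \<kappa>' u * (2 * x l) * (x i * x j)
     + \<kappa> u * (kron i l * x j + x i * kron j l))" if "l < 2" for i j l
    unfolding u_def by (rule has_partial_imp[OF partial_G[OF that]])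
  define L where "L l = h' u * (x i * kron j l + x j * kron i l - x l * kron i j)
     + \<kappa> u * (kron i j * x l) + \<kappa>' u * (x i * x j * x l)" for l
  have L: "partial i (\<lambda>y. G y j l) x + partial j (\<lambda>y. G y i l) x - partial l (\<lambda>y. G y i j) x = 2 * L l"
    if "l < 2" for l
    using that assms(3,4) by (simp add: par L_def kron_def algebra_simps)
  have xL: "(\<Sum>l<2. x l * L l) = 2 * h' u * (x i * x j) + u * (\<kappa> u - h' u) * kron i j
     + u * \<kappa>' u * (x i * x j)"
    using assms(3,4) unfolding sum_two less_2_cases_iff
    by (elim disjE) (simp_all add: L_def kron_def u_def sqnorm_def power2_eq_square algebra_simps)
  have "christoffel 2 G m i j x = (\<Sum>l<2. (kron m l - \<kappa> u * (x m * x l)) * L l) / h u"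
    unfolding christoffel_def sum_divide_distrib
    using assms(2) by (intro sum.cong refl) (simp add: inverse_G[OF x] L flip: u_def)
  also have "(\<Sum>l<2. (kron m l - \<kappa> u * (x m * x l)) * L l) = L m - \<kappa> u * x m * (\<Sum>l<2. x l * L l)"
    using sum_kron(1)[OF assms(2), of L]
    by (simp add: left_diff_distrib sum_subtractf sum_distrib_left mult.assoc)
  also have "\<dots> = h' u * (x i * kron j m + x j * kron i m) + (\<kappa> u - h' u) * h u * (kron i j * x m)
     + (\<kappa>' u * h u - 2 * \<kappa> u * h' u) * (x i * x j * x m)"
    unfolding xL unfolding L_def h_def by (simp add: algebra_simps)
  also have "\<dots> / h u = \<Gamma> m i j x"
    using h0 by (simp add: \<Gamma>_def \<alpha>_def \<beta>_def \<gamma>_def add_divide_distrib diff_divide_distrib left_diff_distrib flip: u_def)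
  finally show ?thesis .
qed

lemma partial_\<Gamma>:
  assumes x: "x \<in> U" and l: "l < 2"
  shows "has_partial l (\<Gamma> m i j)
    (\<alpha>' (sqnorm x) * (2 * x l) * (x i * kron j m + x j * kron i m)
     + \<alpha> (sqnorm x) * (kron i l * kron j m + kron j l * kron i m)
     + (\<beta>' (sqnorm x) * (2 * x l) * (kron i j * x m) + \<beta> (sqnorm x) * (kron i j * kron m l))
     + (\<gamma>' (sqnorm x) * (2 * x l) * (x i * x j * x m)
     + \<gamma> (sqnorm x) * ((kron i l * x j + x i * kron j l) * x m + x i * x j * kron m l))) x"
proof -
  have coord: "has_partial l (\<lambda>y. y i) (kron i l) x" for i
    using has_partial_coord[of l i x] by (simp add: kron_def)
  have hx: "h (sqnorm x) \<noteq> 0"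
    using x by (simp add: U_def)
  note d\<alpha> = has_partial_sqnorm[OF \<alpha>_deriv[OF hx] l]
    and d\<beta> = has_partial_sqnorm[OF \<beta>_deriv l] and d\<gamma> = has_partial_sqnorm[OF \<gamma>_deriv[OF hx] l]
  have c: "has_partial l (\<lambda>y. f y * c) (a * c) x" if "has_partial l f a x" for f c a
    using that unfolding has_partial_def by (rule DERIV_cmult_right)
  have c': "has_partial l (\<lambda>y. c * f y) (c * a) x" if "has_partial l f a x" for f c a
    using that unfolding has_partial_def by (rule DERIV_cmult)
  show ?thesis
    unfolding \<Gamma>_def[abs_def]
    apply (rule has_partial_add)
     apply (rule has_partial_add)
      apply (rule has_partial_mult[OF d\<alpha>])
      apply (rule has_partial_add)
       apply (rule c, rule coord)
      apply (rule c, rule coord)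
     apply (rule has_partial_mult[OF d\<beta>])
     apply (rule c', rule coord)
    apply (rule has_partial_mult[OF d\<gamma>])
    apply (rule has_partial_mult)
     apply (rule has_partial_mult)
      apply (rule coord)
     apply (rule coord)
    apply (rule coord)
    done
qed

lemma partial_christoffel_G:
  assumes x: "x \<in> U" and "m < 2" "i < 2" "j < 2"
  shows "partial l (christoffel 2 G m i j) x = partial l (\<Gamma> m i j) x"
proof (rule partial_cong_ev)
  show "\<forall>\<^sub>F t in nhds (x l). christoffel 2 G m i j (x(l := t)) = \<Gamma> m i j (x(l := t))"
    using line_open_U[OF x] by eventually_elim (rule christoffel_G[OF _ assms(2-4)])
qed

lemma metric_chart_G: "metric_chart 2 G U"
proof
  fix x assume x: "x \<in> U"
  show "\<forall>\<^sub>F t in nhds (x i). x(i := t) \<in> U" for i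
    by (rule line_open_U[OF x])
  show "G x i j = G x j i" for i j
    by (auto simp: G_def kron_def)
  show "invertible_at 2 G x"
    unfolding invertible_at_def
    by (rule exI[of _ "\<lambda>i j. (kron i j - \<kappa> (sqnorm x) * (x i * x j)) / h (sqnorm x)"])
      (use inverse_product[OF x] in simp)
  show "has_partial l (\<lambda>y. G y i j) (partial l (\<lambda>y. G y i j) x) x" if "l < 2" for l i j
    by (rule has_partial_partial[OF partial_G[OF that]])
qed


text \<open>
  In two dimensions the Ricci tensor is the Gauss curvature times the metric. The factor is
  \<open>- f'' / f\<close>, expressed as a function of \<open>u\<close>.
\<close>

lemma ricci_G:
  assumes x: "x \<in> U" and "i < 2" "j < 2"
  defines "u \<equiv> sqnorm x"
  shows "ricci 2 G i j x = - (3 * \<alpha> u + 2 * u * \<alpha>' u + u * (\<alpha> u)\<^sup>2) * G x i j"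
proof -
  have par: "partial l (christoffel 2 G m i j) x =
    (\<alpha>' u * (2 * x l) * (x i * kron j m + x j * kron i m)
     + \<alpha> u * (kron i l * kron j m + kron j l * kron i m)
     + (\<beta>' u * (2 * x l) * (kron i j * x m) + \<beta> u * (kron i j * kron m l))
     + (\<gamma>' u * (2 * x l) * (x i * x j * x m)
     + \<gamma> u * ((kron i l * x j + x i * kron j l) * x m + x i * x j * kron m l)))"
    if "m < 2" "i < 2" "j < 2" "l < 2" for m i j l
    using partial_christoffel_G[OF x that(1-3)] has_partial_imp[OF partial_\<Gamma>[OF x that(4)]]
    by (simp only: u_def)
  note chr = christoffel_G[OF x, unfolded \<Gamma>_def u_def[symmetric]]
  define a b where "a = x 0" and "b = x (Suc 0)"
  have u: "u = a * a + b * b"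
    by (simp add: u_def sqnorm_def a_def b_def power2_eq_square)
  define A B C A' B' C' where defs: "A = \<alpha> u" "B = \<beta> u" "C = \<gamma> u" "A' = \<alpha>' u" "B' = \<beta>' u" "C' = \<gamma>' u"
  (* The definition expanded, before the relations between the coefficients are used. *)
  have ric: "ricci 2 G i j x =
     (2 * A + 2 * u * B' + 2 * B - (3 * A + B + C * u) * (1 - B * u) - 2 * u * A * B) * kron i j
     + (4 * A' + 2 * u * C' + 4 * C - 2 * (3 * A' + B' + C' * u + C) + (3 * A + B + C * u) * (2 * A + C * u)
        - 5 * A\<^sup>2 - 2 * A * B - 4 * u * A * C - B\<^sup>2 - 2 * u * B * C - u\<^sup>2 * C\<^sup>2) * (x i * x j)"
    using assms(2,3) unfolding less_2_cases_iff
    by (elim disjE) (simp_all add: ricci_def riemann_def sum_two par chr kron_def power2_eq_square flip: a_def b_def defs u_def,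
       simp_all add: u algebra_simps)
  have h0: "h u \<noteq> 0"
    using x by (auto simp: U_def u_def)
  define k k' k'' where kdefs: "k = \<kappa> u" "k' = \<kappa>' u" "k'' = \<kappa>'' u"
  have rel: "h u = 1 - u * k" "B = k - A * (1 - u * k)" "C = k' - 2 * k * A"
    "B' = k' - (A' + A\<^sup>2) * (1 - u * k)" "C' = k'' - 2 * k' * A - 2 * k * A'"
    using h0 by (simp_all add: defs kdefs h_def \<beta>_def \<beta>'_def \<gamma>_def \<gamma>'_def)
       (simp_all add: \<alpha>_def \<alpha>'_def h_def)
  (* h' = - (k + u k') and h'' = - (2 k' + u k'') in terms of A = h' / h and A'. *)
  have E1: "A * (1 - u * k) + k + u * k' = 0" and E2: "(A' + A\<^sup>2) * (1 - u * k) + 2 * k' + u * k'' = 0"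
    using h0 by (simp_all add: defs kdefs \<alpha>_def \<alpha>'_def h'_def h''_def h_def)
  (* The trace of the Christoffel symbols is the gradient of the logarithm of sqrt h, namely A y. *)
  have trace: "3 * A + B + C * u = A"
    using E1 unfolding rel by (simp add: algebra_simps)
  have "2 * A' + B' + C' * u + C = ((A' + A\<^sup>2) * (1 - u * k) + 2 * k' + u * k'')
      - 2 * A * (A * (1 - u * k) + k + u * k')"
    unfolding rel by (simp add: algebra_simps power2_eq_square)
  then have trace': "3 * A' + B' + C' * u + C = A'"
    using E1 E2 by simp
  have B: "B = - 2 * A - u * C"
    using trace by (simp add: algebra_simps)
  have "2 * A + 2 * u * B' + 2 * B - A * (1 - B * u) - 2 * u * A * B
     = - (3 * A + 2 * u * A' + u * A\<^sup>2) * h u + 2 * (A * (1 - u * k) + k + u * k')"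
    unfolding rel by (simp add: algebra_simps power2_eq_square)
  then have 1: "2 * A + 2 * u * B' + 2 * B - (3 * A + B + C * u) * (1 - B * u) - 2 * u * A * B
     = - (3 * A + 2 * u * A' + u * A\<^sup>2) * h u"
    unfolding trace E1 by simp
  have "4 * A' + 2 * u * C' + 4 * C - 2 * A' + A * (2 * A + C * u)
        - 5 * A\<^sup>2 - 2 * A * B - 4 * u * A * C - B\<^sup>2 - 2 * u * B * C - u\<^sup>2 * C\<^sup>2
     = 2 * A' + 2 * u * C' + 4 * C - 3 * A\<^sup>2 - u * A * C"
    unfolding B by (simp add: algebra_simps power2_eq_square)
  also have "\<dots> = - (3 * A + 2 * u * A' + u * A\<^sup>2) * k
     + 2 * ((A' + A\<^sup>2) * (1 - u * k) + 2 * k' + u * k'') - 5 * A * (A * (1 - u * k) + k + u * k')"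
    unfolding rel by (simp add: algebra_simps power2_eq_square)
  finally have 2: "4 * A' + 2 * u * C' + 4 * C - 2 * (3 * A' + B' + C' * u + C) + (3 * A + B + C * u) * (2 * A + C * u)
        - 5 * A\<^sup>2 - 2 * A * B - 4 * u * A * C - B\<^sup>2 - 2 * u * B * C - u\<^sup>2 * C\<^sup>2
     = - (3 * A + 2 * u * A' + u * A\<^sup>2) * k"
    unfolding trace trace' E1 E2 by simp
  show ?thesis
    unfolding ric 1 2 by (simp add: G_def defs kdefs algebra_simps flip: u_def)
qed

lemma scalar_curvature_G:
  assumes x: "x \<in> U"
  defines "u \<equiv> sqnorm x"
  shows "scalar_curvature 2 G x = - 2 * (3 * \<alpha> u + 2 * u * \<alpha>' u + u * (\<alpha> u)\<^sup>2)"
proof -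
  interpret metric_chart 2 G U by (rule metric_chart_G)
  have "(\<Sum>k<2. inverse_metric 2 G x j k * G x j k) = 1" if "j < 2" for j
    using inverse_times_metric[OF metric_invertible[OF x] that that] that
    by (simp add: metric_symmetric[OF x, of j])
  then have "(\<Sum>j<2. \<Sum>k<2. inverse_metric 2 G x j k * G x j k) = 2"
    by simp
  moreover have "scalar_curvature 2 G x = - (3 * \<alpha> u + 2 * u * \<alpha>' u + u * (\<alpha> u)\<^sup>2)
      * (\<Sum>j<2. \<Sum>k<2. inverse_metric 2 G x j k * G x j k)"
    unfolding scalar_curvature_def sum_distrib_left
    by (intro sum.cong refl) (simp add: ricci_G[OF x] u_def)
  ultimately show ?thesis by simp
qed

end

section \<open>The round disc\<close>

text \<open>
  For the disc \<open>f(\<rho>)\<^sup>2 = 4 sin\<^sup>2 (\<rho> / 2) = 2 - 2 cos \<rho>\<close>, so \<open>\<kappa> = (\<rho>\<^sup>2 - 2 + 2 cos \<rho>) / \<rho>\<^sup>4\<close>. This is an entire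
  function of \<open>u = \<rho>\<^sup>2\<close>; its power series provides the derivatives at \<open>u = 0\<close>.
\<close>

definition disc_coeff :: "nat \<Rightarrow> real" where
  "disc_coeff n = 2 * (- 1) ^ n / fact (2 * n + 4)"

definition disc_fun :: "real \<Rightarrow> real" where
  "disc_fun u = (\<Sum>n. disc_coeff n * u ^ n)"

definition disc_fun' :: "real \<Rightarrow> real" where
  "disc_fun' u = (\<Sum>n. diffs disc_coeff n * u ^ n)"

definition disc_fun'' :: "real \<Rightarrow> real" where
  "disc_fun'' u = (\<Sum>n. diffs (diffs disc_coeff) n * u ^ n)"

lemma summable_disc_coeff: "summable (\<lambda>n. disc_coeff n * u ^ n)"
proof (rule summable_comparison_test')
  show "summable (\<lambda>n. 2 * (inverse (fact n) * \<bar>u\<bar> ^ n))"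
    by (intro summable_mult summable_exp)
  show "norm (disc_coeff n * u ^ n) \<le> 2 * (inverse (fact n) * \<bar>u\<bar> ^ n)" for n
  proof -
    have "fact n \<le> (fact (2 * n + 4) :: real)"
      by (intro fact_mono) auto
    then have "inverse (fact (2 * n + 4)) \<le> (inverse (fact n) :: real)"
      by (intro le_imp_inverse_le) auto
    then have "inverse (fact (2 * n + 4)) * \<bar>u\<bar> ^ n \<le> inverse (fact n) * \<bar>u\<bar> ^ n"
      by (intro mult_right_mono) auto
    moreover have "norm (disc_coeff n * u ^ n) = 2 * (inverse (fact (2 * n + 4)) * \<bar>u\<bar> ^ n)"
      by (simp add: disc_coeff_def abs_mult power_abs divide_inverse)
    ultimately show ?thesis by linarith
  qed
qed

interpretation disc: normal_disc disc_fun disc_fun' disc_fun''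
proof
  show "(disc_fun has_real_derivative disc_fun' u) (at u)" for u
    unfolding disc_fun_def[abs_def] disc_fun'_def
    by (rule termdiffs_strong_converges_everywhere[OF summable_disc_coeff])
  show "(disc_fun' has_real_derivative disc_fun'' u) (at u)" for u
    unfolding disc_fun'_def[abs_def] disc_fun''_def
    by (rule termdiffs_strong_converges_everywhere[OF termdiff_converges_all[OF summable_disc_coeff]])
qed

lemma disc_fun_0: "disc_fun 0 = 1 / 12"
  unfolding disc_fun_def powser_zero by (simp add: disc_coeff_def fact_numeral)

lemma disc_fun_square: "t ^ 4 * disc_fun (t\<^sup>2) = t\<^sup>2 - 2 + 2 * cos t"
proof -
  have "(\<lambda>n. (- 1) ^ (n + 2) / fact (2 * (n + 2)) * t ^ (2 * (n + 2))) sums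
      (cos t - (\<Sum>i<2. (- 1) ^ i / fact (2 * i) * t ^ (2 * i)))"
    by (rule sums_split_initial_segment[OF cos_paired])
  then have "(\<lambda>n. 2 * ((- 1) ^ (n + 2) / fact (2 * (n + 2)) * t ^ (2 * (n + 2)))) sums
      (2 * (cos t - (\<Sum>i<2. (- 1) ^ i / fact (2 * i) * t ^ (2 * i))))"
    by (rule sums_mult)
  moreover have "2 * ((- 1) ^ (n + 2) / fact (2 * (n + 2)) * t ^ (2 * (n + 2))) = t ^ 4 * (disc_coeff n * (t\<^sup>2) ^ n)" for n
  proof -
    define F :: real where "F = fact (2 * n + 4)"
    have "2 * (n + 2) = 2 * n + 4" by simp
    moreover have "t ^ (2 * n + 4) = t ^ 4 * (t\<^sup>2) ^ n"
      by (simp only: power_add power_mult[symmetric] mult.commute)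
    ultimately show ?thesis
      by (simp only: disc_coeff_def F_def[symmetric]) simp
  qed
  ultimately have "(\<lambda>n. t ^ 4 * (disc_coeff n * (t\<^sup>2) ^ n)) sums (t\<^sup>2 - 2 + 2 * cos t)"
    by (simp add: numeral_2_eq_2 algebra_simps)
  moreover have "(\<lambda>n. t ^ 4 * (disc_coeff n * (t\<^sup>2) ^ n)) sums (t ^ 4 * disc_fun (t\<^sup>2))"
    unfolding disc_fun_def by (intro sums_mult summable_sums summable_disc_coeff)
  ultimately show ?thesis
    using sums_unique2 by metis
qed

lemma disc_closed_form:
  assumes "u > 0"
  shows "u\<^sup>2 * disc_fun u = u - 2 + 2 * cos (sqrt u)"
proof -
  have "sqrt u ^ 4 = ((sqrt u)\<^sup>2)\<^sup>2"
    by (simp flip: power_mult)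
  then show ?thesis
    using disc_fun_square[of "sqrt u"] assms by simp
qed

text \<open>
  Away from the centre, differentiating both sides of the closed form gives the derivatives of \<open>\<kappa>\<close>.
\<close>

lemma disc_closed_form':
  assumes u: "u > 0"
  shows "2 * u * disc_fun u + u\<^sup>2 * disc_fun' u = 1 - sin (sqrt u) / sqrt u"
proof (rule DERIV_unique)
  show "((\<lambda>u. u\<^sup>2 * disc_fun u) has_real_derivative 2 * u * disc_fun u + u\<^sup>2 * disc_fun' u) (at u)"
    by (auto intro!: derivative_eq_intros disc.\<kappa>_deriv)
  have "((\<lambda>u. u - 2 + 2 * cos (sqrt u)) has_real_derivative 1 - sin (sqrt u) / sqrt u) (at u)"
    using u by (auto intro!: derivative_eq_intros simp: field_simps)
  moreover have "\<forall>\<^sub>F u in nhds u. u\<^sup>2 * disc_fun u = u - 2 + 2 * cos (sqrt u)"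
    using eventually_nhds_in_open[of "{0<..}" u] u
    by (auto elim!: eventually_mono simp: disc_closed_form)
  ultimately show "((\<lambda>u. u\<^sup>2 * disc_fun u) has_real_derivative 1 - sin (sqrt u) / sqrt u) (at u)"
    by (simp add: DERIV_cong_ev)
qed

lemma disc_closed_form'':
  assumes u: "u > 0"
  shows "2 * disc_fun u + 4 * u * disc_fun' u + u\<^sup>2 * disc_fun'' u = (sin (sqrt u) / sqrt u - cos (sqrt u)) / (2 * u)"
proof (rule DERIV_unique)
  show "((\<lambda>u. 2 * u * disc_fun u + u\<^sup>2 * disc_fun' u) has_real_derivative
      2 * disc_fun u + 4 * u * disc_fun' u + u\<^sup>2 * disc_fun'' u) (at u)"
    by (auto intro!: derivative_eq_intros disc.\<kappa>_deriv disc.\<kappa>_deriv2)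
  have "((\<lambda>u. 1 - sin (sqrt u) / sqrt u) has_real_derivative
      - ((cos (sqrt u) * (inverse (sqrt u) / 2)) * sqrt u - sin (sqrt u) * (inverse (sqrt u) / 2)) / (sqrt u * sqrt u)) (at u)"
    using u by (auto intro!: derivative_eq_intros simp: diff_divide_distrib)
  also have "- ((cos (sqrt u) * (inverse (sqrt u) / 2)) * sqrt u - sin (sqrt u) * (inverse (sqrt u) / 2)) / (sqrt u * sqrt u)
     = (sin (sqrt u) / sqrt u - cos (sqrt u)) / (2 * u)"
  proof -
    define r where "r = sqrt u"
    have "r > 0" "u = r * r" using u by (simp_all add: r_def)
    then show ?thesis
      unfolding r_def[symmetric] by (simp add: field_simps)
  qed
  finally have "((\<lambda>u. 1 - sin (sqrt u) / sqrt u) has_real_derivative (sin (sqrt u) / sqrt u - cos (sqrt u)) / (2 * u)) (at u)" .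
  moreover have "\<forall>\<^sub>F u in nhds u. 2 * u * disc_fun u + u\<^sup>2 * disc_fun' u = 1 - sin (sqrt u) / sqrt u"
    using eventually_nhds_in_open[of "{0<..}" u] u
    by (auto elim!: eventually_mono simp: disc_closed_form')
  ultimately show "((\<lambda>u. 2 * u * disc_fun u + u\<^sup>2 * disc_fun' u) has_real_derivative (sin (sqrt u) / sqrt u - cos (sqrt u)) / (2 * u)) (at u)"
    by (simp add: DERIV_cong_ev)
qed

lemma disc_h:
  assumes u: "u > 0"
  shows "u * disc.h u = 2 - 2 * cos (sqrt u)"
    and "disc.h u + u * disc.h' u = sin (sqrt u) / sqrt u"
    and "2 * disc.h' u + u * disc.h'' u = (cos (sqrt u) - sin (sqrt u) / sqrt u) / (2 * u)"
proof -
  show "u * disc.h u = 2 - 2 * cos (sqrt u)"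
    using disc_closed_form[OF u] by (simp add: disc.h_def power2_eq_square algebra_simps)
  show "disc.h u + u * disc.h' u = sin (sqrt u) / sqrt u"
    using disc_closed_form'[OF u] by (simp add: disc.h_def disc.h'_def power2_eq_square algebra_simps)
  have "2 * disc.h' u + u * disc.h'' u = - ((sin (sqrt u) / sqrt u - cos (sqrt u)) / (2 * u))"
    unfolding disc_closed_form''[OF u, symmetric]
    by (simp add: disc.h''_def disc.h'_def power2_eq_square algebra_simps)
  then show "2 * disc.h' u + u * disc.h'' u = (cos (sqrt u) - sin (sqrt u) / sqrt u) / (2 * u)"
    by (simp add: diff_divide_distrib)
qed

text \<open>
  \<open>u h = f\<^sup>2\<close> vanishes for the first time at \<open>\<rho> = 2 \<pi>\<close>, the antipode of the centre on the sphere of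
  radius 2.
\<close>

lemma disc_h_pos:
  assumes "0 \<le> u" "u < (2 * pi)\<^sup>2"
  shows "disc.h u > 0"
proof (cases "u = 0")
  case False
  with assms have u: "u > 0" by simp
  have "sqrt u < 2 * pi"
    using real_sqrt_less_mono[OF assms(2)] by (simp only: real_sqrt_abs) simp
  then have "sin (sqrt u / 2) > 0"
    using u by (intro sin_gt_zero) auto
  moreover have "2 - 2 * cos (sqrt u) = 4 * (sin (sqrt u / 2))\<^sup>2"
    using cos_double_sin[of "sqrt u / 2"] by simp
  ultimately have "u * disc.h u > 0"
    unfolding disc_h(1)[OF u] by simp
  then show ?thesis
    using u by (simp add: zero_less_mult_iff)
qed (simp add: disc.h_def)

text \<open>
  A cap of the sphere of radius 2 has Gauss curvature \<open>1 / 4\<close>. For \<open>u > 0\<close> the closed forms reduce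
  this to \<open>sin\<^sup>2 + cos\<^sup>2 = 1\<close>; for \<open>u = 0\<close> only \<open>h' / h = - \<kappa> 0 = - 1 / 12\<close> survives.
\<close>

lemma disc_gauss_curvature:
  assumes "u \<ge> 0" "disc.h u \<noteq> 0"
  shows "- (3 * disc.\<alpha> u + 2 * u * disc.\<alpha>' u + u * (disc.\<alpha> u)\<^sup>2) = 1 / 4"
proof (cases "u = 0")
  case True
  then show ?thesis
    by (simp add: disc.\<alpha>_def disc.h_def disc.h'_def disc_fun_0)
next
  case False
  with assms have u: "u > 0" by simp
  define h h1 h2 c s where defs: "h = disc.h u" "h1 = disc.h' u" "h2 = disc.h'' u" "c = cos (sqrt u)" "s = sin (sqrt u) / sqrt u"
  have h0: "h \<noteq> 0" using assms by (simp add: defs)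
  have r1: "u * h = 2 - 2 * c" and r2: "u * h1 = s - h"
    using disc_h(1,2)[OF u] by (simp_all add: defs algebra_simps)
  have r3: "2 * u * (u * h2) = c - s - 4 * (s - h)"
  proof -
    have "2 * u * (2 * h1 + u * h2) = c - s"
      using disc_h(3)[OF u] u by (simp add: defs)
    then show ?thesis
      unfolding r2[symmetric] by (simp add: algebra_simps)
  qed
  have r4: "u * s\<^sup>2 = 1 - c\<^sup>2"
    using u by (simp add: defs power_divide sin_squared_eq)
  have "u * (u * (- 3 * h * h1 - 2 * u * h * h2 + u * h1\<^sup>2 - h\<^sup>2 / 4))
     = u * (- 3 * h * (u * h1) - h * (2 * u * (u * h2)) + (u * h1)\<^sup>2 - u * h\<^sup>2 / 4)"
    by (simp add: power2_eq_square algebra_simps)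
  also have "\<dots> = - (u * h) * c + u * s\<^sup>2 - (u * h)\<^sup>2 / 4"
    unfolding r2 r3 by (simp add: power2_eq_square algebra_simps)
  also have "\<dots> = 0"
    unfolding r1 r4 by (simp add: power2_eq_square field_simps)
  finally have "- 3 * h * h1 - 2 * u * h * h2 + u * h1\<^sup>2 = h\<^sup>2 / 4"
    using u by simp
  moreover have "- (3 * disc.\<alpha> u + 2 * u * disc.\<alpha>' u + u * (disc.\<alpha> u)\<^sup>2)
     = (- 3 * h * h1 - 2 * u * h * h2 + u * h1\<^sup>2) / h\<^sup>2"
    using h0 by (simp add: disc.\<alpha>_def disc.\<alpha>'_def flip: defs) (simp add: power2_eq_square field_simps)
  ultimately show ?thesis
    using h0 by simp
qed

text \<open>
  The angular form is \<open>u\<inverse> J y\<close> with the rotation \<open>J\<close> by a right angle, and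
  \<open>(J y)\<^sub>i (J y)\<^sub>j = u \<delta>\<^sub>i\<^sub>j - y\<^sub>i y\<^sub>j\<close>.
\<close>

lemma disc_metric_normal_form:
  assumes "i < 2" "j < 2"
  shows "disc_metric y i j = disc.G y i j"
proof (cases "radius y = 0")
  case True
  then have "(y 0)\<^sup>2 + (y 1)\<^sup>2 = 0"
    by (simp add: radius_def)
  then have y: "y 0 = 0" "y (Suc 0) = 0"
    by (simp_all add: sum_power2_eq_zero_iff)
  then show ?thesis
    using assms True by (auto simp: disc_metric_def disc.G_def disc.h_def sqnorm_def kron_def less_2_cases_iff)
next
  case False
  define u where "u = sqnorm y"
  have rad: "radius y = sqrt u"
    by (simp add: radius_def u_def sqnorm_def)
  have u: "u > 0"
    using False rad by (simp add: less_le u_def sqnorm_def)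
  have rad2: "(radius y)\<^sup>2 = u" using u rad by simp
  have sin2: "4 * (sin (radius y / 2))\<^sup>2 = u * disc.h u"
    using cos_double_sin[of "sqrt u / 2"] by (simp add: disc_h(1)[OF u] rad)
  have dr: "d_radius y i * d_radius y j = y i * y j / u"
    using rad2 by (simp add: d_radius_def power2_eq_square)
  have da: "u * (u * (d_angle y i * d_angle y j)) = u * kron i j - y i * y j"
  proof -
    define J where "J i = (if i = 0 then - y 1 else y 0)" for i :: nat
    have "d_angle y i = J i / u" for i
      by (simp only: d_angle_def rad2 J_def)
    then have "u * (u * (d_angle y i * d_angle y j)) = J i * J j"
      using u by simp
    also have "\<dots> = u * kron i j - y i * y j"
      using assms unfolding less_2_cases_iff
      by (elim disjE) (simp_all add: J_def kron_def u_def sqnorm_def power2_eq_square algebra_simps)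
    finally show ?thesis .
  qed
  have "u * disc_metric y i j = y i * y j + disc.h u * (u * (u * (d_angle y i * d_angle y j)))"
    using False u by (simp add: disc_metric_def dr sin2 algebra_simps)
  also have "\<dots> = u * disc.G y i j"
    unfolding da disc.G_def u_def[symmetric] disc.h_def by (simp add: algebra_simps)
  finally show ?thesis using u by simp
qed

section \<open>The comparison manifold\<close>

interpretation disc: metric_chart 2 disc.G disc.U
  by (rule disc.metric_chart_G)

lemma flat_extension_chart_disc:
  assumes "2 \<le> m"
  shows "flat_extension_chart 2 disc.G disc.U m"
proof
  show "2 \<le> m" by (rule assms)
  show "disc.G (x(l := t)) i j = disc.G x i j" if "2 \<le> l" "i < 2" "j < 2" for l i j t x
    using that by (auto simp: disc.G_def sqnorm_def)
qed

lemma scalar_curvature_disc: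
  assumes "y \<in> disc.U"
  shows "scalar_curvature 2 disc.G y = 1 / 2"
  using assms disc_gauss_curvature[of "sqnorm y"]
  by (simp add: disc.scalar_curvature_G disc.U_def sqnorm_def)

definition disc_times_torus :: metric where
  "disc_times_torus = flat_extension 2 disc.G"

lemma g_bar_warped: "g_bar z r = warped_product ((sinh r)\<^sup>2) (\<lambda>\<theta>. 1 / z r \<theta>) disc_times_torus"
proof (intro ext)
  fix x :: point and i j :: nat
  have shift: "(\<lambda>k. x (k + 1)) = fibre x"
    by (simp add: fibre_def)
  show "g_bar z r x i j = warped_product ((sinh r)\<^sup>2) (\<lambda>\<theta>. 1 / z r \<theta>) disc_times_torus x i j"
    unfolding g_bar_def shift
    by (cases i; cases j)
      (auto simp: warped_product_def disc_times_torus_def flat_extension_def disc_metric_normal_form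
        power_divide less_2_cases_iff)
qed

lemma X_bar_chart:
  assumes "x \<in> X_bar"
  shows "fibre x \<in> disc.U"
proof -
  have "sqrt (sqnorm (fibre x)) \<le> pi / 3"
    using assms by (simp add: X_bar_def radius_def sqnorm_def)
  then have "sqnorm (fibre x) \<le> (pi / 3)\<^sup>2"
    by (rule sqrt_le_D)
  also have "\<dots> < (2 * pi)\<^sup>2"
    by (intro power_strict_mono) auto
  finally have "disc.h (sqnorm (fibre x)) > 0"
    by (intro disc_h_pos) (auto simp: sqnorm_def)
  then show ?thesis
    by (simp add: disc.U_def)
qed

text \<open>
  For a fixed radius \<open>r\<close> the comparison metric depends on \<open>z\<close> only through the warping function
  \<open>1 / z r\<close>, so its geometry is determined by this function and two derivatives, wherever \<open>z\<close> comes
  from.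
\<close>

locale comparison =
  fixes n :: nat and r :: real and z :: "real \<Rightarrow> real \<Rightarrow> real" and w' w'' :: "real \<Rightarrow> real"
  assumes dim: "n \<ge> 3" and r: "r > 0" and z_pos: "z r \<theta> > 0"
    and w_deriv: "((\<lambda>\<theta>. 1 / z r \<theta>) has_real_derivative w' \<theta>) (at \<theta>)"
    and w_deriv2: "(w' has_real_derivative w'' \<theta>) (at \<theta>)"
begin

lemma dim_Suc: "Suc (n - 1) = n" "2 \<le> n - 1"
  using dim by auto

interpretation flat: flat_extension_chart 2 disc.G disc.U "n - 1"
  by (rule flat_extension_chart_disc[OF dim_Suc(2)])

sublocale warped_product_chart "n - 1" disc_times_torus disc.U "(sinh r)\<^sup>2" "\<lambda>\<theta>. 1 / z r \<theta>" w' w''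
  rewrites "Suc (n - 1) = n"
    and "warped_product ((sinh r)\<^sup>2) (\<lambda>\<theta>. 1 / z r \<theta>) disc_times_torus = g_bar z r"
proof -
  interpret metric_chart "n - 1" disc_times_torus disc.U
    unfolding disc_times_torus_def by (rule flat.metric_chart_flat_extension)
  show "warped_product_chart (n - 1) disc_times_torus disc.U ((sinh r)\<^sup>2) (\<lambda>\<theta>. 1 / z r \<theta>) w' w''"
    by unfold_locales (use r z_pos w_deriv w_deriv2 in \<open>auto simp: less_imp_neq[symmetric]\<close>)
qed (simp_all only: dim_Suc g_bar_warped)

lemma scalar_curvature_g_bar:
  assumes x: "x \<in> X_bar"
  shows "scalar_curvature n (g_bar z r) x = 1 / 2 * (z r (x 0))\<^sup>2
     - 2 * (real n - 1) * (w'' (x 0) * z r (x 0)) / (sinh r)\<^sup>2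
     - (real n - 1) * (real n - 2) * (w' (x 0) * z r (x 0))\<^sup>2 / (sinh r)\<^sup>2"
proof -
  have "scalar_curvature (n - 1) disc_times_torus (fibre x) = 1 / 2"
    unfolding disc_times_torus_def flat.scalar_curvature_flat_extension[OF X_bar_chart[OF x]]
    by (rule scalar_curvature_disc[OF X_bar_chart[OF x]])
  moreover have "real (n - 1) = real n - 1"
    using dim by simp
  ultimately show ?thesis
    unfolding scalar_curvature_warped[OF X_bar_chart[OF x]]
    by (simp add: power_divide)
qed

end

section \<open>Mean curvature of a hypersurface with diagonal induced metric\<close>

text \<open>
  Existence and uniqueness evaluate the definite description of the unit normal; after that, only the
  diagonal of the second fundamental form survives the trace.
\<close>

lemma mean_curvature_diagonal:
  assumes N: "outward_unit_normal n g X F q N"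
    and unique: "\<And>N'. outward_unit_normal n g X F q N' \<Longrightarrow> N' = N"
    and diag: "\<And>a b. a < n - 1 \<Longrightarrow> b < n - 1 \<Longrightarrow> induced_metric n g F q a b = (if a = b then d a else 0)"
    and d: "\<And>a. a < n - 1 \<Longrightarrow> d a \<noteq> 0"
  shows "mean_curvature n g X F q = (\<Sum>a<n - 1. second_fundamental_form n g F q N a a / d a)"
proof -
  have the: "(THE N. outward_unit_normal n g X F q N) = N"
    using N unique by (rule the_equality)
  have "inverse_metric (n - 1) (induced_metric n g F) q a b = (if a = b then 1 / d a else 0)"
    if "a < n - 1" "b < n - 1" for a b
    using inverse_metric_diagonal[of "n - 1" "induced_metric n g F" q d a b] diag d that by blast
  then have "(\<Sum>b<n - 1. inverse_metric (n - 1) (induced_metric n g F) q a b * second_fundamental_form n g F q N a b)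
      = (\<Sum>b<n - 1. if a = b then second_fundamental_form n g F q N a a / d a else 0)" if "a < n - 1" for a
    using that by (intro sum.cong) auto
  then show ?thesis
    unfolding mean_curvature_def the by (intro sum.cong) auto
qed

lemma sum_coordinate_direction:
  fixes M :: "nat \<Rightarrow> nat \<Rightarrow> real"
  assumes "c < n"
  shows "(\<Sum>i<n. \<Sum>j<n. M i j * (if i = c then 1 else 0) * (if j = c then 1 else 0)) = M c c"
proof -
  have "(\<Sum>j<n. M i j * (if i = c then 1 else 0) * (if j = c then 1 else 0)) = (if i = c then M c c else 0)" for i
    using assms by (cases "i = c") (auto simp: if_distrib[of "\<lambda>t. _ * t"] cong: if_cong)
  then show ?thesis using assms by simp
qed

section \<open>The boundary of the comparison manifold\<close>

lemma partial_Y_bar: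
  "partial a (\<lambda>s. Y_bar s i) = (\<lambda>q.
     if a = 1 then (if i = 1 then - (pi / 3 * sin (q 1)) else if i = 2 then pi / 3 * cos (q 1) else 0)
     else if i = (if a = 0 then 0 else Suc a) then 1 else 0)"
proof
  fix q
  show "partial a (\<lambda>s. Y_bar s i) q =
     (if a = 1 then (if i = 1 then - (pi / 3 * sin (q 1)) else if i = 2 then pi / 3 * cos (q 1) else 0)
     else if i = (if a = 0 then 0 else Suc a) then 1 else 0)"
  proof (rule has_partial_imp)
    consider "i = 0" | "i = 1" | "i = 2" | k where "i = Suc (Suc (Suc k))"
      by (metis One_nat_def Suc_1 not0_implies_Suc)
    then show "has_partial a (\<lambda>s. Y_bar s i)
     (if a = 1 then (if i = 1 then - (pi / 3 * sin (q 1)) else if i = 2 then pi / 3 * cos (q 1) else 0)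
     else if i = (if a = 0 then 0 else Suc a) then 1 else 0) q"
      unfolding has_partial_def Y_bar_def
      by cases (auto intro!: derivative_eq_intros simp: fun_upd_def)
  qed
qed

context comparison
begin

lemma inner_g_bar:
  shows "inner_g n (g_bar z r) x V W = (sinh r)\<^sup>2 * (V 0 * W 0) + (1 / z r (x 0))\<^sup>2 *
     (disc.h (sqnorm (fibre x)) * (V 1 * W 1 + V 2 * W 2)
      + disc_fun (sqnorm (fibre x)) * ((x 1 * V 1 + x 2 * V 2) * (x 1 * W 1 + x 2 * W 2))
      + (\<Sum>i<n - 3. V (i + 3) * W (i + 3)))"
proof -
  define m where "m = n - 3"
  have n: "n = Suc (Suc (Suc m))" using dim by (simp add: m_def)
  define c where "c = (1 / z r (x 0))\<^sup>2"
  have gb: "g_bar z r x i j = (if i = 0 \<and> j = 0 then (sinh r)\<^sup>2 else if i = 0 \<or> j = 0 then 0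
      else c * disc_times_torus (fibre x) (i - 1) (j - 1))" for i j
    by (simp add: g_bar_warped warped_product_def c_def)
  have if0: "(if b then c else 0) * t * u = (if b then c * t * u else 0)" "s * (if b then c else 0) = (if b then s * c else 0)"
    for b and c s t u :: real by simp_all
  show ?thesis
    unfolding inner_g_def gb m_def[symmetric] unfolding n c_def[symmetric]
    by (simp add: sum.lessThan_Suc_shift disc_times_torus_def flat_extension_def
          disc.G_def kron_def if0 numeral_2_eq_2 numeral_3_eq_3 sum_distrib_left del: sum.lessThan_Suc cong: if_cong)
       (simp add: algebra_simps numeral_2_eq_2 sum_distrib_left)
qed

lemma Y_bar_values:
  "fibre (Y_bar q) 0 = pi / 3 * cos (q 1)" "fibre (Y_bar q) 1 = pi / 3 * sin (q 1)"
  "Y_bar q 0 = q 0" "Y_bar q 1 = pi / 3 * cos (q 1)" "Y_bar q 2 = pi / 3 * sin (q 1)"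
  "sqnorm (fibre (Y_bar q)) = (pi / 3)\<^sup>2"
  by (simp_all add: Y_bar_def sqnorm_def power_mult_distrib power_divide flip: distrib_left add_divide_distrib)

text \<open>
  The three values at \<open>\<rho> = \<pi> / 3\<close> that the boundary needs: \<open>f = 1\<close>, hence the boundary circle of the
  disc has length \<open>2 \<pi>\<close>; the normalization of radial length; and \<open>f f' = sin \<rho> = \<surd>3 / 2\<close>.
\<close>

lemma disc_boundary:
  shows "(pi / 3)\<^sup>2 * disc.h ((pi / 3)\<^sup>2) = 1"
    and "disc.h ((pi / 3)\<^sup>2) + disc_fun ((pi / 3)\<^sup>2) * (pi / 3)\<^sup>2 = 1"
    and "pi / 3 * (disc.h ((pi / 3)\<^sup>2) + (pi / 3)\<^sup>2 * disc.h' ((pi / 3)\<^sup>2)) = sqrt 3 / 2"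
proof -
  have s: "sqrt ((pi / 3)\<^sup>2) = pi / 3"
    unfolding real_sqrt_abs by simp
  have pos: "(0::real) < (pi / 3)\<^sup>2" by simp
  show "(pi / 3)\<^sup>2 * disc.h ((pi / 3)\<^sup>2) = 1"
    unfolding disc_h(1)[OF pos] s cos_60 by simp
  show "disc.h ((pi / 3)\<^sup>2) + disc_fun ((pi / 3)\<^sup>2) * (pi / 3)\<^sup>2 = 1"
    unfolding disc.h_def by (simp add: mult.commute)
  show "pi / 3 * (disc.h ((pi / 3)\<^sup>2) + (pi / 3)\<^sup>2 * disc.h' ((pi / 3)\<^sup>2)) = sqrt 3 / 2"
    unfolding disc_h(2)[OF pos] s sin_60 by simp
qed

lemma induced_Y_bar:
  assumes "a < n - 1" "b < n - 1"
  shows "induced_metric n (g_bar z r) Y_bar q a b =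
    (if a = b then if a = 0 then (sinh r)\<^sup>2 else (1 / z r (q 0))\<^sup>2 else 0)"
proof -
  define c where "c = (1 / z r (q 0))\<^sup>2"
  define u :: real where "u = (pi / 3)\<^sup>2"
  have uh: "u * disc.h u = 1" using disc_boundary(1) by (simp only: u_def)
  consider "a = 0" | "a = 1" | a' where "a = Suc (Suc a')" "a' < n - 3"
    using assms(1) by (cases a; cases "a - 1") auto
  then have A: "\<exists>a'. a = 0 \<or> a = 1 \<or> (a = Suc (Suc a') \<and> a' < n - 3)" by cases auto
  consider "b = 0" | "b = 1" | b' where "b = Suc (Suc b')" "b' < n - 3"
    using assms(2) by (cases b; cases "b - 1") auto
  then have B: "\<exists>b'. b = 0 \<or> b = 1 \<or> (b = Suc (Suc b') \<and> b' < n - 3)" by cases auto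
  have circle: "c * (disc.h u * (pi / 3 * sin t * (pi / 3 * sin t) + pi / 3 * cos t * (pi / 3 * cos t))) = c" for t
  proof -
    have "pi / 3 * sin t * (pi / 3 * sin t) + pi / 3 * cos t * (pi / 3 * cos t) = u * ((sin t)\<^sup>2 + (cos t)\<^sup>2)"
      unfolding u_def by (simp only: power2_eq_square ring_distribs mult_ac)
    then show ?thesis using uh by (simp add: mult.commute)
  qed
  have delta: "(\<Sum>i<n - 3. (if i = k then 1 else 0) * (if i = l then 1 else 0)) = (if k = l then 1 else (0::real))"
    if "k < n - 3" for k l
    using that by (simp add: if_distrib[of "\<lambda>t. t * _"] cong: if_cong)
  show ?thesis
    using A B circle[of "q 1"] unfolding induced_metric_def inner_g_bar partial_Y_bar Y_bar_values c_def[symmetric] u_def[symmetric]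
    by (elim exE disjE conjE) (simp_all add: delta algebra_simps)
qed

text \<open>
  The radial unit vector of the disc, rescaled by the warping factor.
\<close>

definition bar_normal :: "point \<Rightarrow> point" where
  "bar_normal q = (\<lambda>i. if i = 1 then z r (q 0) * cos (q 1) else if i = 2 then z r (q 0) * sin (q 1) else 0)"

text \<open>
  The normal is an eigenvector of the disc metric with eigenvalue \<open>h + u \<kappa> = 1\<close>.
\<close>

lemma inner_bar_normal:
  "inner_g n (g_bar z r) (Y_bar q) V (bar_normal q) = (V 1 * cos (q 1) + V 2 * sin (q 1)) / z r (q 0)"
proof -
  define t Z u where "t = q 1" and "Z = z r (q 0)" and "u = (pi / 3)\<^sup>2"
  have t1: "q (Suc 0) = t" by (simp add: t_def)
  define l where "l = V 1 * cos t + V 2 * sin t"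
  have Z: "Z > 0" using z_pos by (simp add: Z_def)
  have hk: "disc.h u + disc_fun u * u = 1" using disc_boundary(2) by (simp only: u_def)
  have 1: "pi / 3 * cos t * (Z * cos t) + pi / 3 * sin t * (Z * sin t) = pi / 3 * Z"
  proof -
    have "pi / 3 * cos t * (Z * cos t) + pi / 3 * sin t * (Z * sin t) = pi / 3 * Z * ((sin t)\<^sup>2 + (cos t)\<^sup>2)"
      by (simp only: power2_eq_square ring_distribs mult_ac add.commute)
    then show ?thesis by simp
  qed
  have "inner_g n (g_bar z r) (Y_bar q) V (bar_normal q) = (1 / Z)\<^sup>2 *
     (disc.h u * (V 1 * (Z * cos t) + V 2 * (Z * sin t))
      + disc_fun u * ((pi / 3 * cos t * V 1 + pi / 3 * sin t * V 2) * (pi / 3 * cos t * (Z * cos t) + pi / 3 * sin t * (Z * sin t))))"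
    unfolding inner_g_bar Y_bar_values t_def[symmetric] u_def[symmetric] Z_def[symmetric]
    by (simp add: bar_normal_def t1 flip: Z_def)
  also have "\<dots> = (1 / Z)\<^sup>2 * (Z * (disc.h u + disc_fun u * u) * l)"
    unfolding 1 by (simp add: u_def l_def power2_eq_square algebra_simps)
  also have "\<dots> = l / Z"
    unfolding hk using Z by (simp add: power2_eq_square)
  finally show ?thesis by (simp only: l_def t_def Z_def)
qed

lemma inner_g_bar_commute: "inner_g n (g_bar z r) x V W = inner_g n (g_bar z r) x W V"
  unfolding inner_g_bar by (simp add: mult.commute)

text \<open>
  The normal is radial in the Cartesian coordinates of the disc, so moving along it changes the radius
  and nothing else.
\<close>

lemma X_bar_normal_line:
  "(\<lambda>i. Y_bar q i + s * bar_normal q i) \<in> X_bar \<longleftrightarrow> \<bar>pi / 3 + s * z r (q 0)\<bar> \<le> pi / 3"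
proof -
  have "(pi / 3 * cos (q 1) + s * (z r (q 0) * cos (q 1)))\<^sup>2 + (pi / 3 * sin (q 1) + s * (z r (q 0) * sin (q 1)))\<^sup>2
     = (pi / 3 + s * z r (q 0))\<^sup>2 * ((sin (q 1))\<^sup>2 + (cos (q 1))\<^sup>2)"
    by (simp only: power2_eq_square ring_distribs mult_ac add_ac)
  then have "sqrt ((pi / 3 * cos (q 1) + s * (z r (q 0) * cos (q 1)))\<^sup>2 + (pi / 3 * sin (q 1) + s * (z r (q 0) * sin (q 1)))\<^sup>2)
     = \<bar>pi / 3 + s * z r (q 0)\<bar>"
    by simp
  then show ?thesis
    by (simp add: X_bar_def radius_def Y_bar_def bar_normal_def)
qed

lemma bar_normal_outward: "outward_unit_normal n (g_bar z r) X_bar Y_bar q (bar_normal q)"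
  unfolding outward_unit_normal_def
proof (intro conjI allI impI)
  have Z: "z r (q 0) > 0" by (rule z_pos)
  show "bar_normal q i = 0" if "n \<le> i" for i
    using that dim by (simp add: bar_normal_def)
  show "inner_g n (g_bar z r) (Y_bar q) (bar_normal q) (\<lambda>i. partial a (\<lambda>s. Y_bar s i) q) = 0" for a
    by (subst inner_g_bar_commute) (simp add: inner_bar_normal partial_Y_bar)
  show "inner_g n (g_bar z r) (Y_bar q) (bar_normal q) (bar_normal q) = 1"
  proof -
    have "z r (q 0) * cos (q 1) * cos (q 1) + z r (q 0) * sin (q 1) * sin (q 1)
        = z r (q 0) * ((sin (q 1))\<^sup>2 + (cos (q 1))\<^sup>2)"
      by (simp only: power2_eq_square ring_distribs mult_ac add_ac)
    then show ?thesis
      using Z unfolding inner_bar_normal by (simp add: bar_normal_def)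
  qed
  show "\<exists>\<epsilon>>0. \<forall>t. 0 < t \<and> t < \<epsilon> \<longrightarrow> (\<lambda>i. Y_bar q i - t * bar_normal q i) \<in> X_bar
      \<and> (\<lambda>i. Y_bar q i + t * bar_normal q i) \<notin> X_bar"
  (* Up to this parameter the inward normal line has not yet passed the centre of the disc. *)
  proof (intro exI[of _ "pi / 3 / z r (q 0)"] conjI allI impI)
    show "pi / 3 / z r (q 0) > 0" using Z by simp
    fix t assume t: "0 < t \<and> t < pi / 3 / z r (q 0)"
    then have tZ: "0 < t * z r (q 0)" "t * z r (q 0) < pi / 3"
      using Z by (auto simp: pos_less_divide_eq)
    show "(\<lambda>i. Y_bar q i - t * bar_normal q i) \<in> X_bar"
      using X_bar_normal_line[of q "- t"] tZ by simp
    show "(\<lambda>i. Y_bar q i + t * bar_normal q i) \<notin> X_bar"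
      unfolding X_bar_normal_line using tZ by simp
  qed
qed

text \<open>
  Orthogonality to the coordinate fields leaves only the radial direction, unit length leaves a sign,
  and the side on which \<open>X_bar\<close> lies decides the sign.
\<close>

lemma bar_normal_unique:
  assumes N: "outward_unit_normal n (g_bar z r) X_bar Y_bar q N"
  shows "N = bar_normal q"
proof -
  define t Z u where "t = q 1" and "Z = z r (q 0)" and "u = (pi / 3)\<^sup>2"
  have t1: "q (Suc 0) = t" by (simp add: t_def)
  have Z: "Z > 0" using z_pos by (simp add: Z_def)
  have hk: "disc.h u + disc_fun u * u = 1" and uh: "u * disc.h u = 1"
    using disc_boundary(1,2) by (simp_all only: u_def)
  have tangent: "inner_g n (g_bar z r) (Y_bar q) N (\<lambda>i. partial a (\<lambda>s. Y_bar s i) q) = 0" if "a < n - 1" for a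
    using N that by (simp add: outward_unit_normal_def)
  have unit: "inner_g n (g_bar z r) (Y_bar q) N N = 1"
    using N by (simp add: outward_unit_normal_def)
  have N0: "N 0 = 0"
    using tangent[of 0] dim r unfolding partial_Y_bar inner_g_bar by simp
  have N3: "N i = 0" if "i \<ge> 3" for i
  proof (cases "i < n")
    case True
    define k where "k = i - 3"
    have k: "i = Suc (Suc (Suc k))" "k < n - 3" using that True by (auto simp: k_def)
    have "(\<Sum>j<n - 3. N (Suc (Suc (Suc j))) * (if j = k then 1 else 0)) = N i"
      using k by (simp add: if_distrib[of "\<lambda>t. _ * t"] cong: if_cong)
    moreover have "Suc (Suc k) < n - 1" using k(2) by linarith
    ultimately show ?thesis
      using tangent[of "Suc (Suc k)"] k(1) Z unfolding partial_Y_bar inner_g_bar Y_bar_values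
      by (simp add: numeral_3_eq_3 flip: Z_def)
  qed (use N in \<open>simp add: outward_unit_normal_def\<close>)
  have "(1 / Z)\<^sup>2 * (disc.h u * (pi / 3 * (N 2 * cos t - N 1 * sin t))) = 0"
    using tangent[of 1] dim unfolding partial_Y_bar inner_g_bar Y_bar_values
    by (simp add: algebra_simps t1 flip: Z_def u_def)
  then have perp: "N 2 * cos t - N 1 * sin t = 0"
    using uh Z by auto
  define l where "l = N 1 * cos t + N 2 * sin t"
  have sc: "(sin t)\<^sup>2 + (cos t)\<^sup>2 = 1" by simp
  have "l * cos t = N 1 * ((sin t)\<^sup>2 + (cos t)\<^sup>2) + sin t * (N 2 * cos t - N 1 * sin t)"
    "l * sin t = N 2 * ((sin t)\<^sup>2 + (cos t)\<^sup>2) - cos t * (N 2 * cos t - N 1 * sin t)"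
    unfolding l_def by (simp_all only: power2_eq_square) (simp_all add: algebra_simps del: sin_cos_squared_add sin_cos_squared_add2 sin_cos_squared_add3)
  then have N12: "N 1 = l * cos t" "N 2 = l * sin t"
    unfolding perp sc by simp_all
  have N_eq: "N = (\<lambda>i. l / Z * bar_normal q i)"
  proof
    fix i :: nat
    consider "i = 0" | "i = 1" | "i = 2" | "i \<ge> 3" by linarith
    then show "N i = l / Z * bar_normal q i"
      using N0 N12 N3 Z by cases (auto simp: bar_normal_def t1 simp flip: Z_def)
  qed
  have "inner_g n (g_bar z r) (Y_bar q) N N = l / Z * inner_g n (g_bar z r) (Y_bar q) N (bar_normal q)"
    by (subst (2) N_eq) (simp add: inner_g_def sum_distrib_left mult_ac)
  also have "inner_g n (g_bar z r) (Y_bar q) N (bar_normal q) = l / Z"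
    unfolding inner_bar_normal by (simp add: l_def t1 flip: Z_def)
  finally have "l / Z * (l / Z) = 1"
    unfolding unit by (rule sym)
  then have "(l / Z)\<^sup>2 = 1"
    by (simp only: power2_eq_square)
  moreover have "l / Z \<noteq> - 1"
  proof
    assume neg: "l / Z = - 1"
    obtain \<epsilon> where "\<epsilon> > 0" and \<epsilon>: "\<And>t. 0 < t \<and> t < \<epsilon> \<Longrightarrow> (\<lambda>i. Y_bar q i - t * N i) \<in> X_bar"
      using N unfolding outward_unit_normal_def by blast
    have "(\<lambda>i. Y_bar q i - \<epsilon> / 2 * N i) \<in> X_bar"
      using \<epsilon>[of "\<epsilon> / 2"] \<open>\<epsilon> > 0\<close> by simp
    moreover have "(\<lambda>i. Y_bar q i - \<epsilon> / 2 * N i) = (\<lambda>i. Y_bar q i + \<epsilon> / 2 * bar_normal q i)"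
      by (subst N_eq) (simp add: neg)
    ultimately have "\<bar>pi / 3 + \<epsilon> / 2 * Z\<bar> \<le> pi / 3"
      using X_bar_normal_line[of q "\<epsilon> / 2"] by (simp add: Z_def)
    moreover have "\<epsilon> / 2 * Z > 0" using \<open>\<epsilon> > 0\<close> Z by simp
    ultimately show False by linarith
  qed
  ultimately have "l / Z = 1"
    by (simp add: power2_eq_1_iff)
  then show ?thesis
    using N_eq by simp
qed

text \<open>
  A coordinate line of \<open>\<theta>\<close> or of a torus factor has covariant acceleration without radial component:
  the warping function depends on \<open>\<theta>\<close> alone. For the boundary circle of the disc, the tangent is orthogonal to
  \<open>y\<close> and only the coefficient \<open>\<beta>\<close> of the Christoffel symbols contributes; the result is \<open>f f'\<close> at
  the boundary times the factor \<open>w\<close>.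
\<close>

lemma second_fundamental_form_bar:
  assumes "a < n - 1"
  shows "second_fundamental_form n (g_bar z r) Y_bar q (bar_normal q) a a = (if a = 1 then sqrt 3 / 2 / z r (q 0) else 0)"
proof -
  interpret flat: flat_extension_chart 2 disc.G disc.U "n - 1"
    by (rule flat_extension_chart_disc[OF dim_Suc(2)])
  define V where "V k = partial a (partial a (\<lambda>s. Y_bar s k)) q
     + (\<Sum>i<n. \<Sum>j<n. christoffel n (g_bar z r) k i j (Y_bar q)
          * partial a (\<lambda>s. Y_bar s i) q * partial a (\<lambda>s. Y_bar s j) q)" for k
  have sff: "second_fundamental_form n (g_bar z r) Y_bar q (bar_normal q) a a
     = - ((V 1 * cos (q 1) + V 2 * sin (q 1)) / z r (q 0))"
    unfolding second_fundamental_form_def V_def inner_bar_normal by simp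
  have X: "fibre (Y_bar q) \<in> disc.U"
    using disc_boundary(1) by (auto simp: disc.U_def Y_bar_values)
  have \<Gamma>: "christoffel n (g_bar z r) (Suc k) (Suc i) (Suc j) (Y_bar q)
      = (if i < 2 \<and> j < 2 then disc.\<Gamma> k i j (fibre (Y_bar q)) else 0)" if "k < 2" "i < n - 1" "j < n - 1" for k i j
  proof -
    have k: "k < n - 1" using that(1) dim_Suc(2) by linarith
    show ?thesis
      unfolding christoffel_warped(7)[OF X that(2,3) k] disc_times_torus_def
        flat.christoffel_flat_extension[OF X k that(2,3)]
      using that(1) by (simp add: disc.christoffel_G[OF X])
  qed
  show ?thesis
  proof (cases "a = 1")
    case False
    define c where "c = (if a = 0 then 0 else Suc a)"
    have c: "c < n" using assms dim by (auto simp: c_def)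
    have T: "partial a (\<lambda>s. Y_bar s i) = (\<lambda>q. if i = c then 1 else 0)" for i
      using False by (simp add: partial_Y_bar c_def)
    have V: "V k = christoffel n (g_bar z r) k c c (Y_bar q)" for k
      unfolding V_def T sum_coordinate_direction[OF c] by simp
    have "V (Suc k) = 0" if "k < 2" for k
      unfolding V using christoffel_warped(3)[OF X, of "Suc k"] \<Gamma>[OF that, of a a] False assms
      by (cases "a = 0") (auto simp: c_def)
    from this[of 0] this[of 1] have "V 1 = 0" "V 2 = 0" by (simp_all add: numeral_2_eq_2)
    then show ?thesis using False by (simp add: sff)
  next
    case a: True
    define t Z u where "t = q 1" and "Z = z r (q 0)" and "u = (pi / 3)\<^sup>2"
    have t1: "q (Suc 0) = t" by (simp add: t_def)
    define \<tau> where "\<tau> i = (if i = 0 then - (pi / 3 * sin t) else pi / 3 * cos t)" for i :: nat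
    define y where "y = fibre (Y_bar q)"
    have y: "y 0 = pi / 3 * cos t" "y 1 = pi / 3 * sin t" "sqnorm y = u"
      by (simp_all only: y_def Y_bar_values t_def u_def)
    have y\<tau>: "y 0 * \<tau> 0 + y 1 * \<tau> 1 = 0"
      by (simp only: y) (simp add: \<tau>_def)
    have \<tau>\<tau>: "\<tau> 0 * \<tau> 0 + \<tau> 1 * \<tau> 1 = u"
    proof -
      have "\<tau> 0 * \<tau> 0 + \<tau> 1 * \<tau> 1 = u * ((sin t)\<^sup>2 + (cos t)\<^sup>2)"
        unfolding \<tau>_def u_def by (simp add: power2_eq_square algebra_simps del: sin_cos_squared_add sin_cos_squared_add2 sin_cos_squared_add3)
      then show ?thesis by simp
    qed
    define m where "m = n - 3"
    have n: "n = Suc (Suc (Suc m))" using dim by (simp add: m_def)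
    have V: "V (Suc k) = - y k + disc.\<beta> u * u * y k" if k: "k < 2" for k
    proof -
      have "(\<Sum>i<n. \<Sum>j<n. christoffel n (g_bar z r) (Suc k) i j (Y_bar q)
          * partial a (\<lambda>s. Y_bar s i) q * partial a (\<lambda>s. Y_bar s j) q)
        = (\<Sum>i<2. \<Sum>j<2. disc.\<Gamma> k i j y * \<tau> i * \<tau> j)"
        unfolding partial_Y_bar a using \<Gamma>[OF k] 
        by (simp add: n sum.lessThan_Suc_shift \<tau>_def numeral_2_eq_2 y_def t1 del: sum.lessThan_Suc)
      also have "\<dots> = 2 * disc.\<alpha> u * (y 0 * \<tau> 0 + y 1 * \<tau> 1) * \<tau> k + disc.\<beta> u * (\<tau> 0 * \<tau> 0 + \<tau> 1 * \<tau> 1) * y k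
          + disc.\<gamma> u * (y 0 * \<tau> 0 + y 1 * \<tau> 1) * (y 0 * \<tau> 0 + y 1 * \<tau> 1) * y k"
        using k unfolding less_2_cases_iff
        by (elim disjE) (simp_all add: disc.\<Gamma>_def y(3) sum_two kron_def, simp_all add: algebra_simps)
      also have "\<dots> = disc.\<beta> u * u * y k"
        unfolding y\<tau> \<tau>\<tau> by simp
      finally have sum: "(\<Sum>i<n. \<Sum>j<n. christoffel n (g_bar z r) (Suc k) i j (Y_bar q)
          * partial a (\<lambda>s. Y_bar s i) q * partial a (\<lambda>s. Y_bar s j) q) = disc.\<beta> u * u * y k" .
      have "has_partial 1 (\<lambda>q. if Suc k = 1 then - (pi / 3 * sin (q 1)) else if Suc k = 2 then pi / 3 * cos (q 1) else 0) (- y k) q"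
        using k unfolding less_2_cases_iff has_partial_def
        by (elim disjE) (auto intro!: derivative_eq_intros simp: y y(2)[simplified] t_def)
      then have "partial a (partial a (\<lambda>s. Y_bar s (Suc k))) q = - y k"
        unfolding partial_Y_bar a by (intro has_partial_imp) simp
      then show ?thesis
        unfolding V_def sum by simp
    qed
    have yy: "y 0 * cos t + y 1 * sin t = pi / 3"
    proof -
      have "y 0 * cos t + y 1 * sin t = pi / 3 * ((sin t)\<^sup>2 + (cos t)\<^sup>2)"
        unfolding y by (simp only: power2_eq_square ring_distribs mult_ac add_ac)
      then show ?thesis by simp
    qed
    have "V 1 * cos t + V 2 * sin t = (disc.\<beta> u * u - 1) * (y 0 * cos t + y 1 * sin t)"
    proof -
      have "V 1 = - y 0 + disc.\<beta> u * u * y 0" "V 2 = - y 1 + disc.\<beta> u * u * y 1"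
        using V[of 0] V[of 1] by (simp_all add: numeral_2_eq_2)
      then show ?thesis
        by (simp only:) (simp add: algebra_simps)
    qed
    also have "\<dots> = - (pi / 3 * (disc.h u + u * disc.h' u))"
      unfolding yy disc.\<beta>_def disc.h_def by (simp add: algebra_simps)
    also have "\<dots> = - (sqrt 3 / 2)"
      using disc_boundary(3) by (simp only: u_def)
    finally show ?thesis
      unfolding sff by (simp add: a t_def)
  qed
qed

lemma mean_curvature_bar:
  "mean_curvature n (g_bar z r) X_bar Y_bar q = sqrt 3 / 2 * z r (q 0)"
proof -
  define d where "d a = (if a = 0 then (sinh r)\<^sup>2 else (1 / z r (q 0))\<^sup>2)" for a :: nat
  have Z: "z r (q 0) > 0" by (rule z_pos)
  have "mean_curvature n (g_bar z r) X_bar Y_bar q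
     = (\<Sum>a<n - 1. second_fundamental_form n (g_bar z r) Y_bar q (bar_normal q) a a / d a)"
    by (rule mean_curvature_diagonal[OF bar_normal_outward bar_normal_unique])
      (use Z r in \<open>auto simp: induced_Y_bar d_def\<close>)
  also have "\<dots> = (\<Sum>a<n - 1. if a = 1 then sqrt 3 / 2 * z r (q 0) else 0)"
    using Z by (intro sum.cong) (auto simp: second_fundamental_form_bar d_def power2_eq_square)
  also have "\<dots> = sqrt 3 / 2 * z r (q 0)"
    using dim by simp
  finally show ?thesis .
qed

end

section \<open>Geodesics of the hyperbolic plane\<close>

lemma inverse_hyperbolic:
  assumes "y 1 \<noteq> 0" "k < n" "l < n"
  shows "inverse_metric n hyperbolic_metric y k l = (if k = l then (y 1)\<^sup>2 else 0)"
  using inverse_metric_diagonal[of n hyperbolic_metric y "\<lambda>_. 1 / (y 1)\<^sup>2"] assms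
  by (simp add: hyperbolic_metric_def)

lemma partial_hyperbolic:
  assumes "y 1 \<noteq> 0"
  shows "partial l (\<lambda>y. hyperbolic_metric y i j) y = (if i = j \<and> l = 1 then - 2 / (y 1) ^ 3 else 0)"
  using assms unfolding partial_def hyperbolic_metric_def
  by (cases "l = 1"; cases "i = j"; intro DERIV_imp_deriv)
    (auto intro!: derivative_eq_intros simp: power2_eq_square power3_eq_cube field_simps)

lemma christoffel_hyperbolic:
  assumes y: "y 1 \<noteq> 0" and "k < n" "i < n" "j < n"
  shows "christoffel n hyperbolic_metric k i j y =
    ((if i = j \<and> k = 1 then 1 else 0) - (if j = k \<and> i = 1 then 1 else 0) - (if i = k \<and> j = 1 then 1 else 0)) / y 1"
proof -
  define F where "F l = partial i (\<lambda>y. hyperbolic_metric y j l) y + partial j (\<lambda>y. hyperbolic_metric y i l) y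
       - partial l (\<lambda>y. hyperbolic_metric y i j) y" for l
  have "christoffel n hyperbolic_metric k i j y = (\<Sum>l<n. if l = k then (y 1)\<^sup>2 * F k else 0) / 2"
    unfolding christoffel_def F_def[symmetric]
    using assms by (intro arg_cong[of _ _ "\<lambda>t. t / 2"] sum.cong refl) (auto simp: inverse_hyperbolic)
  also have "\<dots> = (y 1)\<^sup>2 * F k / 2"
    using assms by simp
  also have "F k = ((if j = k \<and> i = 1 then 1 else 0) + (if i = k \<and> j = 1 then 1 else 0)
      - (if i = j \<and> k = 1 then 1 else 0)) * (- 2 / (y 1) ^ 3)"
  proof -
    have "partial l (\<lambda>y. hyperbolic_metric y i j) y = (if i = j \<and> l = 1 then 1 else 0) * (- 2 / (y 1) ^ 3)" for i j l
      by (simp only: partial_hyperbolic[where y = y, OF y] if_distrib[of "\<lambda>t. t * _"] mult_1 mult_zero_left)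
    then show ?thesis
      by (simp only: F_def left_diff_distrib distrib_right)
  qed
  also have "(y 1)\<^sup>2 * (s * (- 2 / (y 1) ^ 3)) / 2 = - s / y 1" for s :: real
    using y by (simp add: power2_eq_square power3_eq_cube)
  finally show ?thesis
    by simp
qed

text \<open>
  The quotient of the heights of the starting point and of the point at distance \<open>\<rho>\<close> on the geodesic
  with initial angle \<open>\<psi>\<close> against the horizontal, see \<open>hyperbolic_geodesic\<close>.
\<close>

definition depth :: "real \<Rightarrow> real \<Rightarrow> real" where
  "depth \<rho> \<psi> = cosh \<rho> - sin \<psi> * sinh \<rho>"

lemma depth_bounds:
  assumes "\<rho> \<ge> 0"
  shows "exp (- \<rho>) \<le> depth \<rho> \<psi>" "depth \<rho> \<psi> \<le> exp \<rho>"
proof -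
  have "\<bar>sin \<psi> * sinh \<rho>\<bar> \<le> 1 * sinh \<rho>"
    using assms unfolding abs_mult by (intro mult_mono) auto
  moreover have "exp (- \<rho>) = cosh \<rho> - sinh \<rho>" "exp \<rho> = cosh \<rho> + sinh \<rho>"
    by (simp_all add: cosh_def sinh_def field_simps)
  ultimately show "exp (- \<rho>) \<le> depth \<rho> \<psi>" "depth \<rho> \<psi> \<le> exp \<rho>"
    by (simp_all add: depth_def)
qed

lemma depth_pos: "\<rho> \<ge> 0 \<Longrightarrow> depth \<rho> \<psi> > 0"
  using depth_bounds(1)[of \<rho> \<psi>] exp_gt_zero[of "- \<rho>"] by linarith

lemma constant_on_halfline:
  fixes f :: "real \<Rightarrow> real"
  assumes "\<And>t. t \<ge> 0 \<Longrightarrow> (f has_real_derivative 0) (at t within {0..})" "t \<ge> 0"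
  shows "f t = f 0"
proof -
  obtain c where "\<And>x. x \<in> {0..} \<Longrightarrow> f x = c"
    using has_field_derivative_zero_constant[of "{0..}" f] assms(1) by auto
  then show ?thesis
    using assms(2) by simp
qed

text \<open>
  The speed \<open>(x'\<^sup>2 + z'\<^sup>2) / z\<^sup>2\<close> and the momentum \<open>x' / z\<^sup>2\<close> are conserved. Unit speed turns the equation
  for \<open>z\<close> into the linear equation \<open>w'' = w\<close> for \<open>w = 1 / z\<close>, which is solved by making
  \<open>(w + w') exp (- t)\<close> and \<open>(w - w') exp t\<close> constant; conservation of momentum then integrates \<open>x\<close>.
\<close>

lemma hyperbolic_geodesic:
  assumes geo: "geodesic 2 hyperbolic_metric {0..} c V"
    and pos: "\<And>t. t \<ge> 0 \<Longrightarrow> c t 1 > 0"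
    and init: "V 0 0 = c 0 1 * cos \<psi>" "V 0 1 = c 0 1 * sin \<psi>"
    and t: "t \<ge> 0"
  shows "c t 0 = c 0 0 + c 0 1 * cos \<psi> * sinh t / depth t \<psi>" "c t 1 = c 0 1 / depth t \<psi>"
proof -
  define x z a b where "x t = c t 0" and "z t = c t 1" and "a t = V t 0" and "b t = V t 1" for t
  note defs = this
  define P where "P = c 0 1"
  have P: "P > 0" using pos[of 0] by (simp add: P_def)
  have zp: "z t > 0" if "t \<ge> 0" for t
    using pos[OF that] by (simp add: defs)
  have ode: "((\<lambda>s. c s k) has_real_derivative V t k) (at t within {0..})"
     "((\<lambda>s. V s k) has_real_derivative
        - (\<Sum>i<2. \<Sum>j<2. christoffel 2 hyperbolic_metric k i j (c t) * V t i * V t j)) (at t within {0..})"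
    if "t \<ge> 0" "k < 2" for t k
    using geo that by (auto simp: geodesic_def)
  have dx: "(x has_real_derivative a t) (at t within {0..})"
    and dz: "(z has_real_derivative b t) (at t within {0..})" if "t \<ge> 0" for t
    using ode(1)[OF that, of 0] ode(1)[OF that, of 1] by (simp_all add: defs[abs_def])
  have da: "(a has_real_derivative 2 * a t * b t / z t) (at t within {0..})"
    and db: "(b has_real_derivative ((b t)\<^sup>2 - (a t)\<^sup>2) / z t) (at t within {0..})" if "t \<ge> 0" for t
  proof -
    have "- (\<Sum>i<2. \<Sum>j<2. christoffel 2 hyperbolic_metric 0 i j (c t) * V t i * V t j) = 2 * a t * b t / z t"
      "- (\<Sum>i<2. \<Sum>j<2. christoffel 2 hyperbolic_metric 1 i j (c t) * V t i * V t j) = ((b t)\<^sup>2 - (a t)\<^sup>2) / z t"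
      using zp[OF that] unfolding sum_two
      by (simp_all add: christoffel_hyperbolic defs power2_eq_square diff_divide_distrib)
    then show "(a has_real_derivative 2 * a t * b t / z t) (at t within {0..})"
      "(b has_real_derivative ((b t)\<^sup>2 - (a t)\<^sup>2) / z t) (at t within {0..})"
      using ode(2)[OF that, of 0] ode(2)[OF that, of 1] by (simp_all add: defs[abs_def])
  qed
  have energy: "((a t)\<^sup>2 + (b t)\<^sup>2) / (z t)\<^sup>2 = 1" if "t \<ge> 0" for t
  proof -
    have "((\<lambda>t. ((a t)\<^sup>2 + (b t)\<^sup>2) / (z t)\<^sup>2) has_real_derivative 0) (at t within {0..})" if "t \<ge> 0" for t
      using zp[OF that] that
      by (auto intro!: derivative_eq_intros da db dz simp: field_simps power2_eq_square)
    from constant_on_halfline[of "\<lambda>t. ((a t)\<^sup>2 + (b t)\<^sup>2) / (z t)\<^sup>2", OF this that]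
    have "((a t)\<^sup>2 + (b t)\<^sup>2) / (z t)\<^sup>2 = ((a 0)\<^sup>2 + (b 0)\<^sup>2) / (z 0)\<^sup>2" .
    also have "\<dots> = P\<^sup>2 * ((cos \<psi>)\<^sup>2 + (sin \<psi>)\<^sup>2) / P\<^sup>2"
      by (simp only: defs init P_def[symmetric] power_mult_distrib distrib_left)
    also have "\<dots> = 1"
      using P by simp
    finally show ?thesis .
  qed
  have dv: "((\<lambda>t. - b t / (z t)\<^sup>2) has_real_derivative 1 / z t) (at t within {0..})" if "t \<ge> 0" for t
  proof -
    have "((\<lambda>t. - b t / (z t)\<^sup>2) has_real_derivative (((a t)\<^sup>2 + (b t)\<^sup>2) / (z t)\<^sup>2) / z t) (at t within {0..})"
      using zp[OF that] that
      by (auto intro!: derivative_eq_intros db dz simp: field_simps power2_eq_square)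
    then show ?thesis using energy[OF that] by simp
  qed
  have dw: "((\<lambda>t. 1 / z t) has_real_derivative - b t / (z t)\<^sup>2) (at t within {0..})" if "t \<ge> 0" for t
    using zp[OF that] that by (auto intro!: derivative_eq_intros dz simp: power2_eq_square)
  define w v where "w t = 1 / z t" and "v t = - b t / (z t)\<^sup>2" for t
  have dw: "(w has_real_derivative v t) (at t within {0..})"
    and dv: "(v has_real_derivative w t) (at t within {0..})" if "t \<ge> 0" for t
    using dw[OF that] dv[OF that] by (simp_all add: w_def[abs_def] v_def[abs_def])
  have init_wv: "w 0 = 1 / P" "v 0 = - sin \<psi> / P"
  proof -
    have "z 0 = P" "b 0 = P * sin \<psi>"
      by (simp_all only: defs init P_def)
    then show "w 0 = 1 / P" "v 0 = - sin \<psi> / P"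
      using P by (simp_all add: w_def v_def power2_eq_square)
  qed
  have plus: "(w t + v t) * exp (- t) = (1 - sin \<psi>) / P" if "t \<ge> 0" for t
  proof -
    have "((\<lambda>t. (w t + v t) * exp (- t)) has_real_derivative 0) (at t within {0..})" if "t \<ge> 0" for t
      using that by (auto intro!: derivative_eq_intros dv dw simp: algebra_simps)
    from constant_on_halfline[of "\<lambda>t. (w t + v t) * exp (- t)", OF this that] show ?thesis
      by (simp add: init_wv diff_divide_distrib)
  qed
  have minus: "(w t - v t) * exp t = (1 + sin \<psi>) / P" if "t \<ge> 0" for t
  proof -
    have "((\<lambda>t. (w t - v t) * exp t) has_real_derivative 0) (at t within {0..})" if "t \<ge> 0" for t
      using that by (auto intro!: derivative_eq_intros dv dw simp: algebra_simps)
    from constant_on_halfline[of "\<lambda>t. (w t - v t) * exp t", OF this that] show ?thesis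
      by (simp add: init_wv add_divide_distrib)
  qed
  have w: "1 / z t = depth t \<psi> / P" if "t \<ge> 0" for t
  proof -
    have "w t + v t = (1 - sin \<psi>) / P * exp t"
      unfolding plus[OF that, symmetric] by (simp add: exp_minus)
    moreover have "w t - v t = (1 + sin \<psi>) / P * exp (- t)"
      unfolding minus[OF that, symmetric] by (simp add: exp_minus)
    ultimately have "2 * w t = (1 - sin \<psi>) / P * exp t + (1 + sin \<psi>) / P * exp (- t)"
      by linarith
    also have "\<dots> = 2 * (depth t \<psi> / P)"
      using P by (simp add: depth_def cosh_def sinh_def field_simps)
    finally show ?thesis by (simp add: w_def)
  qed
  have z: "z t = P / depth t \<psi>" if "t \<ge> 0" for t
  proof -
    have "z t = 1 / (1 / z t)" by simp
    also have "\<dots> = P / depth t \<psi>" unfolding w[OF that] by simp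
    finally show ?thesis .
  qed
  from z[OF t] show "c t 1 = c 0 1 / depth t \<psi>"
    by (simp only: defs P_def)
  have mom: "a t = cos \<psi> / P * (z t)\<^sup>2" if "t \<ge> 0" for t
  proof -
    have "((\<lambda>t. a t / (z t)\<^sup>2) has_real_derivative 0) (at t within {0..})" if "t \<ge> 0" for t
      using zp[OF that] that
      by (auto intro!: derivative_eq_intros da dz simp: field_simps power2_eq_square)
    from constant_on_halfline[of "\<lambda>t. a t / (z t)\<^sup>2", OF this that]
    have const: "a t / (z t)\<^sup>2 = a 0 / (z 0)\<^sup>2" .
    show ?thesis
    proof -
      have "a 0 = P * cos \<psi>" "z 0 = P"
        by (simp_all only: defs init P_def)
      then have "a t / (z t)\<^sup>2 = cos \<psi> / P"
        using const P by (simp add: power2_eq_square)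
      then show ?thesis
        using zp[OF that] by (simp add: divide_eq_eq)
    qed
  qed
  have dq: "((\<lambda>t. P * cos \<psi> * sinh t / depth t \<psi>) has_real_derivative a t) (at t within {0..})" if "t \<ge> 0" for t
  proof -
    have D: "depth t \<psi> > 0" by (rule depth_pos[OF that])
    have "((\<lambda>t. P * cos \<psi> * sinh t / depth t \<psi>) has_real_derivative
       P * cos \<psi> * (cosh t * depth t \<psi> - sinh t * (sinh t - sin \<psi> * cosh t)) / (depth t \<psi>)\<^sup>2) (at t within {0..})"
      using D unfolding depth_def
      by (auto intro!: derivative_eq_intros simp: power2_eq_square) (simp add: algebra_simps)
    also have "cosh t * depth t \<psi> - sinh t * (sinh t - sin \<psi> * cosh t) = 1"
      using cosh_square_eq[of t] by (simp add: depth_def power2_eq_square algebra_simps)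
    also have "P * cos \<psi> * 1 / (depth t \<psi>)\<^sup>2 = a t"
      using P by (simp add: mom[OF that] z[OF that] power2_eq_square)
    finally show ?thesis .
  qed
  have "((\<lambda>t. x t - P * cos \<psi> * sinh t / depth t \<psi>) has_real_derivative 0) (at t within {0..})" if "t \<ge> 0" for t
    using DERIV_diff[OF dx[OF that] dq[OF that]] by simp
  from constant_on_halfline[of "\<lambda>t. x t - P * cos \<psi> * sinh t / depth t \<psi>", OF this t]
  show "c t 0 = c 0 0 + c 0 1 * cos \<psi> * sinh t / depth t \<psi>"
    by (simp add: depth_def) (simp add: defs P_def depth_def)
qed

text \<open>
  The sign \<open>\<sigma>\<close> is the orientation of the basis; both orientations occur among polar coordinates.
\<close>

lemma orthonormal_pair:
  fixes a b c d P :: real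
  assumes "P > 0" "a\<^sup>2 + b\<^sup>2 = P\<^sup>2" "c\<^sup>2 + d\<^sup>2 = P\<^sup>2" "a * c + b * d = 0"
  shows "\<exists>\<alpha> \<sigma>. \<sigma>\<^sup>2 = 1 \<and> (\<forall>\<theta>. cos \<theta> * a + sin \<theta> * c = P * cos (\<alpha> + \<sigma> * \<theta>)
      \<and> cos \<theta> * b + sin \<theta> * d = P * sin (\<alpha> + \<sigma> * \<theta>))"
proof -
  have "(a / P)\<^sup>2 + (b / P)\<^sup>2 = 1"
    using assms(1,2) by (simp add: power_divide flip: add_divide_distrib)
  then obtain \<alpha> where \<alpha>: "a / P = cos \<alpha>" "b / P = sin \<alpha>"
    using sincos_total_2pi by metis
  then have ab: "a = P * cos \<alpha>" "b = P * sin \<alpha>"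
    using assms(1) by (simp_all add: field_simps)
  define \<sigma> where "\<sigma> = (cos \<alpha> * d - sin \<alpha> * c) / P"
  have sc: "(sin \<alpha>)\<^sup>2 + (cos \<alpha>)\<^sup>2 = 1" by simp
  have "P * (cos \<alpha> * c + sin \<alpha> * d) = 0"
    using assms(4) by (simp add: ab algebra_simps)
  then have perp: "cos \<alpha> * c + sin \<alpha> * d = 0"
    using assms(1) by simp
  have \<sigma>P: "\<sigma> * P = cos \<alpha> * d - sin \<alpha> * c"
    using assms(1) by (simp add: \<sigma>_def)
  have cd: "c = - (\<sigma> * P * sin \<alpha>)" "d = \<sigma> * P * cos \<alpha>"
  proof -
    have "- (\<sigma> * P * sin \<alpha>) = c * ((sin \<alpha>)\<^sup>2 + (cos \<alpha>)\<^sup>2) - cos \<alpha> * (cos \<alpha> * c + sin \<alpha> * d)"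
      "\<sigma> * P * cos \<alpha> = d * ((sin \<alpha>)\<^sup>2 + (cos \<alpha>)\<^sup>2) - sin \<alpha> * (cos \<alpha> * c + sin \<alpha> * d)"
      unfolding \<sigma>P by (simp_all add: power2_eq_square algebra_simps del: sin_cos_squared_add sin_cos_squared_add2 sin_cos_squared_add3)
    then show "c = - (\<sigma> * P * sin \<alpha>)" "d = \<sigma> * P * cos \<alpha>"
      unfolding perp sc by simp_all
  qed
  have "(\<sigma> * P)\<^sup>2 + (cos \<alpha> * c + sin \<alpha> * d)\<^sup>2 = ((sin \<alpha>)\<^sup>2 + (cos \<alpha>)\<^sup>2) * (c\<^sup>2 + d\<^sup>2)"
    unfolding \<sigma>P
    by (simp add: power2_eq_square algebra_simps del: sin_cos_squared_add sin_cos_squared_add2 sin_cos_squared_add3)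
  then have "(\<sigma> * P)\<^sup>2 = P\<^sup>2"
    unfolding perp sc using assms(3) by simp
  then have "\<sigma>\<^sup>2 = 1"
    using assms(1) by (simp add: power_mult_distrib)
  then have "\<sigma> = 1 \<or> \<sigma> = -1"
    by (simp add: power2_eq_1_iff)
  then have rot: "cos \<theta> * a + sin \<theta> * c = P * cos (\<alpha> + \<sigma> * \<theta>)
      \<and> cos \<theta> * b + sin \<theta> * d = P * sin (\<alpha> + \<sigma> * \<theta>)" for \<theta>
    unfolding cd unfolding ab
    by (elim disjE) (simp_all add: cos_add sin_add cos_diff sin_diff algebra_simps)
  show ?thesis
    by (intro exI conjI allI) (rule \<open>\<sigma>\<^sup>2 = 1\<close> conjunct1[OF rot] conjunct2[OF rot])+
qed

lemma polar_coordinates_formula: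
  assumes polar: "geodesic_polar_coordinates p \<Phi>" and p: "p 1 > 0"
  obtains \<alpha> \<sigma> where "\<sigma>\<^sup>2 = 1"
    "\<And>\<rho> \<theta>. \<rho> \<ge> 0 \<Longrightarrow> \<Phi> \<rho> \<theta> 0 = p 0 + p 1 * cos (\<alpha> + \<sigma> * \<theta>) * sinh \<rho> / depth \<rho> (\<alpha> + \<sigma> * \<theta>)"
    "\<And>\<rho> \<theta>. \<rho> \<ge> 0 \<Longrightarrow> \<Phi> \<rho> \<theta> 1 = p 1 / depth \<rho> (\<alpha> + \<sigma> * \<theta>)"
proof -
  obtain e1 e2 where e: "inner_g 2 hyperbolic_metric p e1 e1 = 1"
     "inner_g 2 hyperbolic_metric p e2 e2 = 1"
     "inner_g 2 hyperbolic_metric p e1 e2 = 0"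
    and geo: "\<And>\<theta>. \<exists>V. geodesic 2 hyperbolic_metric {0..} (\<lambda>\<rho>. \<Phi> \<rho> \<theta>) V \<and>
        (\<forall>\<rho>\<ge>0. \<Phi> \<rho> \<theta> 1 > 0) \<and>
        (\<forall>k<2. \<Phi> 0 \<theta> k = p k \<and> V 0 k = cos \<theta> * e1 k + sin \<theta> * e2 k)"
    using polar unfolding geodesic_polar_coordinates_def by blast
  have "inner_g 2 hyperbolic_metric p v w = (v 0 * w 0 + v 1 * w 1) / (p 1)\<^sup>2" for v w
    by (simp add: inner_g_def sum_two hyperbolic_metric_def add_divide_distrib)
  note e = e[unfolded this]
  have "(e1 0)\<^sup>2 + (e1 1)\<^sup>2 = (p 1)\<^sup>2" "(e2 0)\<^sup>2 + (e2 1)\<^sup>2 = (p 1)\<^sup>2" "e1 0 * e2 0 + e1 1 * e2 1 = 0"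
    using e(1) e(2) e(3) p by (simp_all only: divide_eq_eq) (simp_all add: power2_eq_square)
  from orthonormal_pair[OF p this] obtain \<alpha> \<sigma> where \<sigma>: "\<sigma>\<^sup>2 = 1"
    and rot: "\<And>\<theta>. cos \<theta> * e1 0 + sin \<theta> * e2 0 = p 1 * cos (\<alpha> + \<sigma> * \<theta>)"
      "\<And>\<theta>. cos \<theta> * e1 1 + sin \<theta> * e2 1 = p 1 * sin (\<alpha> + \<sigma> * \<theta>)"
    by blast
  have "\<Phi> \<rho> \<theta> 0 = p 0 + p 1 * cos (\<alpha> + \<sigma> * \<theta>) * sinh \<rho> / depth \<rho> (\<alpha> + \<sigma> * \<theta>)"
    "\<Phi> \<rho> \<theta> 1 = p 1 / depth \<rho> (\<alpha> + \<sigma> * \<theta>)" if "\<rho> \<ge> 0" for \<rho> \<theta>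
  proof -
    obtain V where V: "geodesic 2 hyperbolic_metric {0..} (\<lambda>\<rho>. \<Phi> \<rho> \<theta>) V" "\<And>\<rho>. \<rho> \<ge> 0 \<Longrightarrow> \<Phi> \<rho> \<theta> 1 > 0"
      "\<And>k. k < 2 \<Longrightarrow> \<Phi> 0 \<theta> k = p k" "\<And>k. k < 2 \<Longrightarrow> V 0 k = cos \<theta> * e1 k + sin \<theta> * e2 k"
      using geo[of \<theta>] by blast
    have p01: "\<Phi> 0 \<theta> 0 = p 0" "\<Phi> 0 \<theta> 1 = p 1"
      using V(3) by auto
    have "V 0 0 = \<Phi> 0 \<theta> 1 * cos (\<alpha> + \<sigma> * \<theta>)" "V 0 1 = \<Phi> 0 \<theta> 1 * sin (\<alpha> + \<sigma> * \<theta>)"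
      unfolding p01 using V(4)[of 0] V(4)[of 1] rot[of \<theta>] by simp_all
    from hyperbolic_geodesic[OF V(1,2) this that]
    show "\<Phi> \<rho> \<theta> 0 = p 0 + p 1 * cos (\<alpha> + \<sigma> * \<theta>) * sinh \<rho> / depth \<rho> (\<alpha> + \<sigma> * \<theta>)"
      "\<Phi> \<rho> \<theta> 1 = p 1 / depth \<rho> (\<alpha> + \<sigma> * \<theta>)"
      unfolding p01 by simp_all
  qed
  then show thesis
    by (rule that[OF \<sigma>])
qed

section \<open>The boundary of a geodesic disc times a torus\<close>

lemma cosh_sinh_square: "(cosh \<rho>)\<^sup>2 = 1 + (sinh \<rho>)\<^sup>2" for \<rho> :: real
  using cosh_square_eq[of \<rho>] by simp

text \<open>
  The identity behind the fact that a hyperbolic circle is a Euclidean circle: it says that the vector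
  with the components \<open>cos \<psi>\<close> and \<open>cosh \<rho> sin \<psi> - sinh \<rho>\<close> has length \<open>depth \<rho> \<psi>\<close>.
\<close>

lemma depth_square: "(cos \<psi>)\<^sup>2 + (cosh \<rho> * sin \<psi> - sinh \<rho>)\<^sup>2 = (depth \<rho> \<psi>)\<^sup>2"
proof -
  have "(cos \<psi>)\<^sup>2 + (cosh \<rho> * sin \<psi> - sinh \<rho>)\<^sup>2 - (depth \<rho> \<psi>)\<^sup>2
      = (cos \<psi>)\<^sup>2 + ((cosh \<rho>)\<^sup>2 - (sinh \<rho>)\<^sup>2) * ((sin \<psi>)\<^sup>2 - 1)"
    by (simp add: depth_def power2_eq_square algebra_simps)
  also have "\<dots> = 0"
    by (simp add: cosh_sinh_square cos_squared_eq)
  finally show ?thesis by simp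
qed

text \<open>
  The orthonormal basis behind the polar coordinates is determined by the angle \<open>\<alpha>\<close> of its first vector
  and by its orientation \<open>\<sigma>\<close>.
\<close>

locale polar_chart =
  fixes p :: point and \<Phi> :: "real \<Rightarrow> real \<Rightarrow> point" and r \<alpha> \<sigma> :: real
  assumes r: "r > 0" and p: "p 1 > 0" and \<sigma>: "\<sigma>\<^sup>2 = 1"
    and \<Phi>0: "\<And>\<rho> \<theta>. \<rho> \<ge> 0 \<Longrightarrow> \<Phi> \<rho> \<theta> 0 = p 0 + p 1 * cos (\<alpha> + \<sigma> * \<theta>) * sinh \<rho> / depth \<rho> (\<alpha> + \<sigma> * \<theta>)"
    and \<Phi>1: "\<And>\<rho> \<theta>. \<rho> \<ge> 0 \<Longrightarrow> \<Phi> \<rho> \<theta> 1 = p 1 / depth \<rho> (\<alpha> + \<sigma> * \<theta>)"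
begin

abbreviation "P \<equiv> p 1"
abbreviation "\<psi> \<theta> \<equiv> \<alpha> + \<sigma> * \<theta>"
abbreviation "D \<theta> \<equiv> depth r (\<psi> \<theta>)"

lemma D_pos: "D \<theta> > 0"
  using r by (intro depth_pos) simp

text \<open>
  For the hyperbolic distance \<open>d\<close> of two points at Euclidean horizontal distance \<open>x\<close> and heights \<open>y, z\<close>,
  \<open>2 y z cosh d = x\<^sup>2 + y\<^sup>2 + z\<^sup>2\<close>. This is that equation along a geodesic from \<open>p\<close>.
\<close>

lemma geodesic_circle_equation:
  assumes "\<rho> \<ge> 0"
  shows "(\<Phi> \<rho> \<theta> 0 - p 0)\<^sup>2 + (\<Phi> \<rho> \<theta> 1)\<^sup>2 + P\<^sup>2 = 2 * P * \<Phi> \<rho> \<theta> 1 * cosh \<rho>"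
proof -
  define d where "d = depth \<rho> (\<psi> \<theta>)"
  have d: "d > 0" using depth_pos[OF assms] by (simp add: d_def)
  have "(cos (\<psi> \<theta>))\<^sup>2 * (sinh \<rho>)\<^sup>2 + 1 + d\<^sup>2 - 2 * cosh \<rho> * d
      = (cos (\<psi> \<theta>))\<^sup>2 * (sinh \<rho>)\<^sup>2 + 1 + (sin (\<psi> \<theta>))\<^sup>2 * (sinh \<rho>)\<^sup>2 - (cosh \<rho>)\<^sup>2"
    by (simp add: d_def depth_def power2_eq_square algebra_simps)
  also have "\<dots> = 0"
    by (simp add: cosh_sinh_square cos_squared_eq algebra_simps)
  finally have key: "(cos (\<psi> \<theta>))\<^sup>2 * (sinh \<rho>)\<^sup>2 + 1 + d\<^sup>2 = 2 * cosh \<rho> * d"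
    by simp
  have "(\<Phi> \<rho> \<theta> 0 - p 0)\<^sup>2 + (\<Phi> \<rho> \<theta> 1)\<^sup>2 + P\<^sup>2
     = P\<^sup>2 / d\<^sup>2 * ((cos (\<psi> \<theta>))\<^sup>2 * (sinh \<rho>)\<^sup>2 + 1 + d\<^sup>2)"
    using d unfolding \<Phi>0[OF assms] \<Phi>1[OF assms] d_def[symmetric]
    by (simp add: power_mult_distrib power_divide add_divide_distrib distrib_left)
  also have "\<dots> = 2 * P * \<Phi> \<rho> \<theta> 1 * cosh \<rho>"
    using d unfolding key \<Phi>1[OF assms] d_def[symmetric] by (simp add: power2_eq_square)
  finally show ?thesis .
qed

text \<open>
  By the equation of the geodesic circle, membership in the Euclidean disc means \<open>cosh \<rho> \<le> cosh r\<close>. For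
  the converse, the equation determines \<open>\<rho>\<close> from a given point as \<open>arcosh k\<close>, and the two quotients in
  \<open>split\<close> are then the components of \<open>sinh \<rho>\<close> times a unit vector, from which the angle is read off.
\<close>

lemma X_hyp_iff:
  "x \<in> X_hyp \<Phi> r \<longleftrightarrow> (x 0 - p 0)\<^sup>2 + (x 1 - P * cosh r)\<^sup>2 \<le> (P * sinh r)\<^sup>2"
proof
  have expand: "(X - p 0)\<^sup>2 + (Z - P * cosh r)\<^sup>2 = ((X - p 0)\<^sup>2 + Z\<^sup>2 + P\<^sup>2) - 2 * P * Z * cosh r + (P * sinh r)\<^sup>2" for X Z
    by (simp add: power2_diff power_mult_distrib cosh_sinh_square algebra_simps)
  {
    assume "x \<in> X_hyp \<Phi> r"
    then obtain \<rho> \<theta> where x: "x 0 = \<Phi> \<rho> \<theta> 0" "x 1 = \<Phi> \<rho> \<theta> 1" and \<rho>: "0 \<le> \<rho>" "\<rho> \<le> r"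
      unfolding X_hyp_def geodesic_disc_def by auto
    have "cosh \<rho> \<le> cosh r" using \<rho> by (simp add: cosh_real_nonneg_le_iff)
    moreover have "2 * P * \<Phi> \<rho> \<theta> 1 > 0"
      unfolding \<Phi>1[OF \<rho>(1)] using p depth_pos[OF \<rho>(1)] by simp
    ultimately have "2 * P * \<Phi> \<rho> \<theta> 1 * cosh \<rho> \<le> 2 * P * \<Phi> \<rho> \<theta> 1 * cosh r"
      by (intro mult_left_mono) auto
    then show "(x 0 - p 0)\<^sup>2 + (x 1 - P * cosh r)\<^sup>2 \<le> (P * sinh r)\<^sup>2"
      unfolding expand x geodesic_circle_equation[OF \<rho>(1)] by linarith
  }
  assume in_disc: "(x 0 - p 0)\<^sup>2 + (x 1 - P * cosh r)\<^sup>2 \<le> (P * sinh r)\<^sup>2"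
  define X Z where "X = x 0 - p 0" and "Z = x 1"
  have "(Z - P * cosh r)\<^sup>2 \<le> (P * sinh r)\<^sup>2"
    using in_disc unfolding Z_def by (smt (verit) zero_le_power2)
  then have "\<bar>Z - P * cosh r\<bar> \<le> P * sinh r"
    using p r by (simp add: abs_le_square_iff[symmetric])
  moreover have "P * sinh r < P * cosh r"
    using p by (simp add: sinh_less_cosh_real)
  ultimately have Z: "Z > 0" by linarith
  define k where "k = (X\<^sup>2 + Z\<^sup>2 + P\<^sup>2) / (2 * P * Z)"
  have PZ: "2 * P * Z > 0" using p Z by simp
  have kPZ: "k * (2 * P * Z) = X\<^sup>2 + Z\<^sup>2 + P\<^sup>2"
  proof -
    have "2 * P * Z \<noteq> 0" using PZ by linarith
    then show ?thesis
      unfolding k_def times_divide_eq_left by (rule nonzero_mult_div_cancel_right)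
  qed
  have "k * (2 * P * Z) \<le> cosh r * (2 * P * Z)"
    using in_disc unfolding kPZ expand by (simp add: X_def Z_def algebra_simps)
  then have k_le: "k \<le> cosh r"
    using PZ by (simp only: mult_le_cancel_right)
  have "1 * (2 * P * Z) \<le> k * (2 * P * Z)"
    unfolding kPZ using sum_squares_bound[of P Z] zero_le_power2[of X] by linarith
  then have k_ge: "1 \<le> k"
    using PZ by (simp only: mult_le_cancel_right)
  define \<rho> where "\<rho> = arcosh k"
  have \<rho>: "cosh \<rho> = k" "\<rho> \<ge> 0"
    using k_ge by (simp_all add: \<rho>_def)
  have \<rho>r: "\<rho> \<le> r"
    using k_le r \<rho> cosh_real_nonneg_le_iff[of \<rho> r] by simp
  have sinh2: "(sinh \<rho>)\<^sup>2 = k\<^sup>2 - 1"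
    using cosh_sinh_square[of \<rho>] \<rho> by simp
  have split: "(X / Z)\<^sup>2 + (k - P / Z)\<^sup>2 = (sinh \<rho>)\<^sup>2"
  proof -
    have "Z\<^sup>2 * ((X / Z)\<^sup>2 + (k - P / Z)\<^sup>2) = X\<^sup>2 + (k * Z - P)\<^sup>2"
      using Z by (simp add: power2_eq_square field_simps)
    also have "\<dots> = X\<^sup>2 + P\<^sup>2 + Z\<^sup>2 * k\<^sup>2 - k * (2 * P * Z)"
      by (simp add: power2_eq_square algebra_simps)
    also have "\<dots> = Z\<^sup>2 * (k\<^sup>2 - 1)"
      unfolding kPZ by (simp add: algebra_simps)
    finally show ?thesis using Z by (simp add: sinh2)
  qed
  have "\<exists>\<phi>. X / Z = sinh \<rho> * cos \<phi> \<and> k - P / Z = sinh \<rho> * sin \<phi>"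
  proof (cases "sinh \<rho> = 0")
    case True
    then show ?thesis using split by (simp add: sum_power2_eq_zero_iff)
  next
    case False
    have "(X / Z / sinh \<rho>)\<^sup>2 + ((k - P / Z) / sinh \<rho>)\<^sup>2 = 1"
    proof -
      have "(X / Z / sinh \<rho>)\<^sup>2 + ((k - P / Z) / sinh \<rho>)\<^sup>2 = ((X / Z)\<^sup>2 + (k - P / Z)\<^sup>2) / (sinh \<rho>)\<^sup>2"
        by (simp only: power_divide add_divide_distrib)
      then show ?thesis unfolding split using False by simp
    qed
    then obtain \<phi> where "X / Z / sinh \<rho> = cos \<phi>" "(k - P / Z) / sinh \<rho> = sin \<phi>"
      using sincos_total_2pi by metis
    then show ?thesis
      using False by (intro exI[of _ \<phi>]) (simp add: divide_eq_eq mult.commute)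
  qed
  then obtain \<phi> where \<phi>: "X / Z = sinh \<rho> * cos \<phi>" "k - P / Z = sinh \<rho> * sin \<phi>" by blast
  define \<theta> where "\<theta> = \<sigma> * (\<phi> - \<alpha>)"
  have "\<psi> \<theta> = \<alpha> + \<sigma>\<^sup>2 * (\<phi> - \<alpha>)"
    by (simp add: \<theta>_def power2_eq_square)
  then have \<psi>: "\<psi> \<theta> = \<phi>" unfolding \<sigma> by simp
  have d: "depth \<rho> \<phi> = P / Z"
    unfolding depth_def using \<phi>(2) \<rho>(1) by (simp add: mult.commute)
  have "\<Phi> \<rho> \<theta> 1 = Z"
    unfolding \<Phi>1[OF \<rho>(2)] \<psi> d using p by simp
  moreover have "\<Phi> \<rho> \<theta> 0 = p 0 + X"
  proof -
    have "P * cos \<phi> * sinh \<rho> / (P / Z) = Z * (sinh \<rho> * cos \<phi>)"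
      using p by simp
    then show ?thesis
      unfolding \<Phi>0[OF \<rho>(2)] \<psi> d \<phi>(1)[symmetric] using Z by simp
  qed
  ultimately have "(x 0, x 1) = (\<Phi> \<rho> \<theta> 0, \<Phi> \<rho> \<theta> 1)"
    by (simp add: X_def Z_def)
  then show "x \<in> X_hyp \<Phi> r"
    unfolding X_hyp_def geodesic_disc_def using \<rho>(2) \<rho>r by blast
qed

text \<open>
  The components of the Euclidean outward unit normal of the circle bounding the disc.
\<close>

definition \<nu>0 :: "real \<Rightarrow> real" where "\<nu>0 \<theta> = cos (\<psi> \<theta>) / D \<theta>"
definition \<nu>1 :: "real \<Rightarrow> real" where "\<nu>1 \<theta> = (cosh r * sin (\<psi> \<theta>) - sinh r) / D \<theta>"

lemma \<nu>_unit: "(\<nu>0 \<theta>)\<^sup>2 + (\<nu>1 \<theta>)\<^sup>2 = 1"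
  using D_pos[of \<theta>] depth_square[of "\<psi> \<theta>" r]
  by (simp add: \<nu>0_def \<nu>1_def power_divide flip: add_divide_distrib)

lemma circle_point: "\<Phi> r \<theta> 0 - p 0 = P * sinh r * \<nu>0 \<theta>" "\<Phi> r \<theta> 1 - P * cosh r = P * sinh r * \<nu>1 \<theta>"
proof -
  show "\<Phi> r \<theta> 0 - p 0 = P * sinh r * \<nu>0 \<theta>"
    using r by (simp add: \<Phi>0 \<nu>0_def)
  have "P - P * cosh r * D \<theta> - P * sinh r * (cosh r * sin (\<psi> \<theta>) - sinh r) = P * (1 + (sinh r)\<^sup>2 - (cosh r)\<^sup>2)"
    by (simp add: depth_def power2_eq_square algebra_simps)
  then have "P - P * cosh r * D \<theta> = P * sinh r * (cosh r * sin (\<psi> \<theta>) - sinh r)"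
    unfolding cosh_sinh_square by simp
  moreover have "P / D \<theta> - P * cosh r = (P - P * cosh r * D \<theta>) / D \<theta>"
    using D_pos[of \<theta>] by (simp add: diff_divide_distrib)
  ultimately show "\<Phi> r \<theta> 1 - P * cosh r = P * sinh r * \<nu>1 \<theta>"
    unfolding \<Phi>1[OF less_imp_le[OF r]] \<nu>1_def by simp
qed

definition hyp_normal :: "point \<Rightarrow> point" where
  "hyp_normal q = (\<lambda>i. if i = 0 then \<Phi> r (q 0) 1 * \<nu>0 (q 0) else if i = 1 then \<Phi> r (q 0) 1 * \<nu>1 (q 0) else 0)"

lemma height_pos: "\<Phi> r \<theta> 1 > 0"
  using \<Phi>1[of r \<theta>] r p D_pos[of \<theta>] by simp

lemma X_hyp_normal_line:
  "(\<lambda>i. Y_hyp \<Phi> r q i + s * hyp_normal q i) \<in> X_hyp \<Phi> r \<longleftrightarrow> \<bar>P * sinh r + s * \<Phi> r (q 0) 1\<bar> \<le> P * sinh r"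
proof -
  define R Z a b where "R = P * sinh r" and "Z = \<Phi> r (q 0) 1" and "a = \<nu>0 (q 0)" and "b = \<nu>1 (q 0)"
  have ab: "a\<^sup>2 + b\<^sup>2 = 1" using \<nu>_unit by (simp add: a_def b_def)
  have "Y_hyp \<Phi> r q 0 + s * hyp_normal q 0 - p 0 = (R + s * Z) * a"
    using circle_point(1)[of "q 0"] by (simp add: Y_hyp_def hyp_normal_def R_def Z_def a_def algebra_simps)
  moreover have "Y_hyp \<Phi> r q 1 + s * hyp_normal q 1 - P * cosh r = (R + s * Z) * b"
    using circle_point(2)[of "q 0"] by (simp add: Y_hyp_def hyp_normal_def R_def Z_def b_def algebra_simps)
  ultimately have "(\<lambda>i. Y_hyp \<Phi> r q i + s * hyp_normal q i) \<in> X_hyp \<Phi> r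
      \<longleftrightarrow> (R + s * Z)\<^sup>2 * (a\<^sup>2 + b\<^sup>2) \<le> R\<^sup>2"
    unfolding X_hyp_iff R_def[symmetric] by (simp only: power_mult_distrib distrib_left)
  also have "\<dots> \<longleftrightarrow> \<bar>R + s * Z\<bar> \<le> R"
    unfolding ab using p r by (simp add: R_def flip: abs_le_square_iff)
  finally show ?thesis by (simp only: R_def Z_def)
qed

definition dx :: "real \<Rightarrow> real" where
  "dx \<theta> = \<sigma> * P * sinh r * (sinh r - cosh r * sin (\<psi> \<theta>)) / (D \<theta>)\<^sup>2"
definition dz :: "real \<Rightarrow> real" where
  "dz \<theta> = \<sigma> * P * sinh r * cos (\<psi> \<theta>) / (D \<theta>)\<^sup>2"
definition ddx :: "real \<Rightarrow> real" where
  "ddx \<theta> = P * sinh r * (2 * sinh r * cos (\<psi> \<theta>) * (sinh r - cosh r * sin (\<psi> \<theta>)) - cosh r * cos (\<psi> \<theta>) * D \<theta>) / (D \<theta>) ^ 3"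
definition ddz :: "real \<Rightarrow> real" where
  "ddz \<theta> = P * sinh r * (2 * sinh r * (cos (\<psi> \<theta>))\<^sup>2 - sin (\<psi> \<theta>) * D \<theta>) / (D \<theta>) ^ 3"

lemma D_deriv: "((\<lambda>\<theta>. D \<theta>) has_real_derivative - (\<sigma> * sinh r * cos (\<psi> \<theta>))) (at \<theta>)"
  unfolding depth_def by (auto intro!: derivative_eq_intros)

lemma circle_deriv:
  "((\<lambda>\<theta>. \<Phi> r \<theta> 0) has_real_derivative dx \<theta>) (at \<theta>)"
  "((\<lambda>\<theta>. \<Phi> r \<theta> 1) has_real_derivative dz \<theta>) (at \<theta>)"
  "(dx has_real_derivative ddx \<theta>) (at \<theta>)"
  "(dz has_real_derivative ddz \<theta>) (at \<theta>)"
proof -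
  note D_nz = D_pos[of \<theta>, THEN less_imp_neq, symmetric]
  define c s C S d where "c = cos (\<psi> \<theta>)" and "s = sin (\<psi> \<theta>)" and "C = cosh r" and "S = sinh r" and "d = D \<theta>"
  note abbr = this
  have d: "d \<noteq> 0" "d = C - s * S" using D_nz by (simp_all add: abbr depth_def)
  have cs: "c * c = 1 - s * s" using cos_squared_eq[of "\<psi> \<theta>"] by (simp only: abbr power2_eq_square)
  have \<sigma>\<sigma>: "\<sigma> * \<sigma> = 1" using \<sigma> by (simp add: power2_eq_square)
  have "((\<lambda>\<theta>. p 0 + P * cos (\<psi> \<theta>) * S / D \<theta>) has_real_derivative
      (- (P * \<sigma> * s * S) * d + P * c * S * (\<sigma> * S * c)) / (d * d)) (at \<theta>)"
    using D_nz by (auto intro!: derivative_eq_intros D_deriv simp: abbr)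
  also have "- (P * \<sigma> * s * S) * d + P * c * S * (\<sigma> * S * c) = \<sigma> * P * S * (S * (c * c) - s * d)"
    by (simp add: algebra_simps)
  also have "S * (c * c) - s * d = S - C * s"
    unfolding cs d(2) by (simp add: algebra_simps)
  finally show "((\<lambda>\<theta>. \<Phi> r \<theta> 0) has_real_derivative dx \<theta>) (at \<theta>)"
    unfolding \<Phi>0[OF less_imp_le[OF r]] dx_def by (simp add: abbr power2_eq_square)
  have "((\<lambda>\<theta>. P / D \<theta>) has_real_derivative P * (\<sigma> * S * c) / (d * d)) (at \<theta>)"
    using D_nz by (auto intro!: derivative_eq_intros D_deriv simp: abbr)
  then show "((\<lambda>\<theta>. \<Phi> r \<theta> 1) has_real_derivative dz \<theta>) (at \<theta>)"
    unfolding \<Phi>1[OF less_imp_le[OF r]] dz_def by (simp add: abbr power2_eq_square mult_ac)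
  have "(dx has_real_derivative
     (\<sigma> * P * S * (- (C * (\<sigma> * c))) * d\<^sup>2 - \<sigma> * P * S * (S - C * s) * (2 * d * (- (\<sigma> * S * c)))) / (d\<^sup>2 * d\<^sup>2)) (at \<theta>)"
    unfolding dx_def[abs_def] using D_nz by (auto intro!: derivative_eq_intros D_deriv simp: abbr)
  also have "(\<sigma> * P * S * (- (C * (\<sigma> * c))) * d\<^sup>2 - \<sigma> * P * S * (S - C * s) * (2 * d * (- (\<sigma> * S * c)))) / (d\<^sup>2 * d\<^sup>2)
     = (\<sigma> * \<sigma>) * P * S * (2 * S * c * (S - C * s) - C * c * d) / d ^ 3"
    using d(1) by (simp add: divide_simps power2_eq_square power3_eq_cube) (simp add: algebra_simps)
  finally show "(dx has_real_derivative ddx \<theta>) (at \<theta>)"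
    unfolding \<sigma>\<sigma> ddx_def by (simp add: abbr)
  have "(dz has_real_derivative
     (\<sigma> * P * S * (- (\<sigma> * s)) * d\<^sup>2 - \<sigma> * P * S * c * (2 * d * (- (\<sigma> * S * c)))) / (d\<^sup>2 * d\<^sup>2)) (at \<theta>)"
    unfolding dz_def[abs_def] using D_nz by (auto intro!: derivative_eq_intros D_deriv simp: abbr)
  also have "(\<sigma> * P * S * (- (\<sigma> * s)) * d\<^sup>2 - \<sigma> * P * S * c * (2 * d * (- (\<sigma> * S * c)))) / (d\<^sup>2 * d\<^sup>2)
     = (\<sigma> * \<sigma>) * P * S * (2 * S * c\<^sup>2 - s * d) / d ^ 3"
    using d(1) by (simp add: divide_simps power2_eq_square power3_eq_cube) (simp add: algebra_simps)
  finally show "(dz has_real_derivative ddz \<theta>) (at \<theta>)"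
    unfolding \<sigma>\<sigma> ddz_def by (simp add: abbr)
qed

text \<open>
  The velocity of the circle is, up to orientation, \<open>sinh r\<close> times the height times the rotated
  normal, so that the circle has constant hyperbolic speed \<open>sinh r\<close>.
\<close>

lemma tangent_normal:
  "dx \<theta> = - (\<sigma> * sinh r * \<Phi> r \<theta> 1 * \<nu>1 \<theta>)" "dz \<theta> = \<sigma> * sinh r * \<Phi> r \<theta> 1 * \<nu>0 \<theta>"
  unfolding dx_def dz_def \<Phi>1[OF less_imp_le[OF r]] \<nu>0_def \<nu>1_def
  by (simp_all add: power2_eq_square algebra_simps diff_divide_distrib)

lemma partial_Y_hyp:
  "partial a (\<lambda>s. Y_hyp \<Phi> r s i) = (\<lambda>q.
     if a = 0 then (if i = 0 then dx (q 0) else if i = 1 then dz (q 0) else 0)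
     else if i = Suc a then 1 else 0)"
proof
  fix q
  show "partial a (\<lambda>s. Y_hyp \<Phi> r s i) q =
     (if a = 0 then (if i = 0 then dx (q 0) else if i = 1 then dz (q 0) else 0)
     else if i = Suc a then 1 else 0)"
  proof (rule has_partial_imp)
    consider "i = 0" | "i = 1" | k where "i = Suc (Suc k)"
      by (metis One_nat_def not0_implies_Suc)
    then show "has_partial a (\<lambda>s. Y_hyp \<Phi> r s i)
     (if a = 0 then (if i = 0 then dx (q 0) else if i = 1 then dz (q 0) else 0)
     else if i = Suc a then 1 else 0) q"
      unfolding has_partial_def Y_hyp_def
      using circle_deriv(1,2)[of "q 0"] by cases (auto simp: fun_upd_def)
  qed
qed

lemma partial_partial_Y_hyp:
  "partial a (partial a (\<lambda>s. Y_hyp \<Phi> r s i)) q =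
     (if a = 0 then if i = 0 then ddx (q 0) else if i = 1 then ddz (q 0) else 0 else 0)"
proof (rule has_partial_imp)
  show "has_partial a (partial a (\<lambda>s. Y_hyp \<Phi> r s i))
     (if a = 0 then if i = 0 then ddx (q 0) else if i = 1 then ddz (q 0) else 0 else 0) q"
    unfolding partial_Y_hyp has_partial_def
    using circle_deriv(3,4)[of "q 0"] by (cases "a = 0"; cases "i = 0"; cases "i = 1") auto
qed

lemma Y_hyp_values: "Y_hyp \<Phi> r q 0 = \<Phi> r (q 0) 0" "Y_hyp \<Phi> r q 1 = \<Phi> r (q 0) 1"
  by (simp_all add: Y_hyp_def)

lemma inner_hyperbolic:
  assumes "n \<ge> 2"
  shows "inner_g n hyperbolic_metric x V W
    = (V 0 * W 0 + V 1 * W 1 + (\<Sum>i<n - 2. V (i + 2) * W (i + 2))) / (x 1)\<^sup>2"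
proof -
  define m where "m = n - 2"
  have n: "n = Suc (Suc m)" using assms by (simp add: m_def)
  have "inner_g n hyperbolic_metric x V W = (\<Sum>i<n. V i * W i / (x 1)\<^sup>2)"
    unfolding inner_g_def hyperbolic_metric_def
    by (intro sum.cong refl) (simp add: if_distrib[of "\<lambda>t. t * _"] cong: if_cong)
  then show ?thesis
    unfolding m_def[symmetric] unfolding n
    by (simp add: sum.lessThan_Suc_shift sum_divide_distrib add_divide_distrib numeral_2_eq_2 del: sum.lessThan_Suc)
qed

lemma induced_Y_hyp:
  assumes n: "n \<ge> 3" and "a < n - 1" "b < n - 1"
  shows "induced_metric n hyperbolic_metric (Y_hyp \<Phi> r) q a b =
    (if a = b then if a = 0 then (sinh r)\<^sup>2 else (1 / \<Phi> r (q 0) 1)\<^sup>2 else 0)"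
proof -
  have n2: "n \<ge> 2" using n by simp
  define Z where "Z = \<Phi> r (q 0) 1"
  have Z: "Z > 0" using height_pos by (simp add: Z_def)
  have A: "\<exists>a'. a = 0 \<or> (a = Suc a' \<and> a' < n - 2)"
    using assms(2) by (cases a) auto
  have B: "\<exists>b'. b = 0 \<or> (b = Suc b' \<and> b' < n - 2)"
    using assms(3) by (cases b) auto
  have speed: "(dx (q 0) * dx (q 0) + dz (q 0) * dz (q 0)) / Z\<^sup>2 = (sinh r)\<^sup>2"
  proof -
    have "dx (q 0) * dx (q 0) + dz (q 0) * dz (q 0)
        = \<sigma>\<^sup>2 * (sinh r)\<^sup>2 * Z\<^sup>2 * ((\<nu>0 (q 0))\<^sup>2 + (\<nu>1 (q 0))\<^sup>2)"
      unfolding tangent_normal Z_def[symmetric] by (simp add: power2_eq_square algebra_simps)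
    then show ?thesis
      unfolding \<sigma> \<nu>_unit using Z by simp
  qed
  have delta: "(\<Sum>i<n - 2. (if i = k then 1 else 0) * (if i = l then 1 else 0)) = (if k = l then 1 else (0::real))"
    if "k < n - 2" for k l
    using that by (simp add: if_distrib[of "\<lambda>t. t * _"] cong: if_cong)
  show ?thesis
    using A B speed unfolding induced_metric_def inner_hyperbolic[OF n2] partial_Y_hyp Y_hyp_values Z_def[symmetric]
    by (elim exE disjE conjE) (simp_all add: delta power_divide)
qed

lemma inner_hyp_normal:
  assumes "n \<ge> 2"
  shows "inner_g n hyperbolic_metric (Y_hyp \<Phi> r q) V (hyp_normal q)
     = (V 0 * \<nu>0 (q 0) + V 1 * \<nu>1 (q 0)) / \<Phi> r (q 0) 1"
proof -
  define Z where "Z = \<Phi> r (q 0) 1"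
  have Z: "Z > 0" using height_pos by (simp add: Z_def)
  have "inner_g n hyperbolic_metric (Y_hyp \<Phi> r q) V (hyp_normal q)
     = (V 0 * (Z * \<nu>0 (q 0)) + V 1 * (Z * \<nu>1 (q 0))) / Z\<^sup>2"
    unfolding inner_hyperbolic[OF assms] Y_hyp_values Z_def[symmetric]
    by (simp add: hyp_normal_def Z_def)
  also have "\<dots> = Z * (V 0 * \<nu>0 (q 0) + V 1 * \<nu>1 (q 0)) / (Z * Z)"
    by (simp add: power2_eq_square algebra_simps)
  finally show ?thesis
    using Z by (simp add: Z_def)
qed

lemma inner_g_hyperbolic_commute: "inner_g n hyperbolic_metric x V W = inner_g n hyperbolic_metric x W V"
  unfolding inner_g_def by (subst sum.swap) (auto simp: hyperbolic_metric_def mult_ac intro!: sum.cong)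

lemma hyp_normal_outward:
  assumes n: "n \<ge> 3"
  shows "outward_unit_normal n hyperbolic_metric (X_hyp \<Phi> r) (Y_hyp \<Phi> r) q (hyp_normal q)"
  unfolding outward_unit_normal_def
proof (intro conjI allI impI)
  have n2: "n \<ge> 2" using n by simp
  define Z where "Z = \<Phi> r (q 0) 1"
  have Z: "Z > 0" using height_pos by (simp add: Z_def)
  have PS: "P * sinh r > 0" using p r by simp
  show "hyp_normal q i = 0" if "n \<le> i" for i
    using that n by (simp add: hyp_normal_def)
  show "inner_g n hyperbolic_metric (Y_hyp \<Phi> r q) (hyp_normal q) (\<lambda>i. partial a (\<lambda>s. Y_hyp \<Phi> r s i) q) = 0" for a
    by (subst inner_g_hyperbolic_commute)
      (simp add: inner_hyp_normal[OF n2] partial_Y_hyp tangent_normal[simplified])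
  show "inner_g n hyperbolic_metric (Y_hyp \<Phi> r q) (hyp_normal q) (hyp_normal q) = 1"
  proof -
    have "Z * \<nu>0 (q 0) * \<nu>0 (q 0) + Z * \<nu>1 (q 0) * \<nu>1 (q 0) = Z * ((\<nu>0 (q 0))\<^sup>2 + (\<nu>1 (q 0))\<^sup>2)"
      by (simp add: power2_eq_square algebra_simps)
    then show ?thesis
      unfolding inner_hyp_normal[OF n2] Z_def[symmetric] \<nu>_unit using Z by (simp add: hyp_normal_def Z_def)
  qed
  show "\<exists>\<epsilon>>0. \<forall>t. 0 < t \<and> t < \<epsilon> \<longrightarrow> (\<lambda>i. Y_hyp \<Phi> r q i - t * hyp_normal q i) \<in> X_hyp \<Phi> r
      \<and> (\<lambda>i. Y_hyp \<Phi> r q i + t * hyp_normal q i) \<notin> X_hyp \<Phi> r"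
  proof (intro exI[of _ "P * sinh r / Z"] conjI allI impI)
    show "P * sinh r / Z > 0" using Z PS by simp
    fix t assume t: "0 < t \<and> t < P * sinh r / Z"
    then have tZ: "0 < t * Z" "t * Z < P * sinh r"
      using Z by (auto simp: pos_less_divide_eq)
    have line: "(\<lambda>i. Y_hyp \<Phi> r q i + s * hyp_normal q i) \<in> X_hyp \<Phi> r \<longleftrightarrow> \<bar>P * sinh r + s * Z\<bar> \<le> P * sinh r" for s
      unfolding Z_def by (rule X_hyp_normal_line)
    have "\<bar>P * sinh r + (- t) * Z\<bar> \<le> P * sinh r"
      using tZ by linarith
    with line[of "- t"] show "(\<lambda>i. Y_hyp \<Phi> r q i - t * hyp_normal q i) \<in> X_hyp \<Phi> r"
      by simp
    show "(\<lambda>i. Y_hyp \<Phi> r q i + t * hyp_normal q i) \<notin> X_hyp \<Phi> r"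
      unfolding line using tZ by linarith
  qed
qed

text \<open>
  As for the comparison manifold: orthogonality leaves the direction of \<open>\<nu>\<close>, unit length a sign, and the
  position of the disc decides it.
\<close>

lemma hyp_normal_unique:
  assumes n: "n \<ge> 3" and N: "outward_unit_normal n hyperbolic_metric (X_hyp \<Phi> r) (Y_hyp \<Phi> r) q N"
  shows "N = hyp_normal q"
proof -
  have n2: "n \<ge> 2" using n by simp
  define Z a b where "Z = \<Phi> r (q 0) 1" and "a = \<nu>0 (q 0)" and "b = \<nu>1 (q 0)"
  have Z: "Z > 0" using height_pos by (simp add: Z_def)
  have ab: "a\<^sup>2 + b\<^sup>2 = 1" using \<nu>_unit by (simp add: a_def b_def)
  have S: "sinh r > 0" and \<sigma>0: "\<sigma> \<noteq> 0" using r \<sigma> by auto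
  have tangent: "inner_g n hyperbolic_metric (Y_hyp \<Phi> r q) N (\<lambda>i. partial a (\<lambda>s. Y_hyp \<Phi> r s i) q) = 0" if "a < n - 1" for a
    using N that by (simp add: outward_unit_normal_def)
  have unit: "inner_g n hyperbolic_metric (Y_hyp \<Phi> r q) N N = 1"
    using N by (simp add: outward_unit_normal_def)
  have N2: "N i = 0" if "i \<ge> 2" for i
  proof (cases "i < n")
    case True
    define k where "k = i - 2"
    have k: "i = Suc (Suc k)" "k < n - 2" using that True by (auto simp: k_def)
    have "(\<Sum>j<n - 2. N (Suc (Suc j)) * (if j = k then 1 else 0)) = N i"
      using k by (simp add: if_distrib[of "\<lambda>t. _ * t"] cong: if_cong)
    moreover have "Suc k < n - 1" using k(2) by linarith
    ultimately show ?thesis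
      using tangent[of "Suc k"] k(1) Z unfolding partial_Y_hyp inner_hyperbolic[OF n2] Y_hyp_values Z_def[symmetric]
      by (simp add: numeral_2_eq_2)
  qed (use N in \<open>simp add: outward_unit_normal_def\<close>)
  have "(N 0 * (- (\<sigma> * sinh r * Z * b)) + N 1 * (\<sigma> * sinh r * Z * a)) / Z\<^sup>2 = 0"
    using tangent[of 0] n unfolding partial_Y_hyp inner_hyperbolic[OF n2] Y_hyp_values tangent_normal Z_def[symmetric] a_def[symmetric] b_def[symmetric]
    by simp
  then have "\<sigma> * sinh r * Z * (N 1 * a - N 0 * b) = 0"
    using Z by (simp add: algebra_simps)
  then have perp: "N 1 * a - N 0 * b = 0"
    using \<sigma>0 S Z by simp
  define l where "l = N 0 * a + N 1 * b"
  have "l * a = N 0 * (a\<^sup>2 + b\<^sup>2) + b * (N 1 * a - N 0 * b)"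
    "l * b = N 1 * (a\<^sup>2 + b\<^sup>2) - a * (N 1 * a - N 0 * b)"
    unfolding l_def by (simp_all add: power2_eq_square algebra_simps)
  then have N01: "N 0 = l * a" "N 1 = l * b"
    unfolding perp ab by simp_all
  have N_eq: "N = (\<lambda>i. l / Z * hyp_normal q i)"
  proof
    fix i :: nat
    consider "i = 0" | "i = 1" | "i \<ge> 2" by linarith
    then show "N i = l / Z * hyp_normal q i"
    proof cases
      case 1
      then show ?thesis using N01 Z by (simp add: hyp_normal_def a_def Z_def)
    next
      case 2
      then show ?thesis using N01 Z by (simp add: hyp_normal_def b_def Z_def)
    next
      case 3
      then show ?thesis using N2 by (simp add: hyp_normal_def)
    qed
  qed
  have "inner_g n hyperbolic_metric (Y_hyp \<Phi> r q) N N = l / Z * inner_g n hyperbolic_metric (Y_hyp \<Phi> r q) N (hyp_normal q)"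
    by (subst (2) N_eq) (simp add: inner_g_def sum_distrib_left mult_ac)
  also have "inner_g n hyperbolic_metric (Y_hyp \<Phi> r q) N (hyp_normal q) = l / Z"
    unfolding inner_hyp_normal[OF n2] by (simp only: l_def a_def b_def Z_def)
  finally have "l / Z * (l / Z) = 1"
    unfolding unit by (rule sym)
  then have "(l / Z)\<^sup>2 = 1"
    by (simp only: power2_eq_square)
  moreover have "l / Z \<noteq> - 1"
  proof
    assume neg: "l / Z = - 1"
    obtain \<epsilon> where "\<epsilon> > 0" and \<epsilon>: "\<And>t. 0 < t \<and> t < \<epsilon> \<Longrightarrow> (\<lambda>i. Y_hyp \<Phi> r q i - t * N i) \<in> X_hyp \<Phi> r"
      using N unfolding outward_unit_normal_def by blast
    have "(\<lambda>i. Y_hyp \<Phi> r q i - \<epsilon> / 2 * N i) \<in> X_hyp \<Phi> r"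
      using \<epsilon>[of "\<epsilon> / 2"] \<open>\<epsilon> > 0\<close> by simp
    moreover have "(\<lambda>i. Y_hyp \<Phi> r q i - \<epsilon> / 2 * N i) = (\<lambda>i. Y_hyp \<Phi> r q i + \<epsilon> / 2 * hyp_normal q i)"
      by (subst N_eq) (simp add: neg)
    ultimately have "\<bar>P * sinh r + \<epsilon> / 2 * Z\<bar> \<le> P * sinh r"
      using X_hyp_normal_line[of q "\<epsilon> / 2"] by (simp add: Z_def)
    moreover have "\<epsilon> / 2 * Z > 0" using \<open>\<epsilon> > 0\<close> Z by simp
    ultimately show False by linarith
  qed
  ultimately have "l / Z = 1"
    by (simp add: power2_eq_1_iff)
  then show ?thesis
    using N_eq by simp
qed

text \<open>
  Along the circle this is the geodesic curvature \<open>coth r\<close> times the squared speed \<open>sinh\<^sup>2 r\<close>. In a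
  torus direction the acceleration is the vertical vector \<open>1 / z\<close>, whose component along the normal is
  \<open>\<nu>1\<close> up to scale.
\<close>

lemma second_fundamental_form_hyp:
  assumes n: "n \<ge> 3" and a: "a < n - 1"
  shows "second_fundamental_form n hyperbolic_metric (Y_hyp \<Phi> r) q (hyp_normal q) a a
    = (if a = 0 then sinh r * cosh r else - \<nu>1 (q 0) / (\<Phi> r (q 0) 1)\<^sup>2)"
proof -
  have n2: "n \<ge> 2" using n by simp
  define Z where "Z = \<Phi> r (q 0) 1"
  have Z: "Z > 0" using height_pos by (simp add: Z_def)
  have Z1: "\<Phi> r (q 0) (Suc 0) = Z" by (simp add: Z_def)
  define V where "V k = partial a (partial a (\<lambda>s. Y_hyp \<Phi> r s k)) q
     + (\<Sum>i<n. \<Sum>j<n. christoffel n hyperbolic_metric k i j (Y_hyp \<Phi> r q)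
          * partial a (\<lambda>s. Y_hyp \<Phi> r s i) q * partial a (\<lambda>s. Y_hyp \<Phi> r s j) q)" for k
  have sff: "second_fundamental_form n hyperbolic_metric (Y_hyp \<Phi> r) q (hyp_normal q) a a
     = - ((V 0 * \<nu>0 (q 0) + V 1 * \<nu>1 (q 0)) / Z)"
    unfolding second_fundamental_form_def V_def inner_hyp_normal[OF n2] Z_def by simp
  have Y1: "Y_hyp \<Phi> r q 1 = Z" "Y_hyp \<Phi> r q 1 \<noteq> 0"
    using Z by (simp_all only: Y_hyp_values Z_def[symmetric])
  note \<Gamma> = christoffel_hyperbolic[where y = "Y_hyp \<Phi> r q" and n = n, OF Y1(2), unfolded Y1(1)]
  show ?thesis
  proof (cases "a = 0")
    case False
    have c: "Suc a < n" using a by simp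
    have T: "partial a (\<lambda>s. Y_hyp \<Phi> r s i) = (\<lambda>q. if i = Suc a then 1 else 0)" for i
      using False by (simp add: partial_Y_hyp)
    have V: "V k = christoffel n hyperbolic_metric k (Suc a) (Suc a) (Y_hyp \<Phi> r q)" for k
      unfolding V_def T sum_coordinate_direction[OF c] by simp
    have "V 0 = 0" "V 1 = 1 / Z"
      unfolding V using c False n by (simp_all add: \<Gamma>)
    then show ?thesis
      unfolding sff using False Z by (simp add: power2_eq_square Z1)
  next
    case a0: True
    define m where "m = n - 2"
    have nm: "n = Suc (Suc m)" using n by (simp add: m_def)
    define \<theta> where "\<theta> = q 0"
    define c s C S d where "c = cos (\<psi> \<theta>)" and "s = sin (\<psi> \<theta>)" and "C = cosh r" and "S = sinh r" and "d = D \<theta>"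
    note abbr = this
    have d: "d \<noteq> 0" "d = C - s * S" using D_pos[of \<theta>] by (simp_all add: abbr depth_def)
    have dd: "c\<^sup>2 + (S - C * s)\<^sup>2 = d\<^sup>2"
      using depth_square[of "\<psi> \<theta>" r] by (simp add: abbr power2_commute)
    have CC: "C\<^sup>2 = 1 + S\<^sup>2" by (simp add: abbr cosh_sinh_square)
    have Zd: "Z = P / d" unfolding Z_def \<Phi>1[OF less_imp_le[OF r]] by (simp add: abbr \<theta>_def)
    have P: "P \<noteq> 0" using p by simp
    have sum: "(\<Sum>i<n. \<Sum>j<n. M i j * partial a (\<lambda>s. Y_hyp \<Phi> r s i) q * partial a (\<lambda>s. Y_hyp \<Phi> r s j) q)
       = M 0 0 * dx \<theta> * dx \<theta> + M 0 1 * dx \<theta> * dz \<theta> + (M 1 0 * dz \<theta> * dx \<theta> + M 1 1 * dz \<theta> * dz \<theta>)"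
      for M :: "nat \<Rightarrow> nat \<Rightarrow> real"
      unfolding partial_Y_hyp a0 nm
      by (simp add: sum.lessThan_Suc_shift \<theta>_def del: sum.lessThan_Suc)
    have V0: "V 0 = ddx \<theta> - 2 * dx \<theta> * dz \<theta> / Z"
      unfolding V_def sum using n a0 Z by (simp add: partial_partial_Y_hyp \<Gamma> \<theta>_def)
    have V1: "V 1 = ddz \<theta> + ((dx \<theta>)\<^sup>2 - (dz \<theta>)\<^sup>2) / Z"
      unfolding V_def sum using n a0 Z
      by (simp add: partial_partial_Y_hyp \<Gamma> \<theta>_def power2_eq_square diff_divide_distrib)
    have \<sigma>\<sigma>: "\<sigma> * \<sigma> = 1" using \<sigma> by (simp add: power2_eq_square)
    have xz: "dx \<theta> * dz \<theta> / Z = (\<sigma> * \<sigma>) * P * S\<^sup>2 * (S - C * s) * c / d ^ 3"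
      "(dx \<theta>)\<^sup>2 / Z = (\<sigma> * \<sigma>) * P * S\<^sup>2 * (S - C * s)\<^sup>2 / d ^ 3"
      "(dz \<theta>)\<^sup>2 / Z = (\<sigma> * \<sigma>) * P * S\<^sup>2 * c\<^sup>2 / d ^ 3"
      using d(1) P unfolding Zd dx_def dz_def abbr[symmetric]
      by (simp_all add: power2_eq_square power3_eq_cube mult_ac)
    have V0': "V 0 = P * S * (- (C * c * d)) / d ^ 3"
    proof -
      have "V 0 = P * S * (2 * S * c * (S - C * s) - C * c * d) / d ^ 3 - 2 * (P * S\<^sup>2 * (S - C * s) * c / d ^ 3)"
        using xz(1) unfolding V0 \<sigma>\<sigma> ddx_def abbr[symmetric] by simp
      also have "\<dots> = (P * S * (2 * S * c * (S - C * s) - C * c * d) - 2 * (P * S\<^sup>2 * (S - C * s) * c)) / d ^ 3"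
        by (simp only: diff_divide_distrib times_divide_eq_right)
      also have "P * S * (2 * S * c * (S - C * s) - C * c * d) - 2 * (P * S\<^sup>2 * (S - C * s) * c) = P * S * (- (C * c * d))"
        by (simp add: power2_eq_square algebra_simps)
      finally show ?thesis .
    qed
    have V1': "V 1 = P * S * (C * (S - C * s) * d) / d ^ 3"
    proof -
      have "V 1 = P * S * (2 * S * c\<^sup>2 - s * d) / d ^ 3 + (P * S\<^sup>2 * (S - C * s)\<^sup>2 / d ^ 3 - P * S\<^sup>2 * c\<^sup>2 / d ^ 3)"
        using xz(2,3) unfolding V1 \<sigma>\<sigma> ddz_def abbr[symmetric] diff_divide_distrib by simp
      also have "\<dots> = P * S * (S * (c\<^sup>2 + (S - C * s)\<^sup>2) - s * d) / d ^ 3"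
        by (simp only: diff_divide_distrib[symmetric] add_divide_distrib[symmetric])
          (simp add: power2_eq_square algebra_simps)
      also have "S * (c\<^sup>2 + (S - C * s)\<^sup>2) - s * d = d * (S * C - s * (1 + S\<^sup>2))"
        unfolding dd power2_eq_square[of d] by (subst (2) d(2)) (simp add: power2_eq_square algebra_simps)
      also have "\<dots> = C * (S - C * s) * d"
        unfolding CC[symmetric] by (simp add: power2_eq_square algebra_simps)
      finally show ?thesis .
    qed
    have "V 0 * \<nu>0 \<theta> + V 1 * \<nu>1 \<theta> = - (P * S * C / d ^ 3) * (c\<^sup>2 + (S - C * s)\<^sup>2)"
      using d(1) unfolding V0' V1' \<nu>0_def \<nu>1_def abbr[symmetric]
      by (simp add: divide_simps power2_eq_square power3_eq_cube) (simp add: algebra_simps)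
    also have "\<dots> = - (S * C * Z)"
      unfolding dd Zd using d(1) by (simp add: power2_eq_square power3_eq_cube)
    finally show ?thesis
      unfolding sff \<theta>_def[symmetric] using a0 Z by (simp add: abbr)
  qed
qed

lemma mean_curvature_hyp:
  assumes n: "n \<ge> 3"
  shows "mean_curvature n hyperbolic_metric (X_hyp \<Phi> r) (Y_hyp \<Phi> r) q
     = cosh r / sinh r - (real n - 2) * \<nu>1 (q 0)"
proof -
  define Z where "Z = \<Phi> r (q 0) 1"
  have Z: "Z > 0" using height_pos by (simp add: Z_def)
  have S: "sinh r > 0" using r by simp
  define d where "d a = (if a = 0 then (sinh r)\<^sup>2 else (1 / Z)\<^sup>2)" for a :: nat
  define m where "m = n - 2"
  have m: "n - 1 = Suc m" "real m = real n - 2" using n by (simp_all add: m_def)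
  have "mean_curvature n hyperbolic_metric (X_hyp \<Phi> r) (Y_hyp \<Phi> r) q
     = (\<Sum>a<n - 1. second_fundamental_form n hyperbolic_metric (Y_hyp \<Phi> r) q (hyp_normal q) a a / d a)"
    by (rule mean_curvature_diagonal[OF hyp_normal_outward[OF n] hyp_normal_unique[OF n]])
      (use Z S in \<open>auto simp: induced_Y_hyp[OF n] d_def Z_def\<close>)
  also have "\<dots> = (\<Sum>a<n - 1. if a = 0 then cosh r / sinh r else - \<nu>1 (q 0))"
    using Z S by (intro sum.cong)
      (auto simp: second_fundamental_form_hyp[OF n] d_def power2_eq_square Z_def)
  also have "\<dots> = cosh r / sinh r - (real n - 2) * \<nu>1 (q 0)"
    unfolding m(1) by (simp add: sum.lessThan_Suc_shift m(2) del: sum.lessThan_Suc)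
  finally show ?thesis .
qed

end

section \<open>Comparison for a high centre\<close>

lemma exp_minus_cancel: "exp (- r) * exp r = 1" for r :: real
  by (simp flip: exp_add)

lemma exp_scale: "2 * k = 2 * exp r * k * exp (- r)" for k r :: real
proof -
  have "2 * exp r * k * exp (- r) = 2 * k * (exp (- r) * exp r)"
    by (simp only: mult_ac)
  then show ?thesis
    by (simp only: exp_minus_cancel mult_1_right)
qed

context polar_chart
begin

text \<open>
  The derivatives of the warping function \<open>1 / z(r, \<theta>) = D \<theta> / P\<close>.
\<close>

definition warp' :: "real \<Rightarrow> real" where
  "warp' \<theta> = - (\<sigma> * sinh r * cos (\<psi> \<theta>)) / P"
definition warp'' :: "real \<Rightarrow> real" where
  "warp'' \<theta> = sinh r * sin (\<psi> \<theta>) / P"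

lemma comparison_warp:
  assumes "n \<ge> 3"
  shows "comparison n r (\<lambda>\<rho> \<theta>. \<Phi> \<rho> \<theta> 1) warp' warp''"
proof
  show "n \<ge> 3" "r > 0" by (rule assms r)+
  show "\<Phi> r \<theta> 1 > 0" for \<theta> by (rule height_pos)
  have w: "(\<lambda>\<theta>. 1 / \<Phi> r \<theta> 1) = (\<lambda>\<theta>. D \<theta> / P)"
    unfolding \<Phi>1[OF less_imp_le[OF r]] by simp
  show "((\<lambda>\<theta>. 1 / \<Phi> r \<theta> 1) has_real_derivative warp' \<theta>) (at \<theta>)" for \<theta>
    unfolding w warp'_def by (rule DERIV_cdivide[OF D_deriv])
  have "(warp' has_real_derivative (\<sigma> * \<sigma>) * sinh r * sin (\<psi> \<theta>) / P) (at \<theta>)" for \<theta>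
    unfolding warp'_def[abs_def] using p by (auto intro!: derivative_eq_intros)
  then show "(warp' has_real_derivative warp'' \<theta>) (at \<theta>)" for \<theta>
    using \<sigma> by (simp add: warp''_def power2_eq_square)
qed

lemma height_ge: "\<Phi> r \<theta> 1 \<ge> P * exp (- r)"
proof -
  have "P * exp (- r) * D \<theta> \<le> P * exp (- r) * exp r"
    using p depth_bounds(2)[of r "\<psi> \<theta>"] r by (intro mult_left_mono) auto
  also have "\<dots> = P"
    by (simp only: mult.assoc exp_minus_cancel mult_1_right)
  finally have "P * exp (- r) * D \<theta> \<le> P" .
  then show ?thesis
    unfolding \<Phi>1[OF less_imp_le[OF r]] using D_pos[of \<theta>] by (simp add: pos_le_divide_eq)
qed

text \<open>
  The factor \<open>P\<close> cancels from \<open>w'' / w\<close> and \<open>w' / w\<close>, and \<open>D \<ge> exp (- r)\<close> bounds what is left.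
\<close>

lemma scalar_curvature_ge:
  assumes n: "n \<ge> 3" and x: "x \<in> X_bar"
  shows "scalar_curvature n (g_bar (\<lambda>\<rho> \<theta>. \<Phi> \<rho> \<theta> 1) r) x
    \<ge> 1 / 2 * (\<Phi> r (x 0) 1)\<^sup>2 - (2 * (real n - 1) * (exp r / sinh r) + (real n - 1) * (real n - 2) * (exp r)\<^sup>2)"
proof -
  interpret comparison n r "\<lambda>\<rho> \<theta>. \<Phi> \<rho> \<theta> 1" warp' warp''
    by (rule comparison_warp[OF n])
  define \<theta> d where "\<theta> = x 0" and "d = D \<theta>"
  have S: "sinh r > 0" using r by simp
  have d: "d > 0" by (simp only: d_def D_pos)
  have "exp (- r) \<le> d"
    using depth_bounds(1)[of r "\<psi> \<theta>"] r by (simp add: d_def)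
  then have inv_d: "1 / d \<le> exp r"
    using d by (simp add: exp_minus field_simps)
  have inv_d0: "0 \<le> 1 / d" using d by simp
  have z: "\<Phi> r \<theta> 1 = P / d"
    unfolding \<Phi>1[OF less_imp_le[OF r]] d_def ..
  have "warp'' \<theta> * \<Phi> r \<theta> 1 / (sinh r)\<^sup>2 = sin (\<psi> \<theta>) * (1 / d / sinh r)"
    unfolding warp''_def z using p S by (simp add: power2_eq_square)
  also have "\<dots> \<le> 1 * (exp r / sinh r)"
    using S inv_d inv_d0 by (intro mult_mono divide_right_mono) auto
  finally have 1: "warp'' \<theta> * \<Phi> r \<theta> 1 / (sinh r)\<^sup>2 \<le> exp r / sinh r" by simp
  have "(warp' \<theta> * \<Phi> r \<theta> 1)\<^sup>2 / (sinh r)\<^sup>2 = \<sigma>\<^sup>2 * (cos (\<psi> \<theta>))\<^sup>2 * (1 / d)\<^sup>2"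
    unfolding warp'_def z using p S by (simp add: power2_eq_square)
  also have "\<dots> \<le> 1 * (exp r)\<^sup>2"
    unfolding \<sigma> using inv_d inv_d0 by (intro mult_mono power_mono) (auto simp: abs_square_le_1)
  finally have 2: "(warp' \<theta> * \<Phi> r \<theta> 1)\<^sup>2 / (sinh r)\<^sup>2 \<le> (exp r)\<^sup>2" by simp
  have "2 * (real n - 1) * (warp'' \<theta> * \<Phi> r \<theta> 1 / (sinh r)\<^sup>2) \<le> 2 * (real n - 1) * (exp r / sinh r)"
    using 1 n by (intro mult_left_mono) auto
  moreover have "(real n - 1) * (real n - 2) * ((warp' \<theta> * \<Phi> r \<theta> 1)\<^sup>2 / (sinh r)\<^sup>2)
      \<le> (real n - 1) * (real n - 2) * (exp r)\<^sup>2"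
    using 2 n by (intro mult_left_mono) auto
  ultimately show ?thesis
    unfolding scalar_curvature_g_bar[OF x] \<theta>_def[symmetric] times_divide_eq_right[symmetric] by linarith
qed

text \<open>
  The hyperbolic side is at most \<open>coth r + (n - 2)\<close>, the other side exceeds \<open>z / 2\<close>, and
  \<open>z \<ge> P exp (- r)\<close>.
\<close>

lemma mean_curvature_comparison:
  assumes n: "n \<ge> 3" and high: "P \<ge> 2 * exp r * (cosh r / sinh r + real n)"
  shows "mean_curvature n (g_bar (\<lambda>\<rho> \<theta>. \<Phi> \<rho> \<theta> 1) r) X_bar Y_bar q
     > mean_curvature n hyperbolic_metric (X_hyp \<Phi> r) (Y_hyp \<Phi> r) q"
proof -
  interpret comparison n r "\<lambda>\<rho> \<theta>. \<Phi> \<rho> \<theta> 1" warp' warp''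
    by (rule comparison_warp[OF n])
  define z where "z = \<Phi> r (q 0) 1"
  have z: "z > 0" unfolding z_def by (rule height_pos)
  have "(\<nu>1 (q 0))\<^sup>2 \<le> 1"
    using \<nu>_unit[of "q 0"] zero_le_power2[of "\<nu>0 (q 0)"] by linarith
  then have "- 1 \<le> \<nu>1 (q 0)"
    by (simp add: abs_square_le_1 abs_le_iff)
  then have "(real n - 2) * (- 1) \<le> (real n - 2) * \<nu>1 (q 0)"
    using n by (intro mult_left_mono) auto
  then have "- (real n - 2) \<le> (real n - 2) * \<nu>1 (q 0)"
    by (simp only: mult_minus_right mult_1_right)
  then have "mean_curvature n hyperbolic_metric (X_hyp \<Phi> r) (Y_hyp \<Phi> r) q \<le> cosh r / sinh r + real n"
    unfolding mean_curvature_hyp[OF n] by linarith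
  also have "\<dots> \<le> z / 2"
  proof -
    have "2 * (cosh r / sinh r + real n) = 2 * exp r * (cosh r / sinh r + real n) * exp (- r)"
      by (rule exp_scale)
    also have "\<dots> \<le> P * exp (- r)"
      using high by (intro mult_right_mono) auto
    also have "\<dots> \<le> z" unfolding z_def by (rule height_ge)
    finally show ?thesis by (simp only: le_divide_eq_numeral1 mult.commute[of _ 2])
  qed
  also have "\<dots> < sqrt 3 / 2 * z"
    using z by simp
  finally show ?thesis
    unfolding mean_curvature_bar z_def .
qed

end

lemma polar_chart_exists:
  assumes "geodesic_polar_coordinates p \<Phi>" "p 1 > 0" "r > 0"
  obtains \<alpha> \<sigma> where "polar_chart p \<Phi> r \<alpha> \<sigma>"
  using polar_coordinates_formula[OF assms(1,2)] assms(2,3) unfolding polar_chart_def by metis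

theorem proposition2p6:
  fixes n :: nat and r :: real
  assumes "n \<ge> 3" and "r > 0"
  shows
    "(\<exists>C>0. \<forall>p \<Phi>. p 1 > 0 \<longrightarrow> geodesic_polar_coordinates p \<Phi> \<longrightarrow>
        (\<forall>x\<in>X_bar. scalar_curvature n (g_bar (\<lambda>\<rho> \<theta>. \<Phi> \<rho> \<theta> 1) r) x
           \<ge> 1 / 2 * (\<Phi> r (x 0) 1)\<^sup>2 - C))
     \<and>
     (\<exists>z0>0. \<forall>p \<Phi>. p 1 \<ge> z0 \<longrightarrow> geodesic_polar_coordinates p \<Phi> \<longrightarrow>
        (\<forall>x\<in>X_bar. scalar_curvature n (g_bar (\<lambda>\<rho> \<theta>. \<Phi> \<rho> \<theta> 1) r) x > - (real n * (real n - 1))))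
     \<and>
     (\<forall>p \<Phi>. p 1 > 0 \<longrightarrow> geodesic_polar_coordinates p \<Phi> \<longrightarrow>
        (\<forall>q. \<forall>a<n - 1. \<forall>b<n - 1.
           induced_metric n hyperbolic_metric (Y_hyp \<Phi> r) q a b
           = induced_metric n (g_bar (\<lambda>\<rho> \<theta>. \<Phi> \<rho> \<theta> 1) r) Y_bar q a b))
     \<and>
     (\<exists>z0>0. \<forall>p \<Phi>. p 1 \<ge> z0 \<longrightarrow> geodesic_polar_coordinates p \<Phi> \<longrightarrow>
        (\<forall>q. mean_curvature n (g_bar (\<lambda>\<rho> \<theta>. \<Phi> \<rho> \<theta> 1) r) X_bar Y_bar q
           > mean_curvature n hyperbolic_metric (X_hyp \<Phi> r) (Y_hyp \<Phi> r) q))"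
proof (intro conjI)
  define C where "C = 2 * (real n - 1) * (exp r / sinh r) + (real n - 1) * (real n - 2) * (exp r)\<^sup>2"
  have S: "sinh r > 0" using assms(2) by simp
  have C: "C > 0"
    unfolding C_def using assms S by (intro add_pos_pos mult_pos_pos divide_pos_pos) auto
  have bound: "scalar_curvature n (g_bar (\<lambda>\<rho> \<theta>. \<Phi> \<rho> \<theta> 1) r) x \<ge> 1 / 2 * (\<Phi> r (x 0) 1)\<^sup>2 - C"
    if p: "p 1 > 0" and polar: "geodesic_polar_coordinates p \<Phi>" and x: "x \<in> X_bar" for p \<Phi> x
  proof -
    obtain \<alpha> \<sigma> where chart: "polar_chart p \<Phi> r \<alpha> \<sigma>"
      using polar_chart_exists[OF polar p assms(2)] .
    show ?thesis
      unfolding C_def by (rule polar_chart.scalar_curvature_ge[OF chart assms(1) x])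
  qed
  then show "\<exists>C>0. \<forall>p \<Phi>. p 1 > 0 \<longrightarrow> geodesic_polar_coordinates p \<Phi> \<longrightarrow>
        (\<forall>x\<in>X_bar. scalar_curvature n (g_bar (\<lambda>\<rho> \<theta>. \<Phi> \<rho> \<theta> 1) r) x \<ge> 1 / 2 * (\<Phi> r (x 0) 1)\<^sup>2 - C)"
    using C by blast
  show "\<exists>z0>0. \<forall>p \<Phi>. p 1 \<ge> z0 \<longrightarrow> geodesic_polar_coordinates p \<Phi> \<longrightarrow>
        (\<forall>x\<in>X_bar. scalar_curvature n (g_bar (\<lambda>\<rho> \<theta>. \<Phi> \<rho> \<theta> 1) r) x > - (real n * (real n - 1)))"
  (* This height makes z at least 2 (C + 1), so that z^2 / 2 exceeds C. *)
  proof (intro exI[of _ "2 * exp r * (C + 1)"] conjI allI impI ballI)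
    show "2 * exp r * (C + 1) > 0" using C by simp
    fix p :: point and \<Phi> x
    assume high: "2 * exp r * (C + 1) \<le> p 1" and polar: "geodesic_polar_coordinates p \<Phi>" and x: "x \<in> X_bar"
    have "2 * exp r * (C + 1) > 0" using C by simp
    with high have p: "p 1 > 0" by linarith
    obtain \<alpha> \<sigma> where chart: "polar_chart p \<Phi> r \<alpha> \<sigma>"
      using polar_chart_exists[OF polar p assms(2)] .
    have "2 * (C + 1) = 2 * exp r * (C + 1) * exp (- r)"
      by (rule exp_scale)
    also have "\<dots> \<le> p 1 * exp (- r)"
      using high by (intro mult_right_mono) auto
    also have "\<dots> \<le> \<Phi> r (x 0) 1"
      by (rule polar_chart.height_ge[OF chart])
    finally have "(2 * (C + 1))\<^sup>2 \<le> (\<Phi> r (x 0) 1)\<^sup>2"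
      using C by (intro power_mono) auto
    moreover have "(2 * (C + 1))\<^sup>2 = 4 * C\<^sup>2 + 8 * C + 4"
      by (simp add: power2_eq_square algebra_simps)
    ultimately have "1 / 2 * (\<Phi> r (x 0) 1)\<^sup>2 - C > 0"
      using C zero_le_power2[of C] by linarith
    moreover have "real n * (real n - 1) \<ge> 0" using assms(1) by simp
    ultimately show "scalar_curvature n (g_bar (\<lambda>\<rho> \<theta>. \<Phi> \<rho> \<theta> 1) r) x > - (real n * (real n - 1))"
      using bound[OF p polar x] by linarith
  qed
  show "\<forall>p \<Phi>. p 1 > 0 \<longrightarrow> geodesic_polar_coordinates p \<Phi> \<longrightarrow>
        (\<forall>q. \<forall>a<n - 1. \<forall>b<n - 1.
           induced_metric n hyperbolic_metric (Y_hyp \<Phi> r) q a b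
           = induced_metric n (g_bar (\<lambda>\<rho> \<theta>. \<Phi> \<rho> \<theta> 1) r) Y_bar q a b)"
  proof (intro allI impI)
    fix p :: point and \<Phi> and q :: point and a b
    assume p: "p 1 > 0" and polar: "geodesic_polar_coordinates p \<Phi>" and ab: "a < n - 1" "b < n - 1"
    obtain \<alpha> \<sigma> where chart: "polar_chart p \<Phi> r \<alpha> \<sigma>"
      using polar_chart_exists[OF polar p assms(2)] .
    show "induced_metric n hyperbolic_metric (Y_hyp \<Phi> r) q a b
        = induced_metric n (g_bar (\<lambda>\<rho> \<theta>. \<Phi> \<rho> \<theta> 1) r) Y_bar q a b"
      unfolding polar_chart.induced_Y_hyp[OF chart assms(1) ab]
        comparison.induced_Y_bar[OF polar_chart.comparison_warp[OF chart assms(1)] ab] ..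
  qed
  show "\<exists>z0>0. \<forall>p \<Phi>. p 1 \<ge> z0 \<longrightarrow> geodesic_polar_coordinates p \<Phi> \<longrightarrow>
        (\<forall>q. mean_curvature n (g_bar (\<lambda>\<rho> \<theta>. \<Phi> \<rho> \<theta> 1) r) X_bar Y_bar q
           > mean_curvature n hyperbolic_metric (X_hyp \<Phi> r) (Y_hyp \<Phi> r) q)"
  proof (intro exI[of _ "2 * exp r * (cosh r / sinh r + real n)"] conjI allI impI)
    have "cosh r / sinh r + real n > 0"
      using S by (intro add_pos_nonneg divide_pos_pos) auto
    then show pos: "2 * exp r * (cosh r / sinh r + real n) > 0" by simp
    fix p :: point and \<Phi> and q :: point
    assume high: "2 * exp r * (cosh r / sinh r + real n) \<le> p 1" and polar: "geodesic_polar_coordinates p \<Phi>"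
    have p: "p 1 > 0" using high pos by linarith
    obtain \<alpha> \<sigma> where chart: "polar_chart p \<Phi> r \<alpha> \<sigma>"
      using polar_chart_exists[OF polar p assms(2)] .
    show "mean_curvature n (g_bar (\<lambda>\<rho> \<theta>. \<Phi> \<rho> \<theta> 1) r) X_bar Y_bar q
        > mean_curvature n hyperbolic_metric (X_hyp \<Phi> r) (Y_hyp \<Phi> r) q"
      by (rule polar_chart.mean_curvature_comparison[OF chart assms(1) high])
  qed
qed

end
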